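(* Let $d\in\{1,2\}$ and $\mu<0$. For every $K\in\mathbb{T}^d$ the essential spectrum of the bounded self-adjoint operator $H_\mu(K)$ is $$\sigma_{\mathrm{ess}}(H_\mu(K))=\bigcup_{k\in\mathbb{T}^d}\{e_\mu(k)+\varepsilon(K-k)\}\ \cup\ [E_{\min}(K),E_{\max}(K)],$$ where $e_\mu(k)$ is the unique eigenvalue of the two-particle operator $h_\mu(k)$.
   Context: $\mathbb{T}^d=(-\pi,\pi]^d$ is the $d$-dimensional torus (addition modulo $2\pi$ in each coordinate), with normalized Haar measure $\eta(dp)=(2\pi)^{-d}dp$; all $L^2$ spaces are with respect to $\eta$ and its products. Put $\varepsilon(p)=\sum_{i=1}^d(1-\cos p^{(i)})$ for $p=(p^{(1)},\dots,p^{(d)})$. Two-particle operator: for $k\in\mathbb{T}^d$ (represented in $(-\pi,\pi]^d$), $h_\mu(k)$ acts on the space $L^{2,e}(\mathbb{T}^d)$ of even functions in $L^2(\mathbb{T}^d)$ by $(h_\mu(k)f)(p)=\mathcal{E}_k(p)f(p)+\mu\int_{\mathbb{T}^d}f(q)\,\eta(dq)$, where $\mathcal{E}_k(p)=\varepsilon(\tfrac{k}{2}-p)+\varepsilon(\tfrac{k}{2}+p)$. It is known that, for every $\mu<0$, $d=1,2$ and $k\in\mathbb{T}^d$, $h_\mu(k)$ has a unique eigenvalue $e_\mu(k)$, and that $e_\mu(k)<\min_p\mathcal{E}_k(p)$. Three-particle operator: let $E(K;p,q)=\varepsilon(K-p-q)+\varepsilon(p)+\varepsilon(q)$, $E_{\min}(K)=\min_{p,q\in\mathbb{T}^d}E(K;p,q)$,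 $E_{\max}(K)=\max_{p,q\in\mathbb{T}^d}E(K;p,q)$. Let $L^{2,s}[(\mathbb{T}^d)^2]$ denote (for given $K$) the closed subspace of those $f\in L^2((\mathbb{T}^d)^2)$ with $f(p,q)=f(q,p)=f(p,K-p-q)$ for a.e. $(p,q)$ (the functions which, with third momentum $K-p-q$, are symmetric in all three bosons). On it, $H_\mu(K)$ acts by $$(H_\mu(K)f)(p,q)=E(K;p,q)f(p,q)+\mu\Big[\int_{\mathbb{T}^d}f(p,t)\eta(dt)+\int_{\mathbb{T}^d}f(t,q)\eta(dt)+\int_{\mathbb{T}^d}f(t,K-p-q)\eta(dt)\Big].$$
   Formalization: e_μ(k) is taken to be the unique eigenvalue of h_μ(k) lying below min_p E_k(p); for k=(π,…,π), where E_k is constant, 2d is a second eigenvalue (of infinite multiplicity), so "the unique eigenvalue" is literally undefined there. *)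

theory Defs
  imports "HOL-Analysis.Analysis" "HOL-Library.Real_Mod"
begin

text \<open>
  Elements of $L^2(M)$ are represented by square-integrable functions, and equality in $L^2(M)$
  is equality almost everywhere. A closed subspace is given by a set \<open>V\<close> of representatives
  (closed under almost-everywhere equality among square-integrable functions), and an operator
  on it by a map \<open>T\<close> on representatives that sends \<open>V\<close> to \<open>V\<close> and respects almost-everywhere
  equality.
\<close>

definition L2 :: "'a measure \<Rightarrow> ('a \<Rightarrow> complex) set" where
  "L2 M = {f \<in> borel_measurable M. integrable M (\<lambda>x. (cmod (f x))\<^sup>2)}"

definition L2_norm :: "'a measure \<Rightarrow> ('a \<Rightarrow> complex) \<Rightarrow> real" where
  "L2_norm M f = sqrt (\<integral>x. (cmod (f x))\<^sup>2 \<partial>M)"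

definition eigenspace ::
  "'a measure \<Rightarrow> ('a \<Rightarrow> complex) set \<Rightarrow> (('a \<Rightarrow> complex) \<Rightarrow> 'a \<Rightarrow> complex) \<Rightarrow> complex
    \<Rightarrow> ('a \<Rightarrow> complex) set" where
  "eigenspace M V T z = {f \<in> V. AE x in M. T f x = z * f x}"

definition is_eigenvalue ::
  "'a measure \<Rightarrow> ('a \<Rightarrow> complex) set \<Rightarrow> (('a \<Rightarrow> complex) \<Rightarrow> 'a \<Rightarrow> complex) \<Rightarrow> complex \<Rightarrow> bool" where
  "is_eigenvalue M V T z \<longleftrightarrow> (\<exists>f \<in> eigenspace M V T z. \<not> (AE x in M. f x = 0))"

definition finite_multiplicity ::
  "'a measure \<Rightarrow> ('a \<Rightarrow> complex) set \<Rightarrow> (('a \<Rightarrow> complex) \<Rightarrow> 'a \<Rightarrow> complex) \<Rightarrow> complex \<Rightarrow> bool" where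
  "finite_multiplicity M V T z \<longleftrightarrow>
    (\<exists>B. finite B \<and> B \<subseteq> eigenspace M V T z \<and>
      (\<forall>f \<in> eigenspace M V T z. \<exists>c. AE x in M. f x = (\<Sum>b\<in>B. c b * b x)))"

text \<open>
  The first conjunct says that \<open>T - z\<close> is onto; the second that it is injective with bounded inverse.
\<close>

definition resolvent_set ::
  "'a measure \<Rightarrow> ('a \<Rightarrow> complex) set \<Rightarrow> (('a \<Rightarrow> complex) \<Rightarrow> 'a \<Rightarrow> complex) \<Rightarrow> complex set" where
  "resolvent_set M V T =
    {z. (\<forall>g \<in> V. \<exists>f \<in> V. AE x in M. T f x - z * f x = g x) \<and>
        (\<exists>C. \<forall>f \<in> V. L2_norm M f \<le> C * L2_norm M (\<lambda>x. T f x - z * f x))}"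

definition spectrum ::
  "'a measure \<Rightarrow> ('a \<Rightarrow> complex) set \<Rightarrow> (('a \<Rightarrow> complex) \<Rightarrow> 'a \<Rightarrow> complex) \<Rightarrow> complex set" where
  "spectrum M V T = - resolvent_set M V T"

definition discrete_spectrum ::
  "'a measure \<Rightarrow> ('a \<Rightarrow> complex) set \<Rightarrow> (('a \<Rightarrow> complex) \<Rightarrow> 'a \<Rightarrow> complex) \<Rightarrow> complex set" where
  "discrete_spectrum M V T =
    {z. z isolated_in spectrum M V T \<and> is_eigenvalue M V T z \<and> finite_multiplicity M V T z}"

text \<open>For self-adjoint \<open>T\<close>; for general operators several inequivalent notions are in use.\<close>

definition essential_spectrum ::
  "'a measure \<Rightarrow> ('a \<Rightarrow> complex) set \<Rightarrow> (('a \<Rightarrow> complex) \<Rightarrow> 'a \<Rightarrow> complex) \<Rightarrow> complex set" where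
  "essential_spectrum M V T = spectrum M V T - discrete_spectrum M V T"

definition torus :: "(real ^ 'n) set" where
  "torus = {p. \<forall>i. - pi < p $ i \<and> p $ i \<le> pi}"

text \<open>The representative in \<open>torus\<close> of a point modulo $2\pi$ in each coordinate.\<close>

definition wrap :: "real ^ 'n \<Rightarrow> real ^ 'n" where
  "wrap p = (\<chi> i. pi - ((pi - p $ i) rmod (2 * pi)))"

lemma wrap_in_torus: "wrap p \<in> torus"
proof -
  have "0 \<le> x rmod (2 * pi)" "x rmod (2 * pi) < 2 * pi" for x
    by (auto intro!: rmod_nonneg rmod_less)
  from this[of "pi - p $ i" for i] show ?thesis
    by (auto simp: wrap_def torus_def algebra_simps)
qed

lemma wrap_eq_mod: "\<exists>m::int. wrap p $ i = p $ i + 2 * pi * m"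
  by (auto simp: wrap_def rmod_def algebra_simps)

definition haar :: "(real ^ 'n) measure" where
  "haar = scale_measure (ennreal (1 / (2 * pi) ^ CARD('n))) (restrict_space lborel torus)"

definition \<epsilon> :: "real ^ 'n \<Rightarrow> real" where
  "\<epsilon> p = (\<Sum>i\<in>UNIV. 1 - cos (p $ i))"

definition L2_even :: "(real ^ 'n \<Rightarrow> complex) set" where
  "L2_even = {f \<in> L2 haar. AE p in haar. f (wrap (- p)) = f p}"

definition E_two :: "real ^ 'n \<Rightarrow> real ^ 'n \<Rightarrow> real" where
  "E_two k p = \<epsilon> ((1/2) *\<^sub>R k - p) + \<epsilon> ((1/2) *\<^sub>R k + p)"

definition h_op :: "real \<Rightarrow> real ^ 'n \<Rightarrow> (real ^ 'n \<Rightarrow> complex) \<Rightarrow> real ^ 'n \<Rightarrow> complex" where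
  "h_op \<mu> k f p = of_real (E_two k p) * f p + of_real \<mu> * (\<integral>q. f q \<partial>haar)"

text \<open>
  The eigenvalue $e_\mu(k)$ of $h_\mu(k)$ is the unique one below the minimum of \<open>E_two k\<close>.
  The restriction only matters at $k = (\pi,\dots,\pi)$: there \<open>E_two k\<close> is constantly $2d$,
  and $2d$ is a second eigenvalue, of infinite multiplicity, besides $e_\mu(k) = 2d + \mu$.
\<close>

definition e_two :: "real \<Rightarrow> real ^ 'n \<Rightarrow> real" where
  "e_two \<mu> k = (THE z. is_eigenvalue haar L2_even (h_op \<mu> k) (of_real z) \<and> z < (INF p\<in>torus. E_two k p))"

definition E_three :: "real ^ 'n \<Rightarrow> real ^ 'n \<Rightarrow> real ^ 'n \<Rightarrow> real" where
  "E_three K p q = \<epsilon> (K - p - q) + \<epsilon> p + \<epsilon> q"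

definition E_min :: "real ^ 'n \<Rightarrow> real" where
  "E_min K = (INF (p, q) \<in> torus \<times> torus. E_three K p q)"

definition E_max :: "real ^ 'n \<Rightarrow> real" where
  "E_max K = (SUP (p, q) \<in> torus \<times> torus. E_three K p q)"

definition L2_sym :: "real ^ 'n \<Rightarrow> ((real ^ 'n) \<times> (real ^ 'n) \<Rightarrow> complex) set" where
  "L2_sym K = {f \<in> L2 (haar \<Otimes>\<^sub>M haar).
     AE (p, q) in haar \<Otimes>\<^sub>M haar. f (p, q) = f (q, p) \<and> f (p, q) = f (p, wrap (K - p - q))}"

definition H_op :: "real \<Rightarrow> real ^ 'n \<Rightarrow> ((real ^ 'n) \<times> (real ^ 'n) \<Rightarrow> complex)
    \<Rightarrow> (real ^ 'n) \<times> (real ^ 'n) \<Rightarrow> complex" where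
  "H_op \<mu> K f = (\<lambda>(p, q). of_real (E_three K p q) * f (p, q) +
     of_real \<mu> * ((\<integral>t. f (p, t) \<partial>haar) + (\<integral>t. f (t, q) \<partial>haar) +
                  (\<integral>t. f (t, wrap (K - p - q)) \<partial>haar)))"

end

theory Submission
  imports Defs "HOL-Complex_Analysis.Great_Picard" "HOL-Probability.Probability_Measure"
begin

text \<open>
  For a bounded symmetric operator \<open>T\<close> and real \<open>z\<close>: if approximate eigenvectors at \<open>z\<close> are relatively
  compact, then \<open>z\<close> belongs to the resolvent set or to the discrete spectrum; if \<open>T - z\<close> is not bounded
  below, then \<open>z\<close> belongs to the spectrum. So it suffices to show that the set on the right-hand side
  has no isolated points, that \<open>H - z\<close> is not bounded below for \<open>z\<close> in it, and that compactness holds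
  for \<open>z\<close> outside.

  On symmetric functions \<open>H\<close> acts as \<open>E f + \<mu> (\<phi>(p) + \<phi>(q) + \<phi>(K - p - q))\<close>, where \<open>\<phi>\<close> is the marginal
  of \<open>f\<close>. With \<open>R = 1 / (E - z)\<close>, an equation \<open>(H - z) f = g\<close> becomes the Faddeev equation
  \<open>(1 + \<mu> r(p)) \<phi>(p) + 2 \<mu> \<integral> R(p, q) \<phi>(q) dq = \<integral> R(p, q) g(p, q) dq\<close>, where \<open>r(p) = \<integral> R(p, q) dq\<close>. The
  integral operator is compact, and \<open>1 + \<mu> r(p)\<close> vanishes exactly when \<open>z = e\<^sub>\<mu>(k) + \<epsilon>(K - k)\<close> for
  \<open>k = K - p\<close>. At such a zero, and at every value of \<open>E\<close>, concentrated trial functions show that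
  \<open>H - z\<close> is not bounded below.
\<close>

section \<open>Square-integrable functions\<close>

text \<open>The condition \<open>d = 1, 2\<close> enters through the threshold of the pair:
  \<open>E_two k\<close> grows at most quadratically from its minimum, so the integral of
  \<open>1 / (E_two k - z)\<close> is unbounded as \<open>z\<close> rises to that minimum, and every
  \<open>\<mu> < 0\<close> yields an eigenvalue below it. The momentum \<open>k = K - p\<close> is
  that of the pair left when one boson carries \<open>p\<close>. In the coordinates
  \<open>k/2 - q\<close> and \<open>k/2 + q\<close> the energy \<open>E\<close> becomes
  \<open>\<epsilon> (K - k) + E_two k q\<close>, so \<open>1 + \<mu> r(p)\<close> is the determinant
  of the rank-one perturbation \<open>h_op \<mu> k\<close> at \<open>z - \<epsilon> (K - k)\<close>.
  The factor 2 arises because \<open>q\<close> and \<open>K - p - q\<close> are exchanged by a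
  reflection that preserves both the measure and \<open>R(p, _)\<close>. A flat two-particle branch
  below the interval would be a single point, and an isolated point of the spectrum is essential
  only if its multiplicity is infinite. Nonconstancy of \<open>r\<close> on the connected torus
  excludes this case. Vectors are representatives, and \<open>H_op\<close> integrates along
  different sections of them; its description by one marginal holds only almost everywhere.\<close>

lemma L2_measurable: "f \<in> L2 M \<Longrightarrow> f \<in> borel_measurable M"
  by (simp add: L2_def)

lemma L2_integrable_sq: "f \<in> L2 M \<Longrightarrow> integrable M (\<lambda>x. (cmod (f x))\<^sup>2)"
  by (simp add: L2_def)

lemma L2_norm_nonneg [simp]: "0 \<le> L2_norm M f"
  by (simp add: L2_norm_def)

lemma L2_norm_power2: "(L2_norm M f)\<^sup>2 = (\<integral>x. (cmod (f x))\<^sup>2 \<partial>M)"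
  by (simp add: L2_norm_def)

lemma L2_norm_leI:
  assumes "(\<integral>x. (cmod (f x))\<^sup>2 \<partial>M) \<le> c\<^sup>2" "0 \<le> c"
  shows "L2_norm M f \<le> c"
  using assms by (metis L2_norm_power2 power2_le_imp_le)

lemma L2_norm_cong_AE:
  assumes "f \<in> borel_measurable M" "g \<in> borel_measurable M" "AE x in M. f x = g x"
  shows "L2_norm M f = L2_norm M g"
  unfolding L2_norm_def using assms by (intro arg_cong[where f=sqrt] integral_cong_AE) auto

lemma L2_cong_AE:
  assumes "f \<in> L2 M" "g \<in> borel_measurable M" "AE x in M. f x = g x"
  shows "g \<in> L2 M"
proof -
  have [measurable]: "f \<in> borel_measurable M" "g \<in> borel_measurable M"
    using assms by (auto simp: L2_def)
  have "integrable M (\<lambda>x. (cmod (g x))\<^sup>2)"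
    by (rule integrable_cong_AE_imp[OF L2_integrable_sq[OF assms(1)]]) (use assms(3) in auto)
  then show ?thesis by (simp add: L2_def)
qed

lemma L2_dominated:
  assumes g: "g \<in> L2 M" and f: "f \<in> borel_measurable M" and "0 \<le> c"
    and le: "AE x in M. cmod (f x) \<le> c * cmod (g x)"
  shows "f \<in> L2 M" "L2_norm M f \<le> c * L2_norm M g"
proof -
  have [measurable]: "f \<in> borel_measurable M" by fact
  have i: "integrable M (\<lambda>x. c\<^sup>2 * (cmod (g x))\<^sup>2)"
    using L2_integrable_sq[OF g] by simp
  have le2: "AE x in M. (cmod (f x))\<^sup>2 \<le> c\<^sup>2 * (cmod (g x))\<^sup>2"
    using le by eventually_elim (metis norm_ge_zero power_mono power_mult_distrib)
  have i2: "integrable M (\<lambda>x. (cmod (f x))\<^sup>2)"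
    by (rule Bochner_Integration.integrable_bound[OF i]) (use le2 in auto)
  then show "f \<in> L2 M" by (simp add: L2_def)
  have "(\<integral>x. (cmod (f x))\<^sup>2 \<partial>M) \<le> (\<integral>x. c\<^sup>2 * (cmod (g x))\<^sup>2 \<partial>M)"
    by (rule integral_mono_AE[OF i2 i le2])
  also have "\<dots> = (c * L2_norm M g)\<^sup>2"
    by (simp add: power_mult_distrib L2_norm_power2)
  finally show "L2_norm M f \<le> c * L2_norm M g"
    by (rule L2_norm_leI) (simp add: \<open>0 \<le> c\<close>)
qed

lemma L2_scale: "f \<in> L2 M \<Longrightarrow> (\<lambda>x. a * f x) \<in> L2 M"
  by (rule L2_dominated(1)[where c="cmod a" and g=f]) (auto simp: norm_mult L2_def)

lemma L2_norm_scale: "L2_norm M (\<lambda>x. a * f x) = cmod a * L2_norm M f"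
  by (simp add: L2_norm_def norm_mult power_mult_distrib real_sqrt_mult)

lemma L2_add:
  assumes f: "f \<in> L2 M" and g: "g \<in> L2 M" shows "(\<lambda>x. f x + g x) \<in> L2 M"
proof -
  have [measurable]: "f \<in> borel_measurable M" "g \<in> borel_measurable M"
    using assms by (auto simp: L2_def)
  have b: "(cmod (f x + g x))\<^sup>2 \<le> 2 * (cmod (f x))\<^sup>2 + 2 * (cmod (g x))\<^sup>2" for x
  proof -
    have "(cmod (f x + g x))\<^sup>2 \<le> (cmod (f x) + cmod (g x))\<^sup>2"
      by (intro power_mono norm_triangle_ineq) auto
    also have "\<dots> \<le> 2 * (cmod (f x))\<^sup>2 + 2 * (cmod (g x))\<^sup>2"
      using sum_squares_bound[of "cmod (f x)" "cmod (g x)"] by (simp add: power2_sum)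
    finally show ?thesis .
  qed
  have "integrable M (\<lambda>x. (cmod (f x + g x))\<^sup>2)"
  proof (rule Bochner_Integration.integrable_bound)
    show "integrable M (\<lambda>x. 2 * (cmod (f x))\<^sup>2 + 2 * (cmod (g x))\<^sup>2)"
      using L2_integrable_sq[OF f] L2_integrable_sq[OF g] by simp
    show "AE x in M. norm ((cmod (f x + g x))\<^sup>2) \<le> norm (2 * (cmod (f x))\<^sup>2 + 2 * (cmod (g x))\<^sup>2)"
      using b by (intro AE_I2) (simp add: abs_of_nonneg)
  qed measurable
  then show ?thesis by (simp add: L2_def)
qed

lemma L2_diff:
  assumes "f \<in> L2 M" "g \<in> L2 M" shows "(\<lambda>x. f x - g x) \<in> L2 M"
  using L2_add[OF assms(1) L2_scale[OF assms(2), of "-1"]] by simp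

lemma L2_integrable_mult:
  assumes f: "f \<in> L2 M" and g: "g \<in> L2 M"
  shows "integrable M (\<lambda>x. cmod (f x) * cmod (g x))"
proof -
  have [measurable]: "f \<in> borel_measurable M" "g \<in> borel_measurable M"
    using assms by (auto simp: L2_def)
  have b: "cmod (f x) * cmod (g x) \<le> (cmod (f x))\<^sup>2 + (cmod (g x))\<^sup>2" for x
    using sum_squares_bound[of "cmod (f x)" "cmod (g x)"]
      mult_nonneg_nonneg[OF norm_ge_zero norm_ge_zero, of "f x" "g x"] by linarith
  show ?thesis
  proof (rule Bochner_Integration.integrable_bound)
    show "integrable M (\<lambda>x. (cmod (f x))\<^sup>2 + (cmod (g x))\<^sup>2)"
      using L2_integrable_sq[OF f] L2_integrable_sq[OF g] by simp
    show "AE x in M. norm (cmod (f x) * cmod (g x)) \<le> norm ((cmod (f x))\<^sup>2 + (cmod (g x))\<^sup>2)"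
      using b by (intro AE_I2) (simp add: abs_of_nonneg)
  qed measurable
qed

lemma L2_Cauchy_Schwarz:
  assumes f: "f \<in> L2 M" and g: "g \<in> L2 M"
  shows "(\<integral>x. cmod (f x) * cmod (g x) \<partial>M) \<le> L2_norm M f * L2_norm M g"
proof -
  have [measurable]: "f \<in> borel_measurable M" "g \<in> borel_measurable M"
    using assms by (auto simp: L2_def)
  have "(\<integral>\<^sup>+x. ennreal (cmod (f x)) * ennreal (cmod (g x)) \<partial>M)\<^sup>2
      \<le> (\<integral>\<^sup>+x. (ennreal (cmod (f x)))\<^sup>2 \<partial>M) * (\<integral>\<^sup>+x. (ennreal (cmod (g x)))\<^sup>2 \<partial>M)"
    by (rule Cauchy_Schwarz_nn_integral) auto
  also have "(\<integral>\<^sup>+x. ennreal (cmod (f x)) * ennreal (cmod (g x)) \<partial>M)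
      = ennreal (\<integral>x. cmod (f x) * cmod (g x) \<partial>M)"
    using nn_integral_eq_integral[OF L2_integrable_mult[OF f g]] by (simp add: ennreal_mult)
  also have "(\<integral>\<^sup>+x. (ennreal (cmod (f x)))\<^sup>2 \<partial>M) = ennreal ((L2_norm M f)\<^sup>2)"
    using nn_integral_eq_integral[OF L2_integrable_sq[OF f]]
    by (simp add: ennreal_power L2_norm_power2)
  also have "(\<integral>\<^sup>+x. (ennreal (cmod (g x)))\<^sup>2 \<partial>M) = ennreal ((L2_norm M g)\<^sup>2)"
    using nn_integral_eq_integral[OF L2_integrable_sq[OF g]]
    by (simp add: ennreal_power L2_norm_power2)
  finally have "(\<integral>x. cmod (f x) * cmod (g x) \<partial>M)\<^sup>2 \<le> (L2_norm M f * L2_norm M g)\<^sup>2"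
    by (simp add: ennreal_power ennreal_mult[symmetric] power_mult_distrib)
  then show ?thesis by (rule power2_le_imp_le) simp
qed

lemma L2_norm_triangle:
  assumes f: "f \<in> L2 M" and g: "g \<in> L2 M"
  shows "L2_norm M (\<lambda>x. f x + g x) \<le> L2_norm M f + L2_norm M g"
proof (rule L2_norm_leI)
  have i: "integrable M (\<lambda>x. (cmod (f x))\<^sup>2 + 2 * (cmod (f x) * cmod (g x)) + (cmod (g x))\<^sup>2)"
    using L2_integrable_sq[OF f] L2_integrable_sq[OF g] L2_integrable_mult[OF f g] by auto
  have "(\<integral>x. (cmod (f x + g x))\<^sup>2 \<partial>M)
      \<le> (\<integral>x. (cmod (f x))\<^sup>2 + 2 * (cmod (f x) * cmod (g x)) + (cmod (g x))\<^sup>2 \<partial>M)"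
  proof (rule integral_mono[OF L2_integrable_sq[OF L2_add[OF f g]] i])
    fix x
    have "(cmod (f x + g x))\<^sup>2 \<le> (cmod (f x) + cmod (g x))\<^sup>2"
      by (intro power_mono norm_triangle_ineq) auto
    then show "(cmod (f x + g x))\<^sup>2
        \<le> (cmod (f x))\<^sup>2 + 2 * (cmod (f x) * cmod (g x)) + (cmod (g x))\<^sup>2"
      by (simp add: power2_sum)
  qed
  also have "\<dots> = (L2_norm M f)\<^sup>2 + 2 * (\<integral>x. cmod (f x) * cmod (g x) \<partial>M) + (L2_norm M g)\<^sup>2"
    using L2_integrable_sq[OF f] L2_integrable_sq[OF g] L2_integrable_mult[OF f g]
    by (simp add: L2_norm_power2)
  also have "\<dots> \<le> (L2_norm M f + L2_norm M g)\<^sup>2"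
    using L2_Cauchy_Schwarz[OF f g] by (simp add: power2_sum)
  finally show "(\<integral>x. (cmod (f x + g x))\<^sup>2 \<partial>M) \<le> (L2_norm M f + L2_norm M g)\<^sup>2" .
qed simp

lemma L2_norm_triangle_diff:
  assumes f: "f \<in> L2 M" and g: "g \<in> L2 M"
  shows "L2_norm M (\<lambda>x. f x - g x) \<le> L2_norm M f + L2_norm M g"
  using L2_norm_triangle[OF f L2_scale[OF g, of "-1"]] L2_norm_scale[of M "-1" g] by simp

lemma L2_norm_minus_commute: "L2_norm M (\<lambda>x. f x - g x) = L2_norm M (\<lambda>x. g x - f x)"
  by (simp add: L2_norm_def norm_minus_commute)

lemma L2_norm_triangle3:
  assumes "f \<in> L2 M" "g \<in> L2 M" "h \<in> L2 M"
  shows "L2_norm M (\<lambda>x. f x - h x) \<le> L2_norm M (\<lambda>x. f x - g x) + L2_norm M (\<lambda>x. g x - h x)"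
  using L2_norm_triangle[OF L2_diff[OF assms(1,2)] L2_diff[OF assms(2,3)]] by simp

lemma L2_norm_eq_0_iff:
  assumes "f \<in> L2 M" shows "L2_norm M f = 0 \<longleftrightarrow> (AE x in M. f x = 0)"
proof -
  have "L2_norm M f = 0 \<longleftrightarrow> (\<integral>x. (cmod (f x))\<^sup>2 \<partial>M) = 0"
    by (simp add: L2_norm_def)
  also have "\<dots> \<longleftrightarrow> (AE x in M. (cmod (f x))\<^sup>2 = 0)"
    by (rule integral_nonneg_eq_0_iff_AE[OF L2_integrable_sq[OF assms]]) simp
  finally show ?thesis by simp
qed

text \<open>Coordinate projections, the third momentum and the reflections all preserve the Haar
  measures, so composing with them is isometric.\<close>

lemma L2_measure_preserving:
  assumes r: "r \<in> measurable M N" "distr M N r = N" and f: "f \<in> L2 N"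
  shows "(\<lambda>x. f (r x)) \<in> L2 M" "L2_norm M (\<lambda>x. f (r x)) = L2_norm N f"
proof -
  have [measurable]: "f \<in> borel_measurable N" using f by (rule L2_measurable)
  note [measurable] = r(1)
  have "integrable (distr M N r) (\<lambda>x. (cmod (f x))\<^sup>2)"
    using L2_integrable_sq[OF f] by (simp add: r(2))
  then have "integrable M (\<lambda>x. (cmod (f (r x)))\<^sup>2)"
    by (simp add: integrable_distr_eq)
  then show "(\<lambda>x. f (r x)) \<in> L2 M" by (auto simp: L2_def)
  have "(\<integral>x. (cmod (f x))\<^sup>2 \<partial>(distr M N r)) = (\<integral>x. (cmod (f (r x)))\<^sup>2 \<partial>M)"
    by (rule integral_distr) auto
  then show "L2_norm M (\<lambda>x. f (r x)) = L2_norm N f"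
    by (simp add: L2_norm_def r(2))
qed

lemma (in prob_space) L2_const: "(\<lambda>_. c) \<in> L2 M" "L2_norm M (\<lambda>_. c) = cmod c"
  by (auto simp: L2_def L2_norm_def prob_space)

lemma (in prob_space) L2_norm1_le:
  assumes "f \<in> L2 M"
  shows "integrable M f" "(\<integral>x. cmod (f x) \<partial>M) \<le> L2_norm M f" "cmod (\<integral>x. f x \<partial>M) \<le> L2_norm M f"
proof -
  have [measurable]: "f \<in> borel_measurable M" using assms by (rule L2_measurable)
  have "integrable M (\<lambda>x. cmod (f x))"
    using L2_integrable_mult[OF assms L2_const(1)[of 1]] by simp
  then show i: "integrable M f" by (simp add: integrable_norm_iff)
  show l: "(\<integral>x. cmod (f x) \<partial>M) \<le> L2_norm M f"
    using L2_Cauchy_Schwarz[OF assms L2_const(1)[of 1]] by (simp add: L2_const)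
  show "cmod (\<integral>x. f x \<partial>M) \<le> L2_norm M f"
    using integral_norm_bound[of M f] l by linarith
qed

text \<open>Fatou's lemma for the squared moduli. Membership and norm bound come out together, so
  the pointwise limit need not be known to be square-integrable beforehand.\<close>

lemma L2_Fatou:
  assumes s: "\<And>n. s n \<in> L2 M" and f: "f \<in> borel_measurable M"
    and lim: "AE x in M. (\<lambda>n. s n x) \<longlonglongrightarrow> f x"
    and bd: "eventually (\<lambda>n. L2_norm M (s n) \<le> c) sequentially"
  shows "f \<in> L2 M" "L2_norm M f \<le> c"
proof -
  have c: "0 \<le> c" using eventually_happens[OF bd] L2_norm_nonneg order_trans by (metis sequentially_bot)
  have [measurable]: "f \<in> borel_measurable M" "\<And>n. s n \<in> borel_measurable M"
    using f L2_measurable[OF s] by auto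
  have "(\<integral>\<^sup>+x. ennreal ((cmod (f x))\<^sup>2) \<partial>M) = (\<integral>\<^sup>+x. liminf (\<lambda>n. ennreal ((cmod (s n x))\<^sup>2)) \<partial>M)"
  proof (rule nn_integral_cong_AE)
    show "AE x in M. ennreal ((cmod (f x))\<^sup>2) = liminf (\<lambda>n. ennreal ((cmod (s n x))\<^sup>2))"
      using lim
    proof eventually_elim
      case (elim x)
      have "(\<lambda>n. ennreal ((cmod (s n x))\<^sup>2)) \<longlonglongrightarrow> ennreal ((cmod (f x))\<^sup>2)"
        by (intro tendsto_intros elim)
      from lim_imp_Liminf[OF sequentially_bot this] show ?case by (rule sym)
    qed
  qed
  also have "\<dots> \<le> liminf (\<lambda>n. \<integral>\<^sup>+x. ennreal ((cmod (s n x))\<^sup>2) \<partial>M)"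
    by (rule nn_integral_liminf) auto
  also have "\<dots> \<le> ennreal (c\<^sup>2)"
  proof (rule Liminf_le)
    show "\<forall>\<^sub>F n in sequentially. (\<integral>\<^sup>+x. ennreal ((cmod (s n x))\<^sup>2) \<partial>M) \<le> ennreal (c\<^sup>2)"
      using bd
    proof eventually_elim
      case (elim n)
      then show ?case
        by (subst nn_integral_eq_integral[OF L2_integrable_sq[OF s]])
          (auto simp: L2_norm_power2[symmetric] intro!: ennreal_leI power_mono)
    qed
  qed simp
  finally have le: "(\<integral>\<^sup>+x. ennreal ((cmod (f x))\<^sup>2) \<partial>M) \<le> ennreal (c\<^sup>2)" .
  have i: "integrable M (\<lambda>x. (cmod (f x))\<^sup>2)"
    by (rule integrableI_bounded) (use le in \<open>auto simp: less_top[symmetric] top_unique\<close>)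
  then show "f \<in> L2 M" by (simp add: L2_def)
  have "(\<integral>x. (cmod (f x))\<^sup>2 \<partial>M) \<le> c\<^sup>2"
    using le nn_integral_eq_integral[OF i] by simp
  then show "L2_norm M f \<le> c" using c by (rule L2_norm_leI)
qed

definition L2_Cauchy :: "'a measure \<Rightarrow> (nat \<Rightarrow> 'a \<Rightarrow> complex) \<Rightarrow> bool" where
  "L2_Cauchy M s \<longleftrightarrow> (\<forall>e>0. \<exists>N. \<forall>m\<ge>N. \<forall>n\<ge>N. L2_norm M (\<lambda>x. s m x - s n x) < e)"

text \<open>Riesz-Fischer. On a probability space the integral of the modulus is at most
  \<open>L2_norm\<close>, so along a fast subsequence the increments are absolutely summable almost
  everywhere and the subsequence converges pointwise.\<close>

lemma (in prob_space) L2_complete: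
  assumes s: "\<And>n. s n \<in> L2 M" and C: "L2_Cauchy M s"
  shows "\<exists>f\<in>L2 M. (\<lambda>n. L2_norm M (\<lambda>x. s n x - f x)) \<longlonglongrightarrow> 0"
proof -
  have sm[measurable]: "s n \<in> borel_measurable M" for n using L2_measurable[OF s] .
  have "\<exists>N. \<forall>m\<ge>N. \<forall>n\<ge>N. L2_norm M (\<lambda>x. s m x - s n x) < (1/2)^k" for k :: nat
    using C unfolding L2_Cauchy_def by (metis half_gt_zero zero_less_one zero_less_power)
  then obtain N where N: "\<And>k m n. N k \<le> m \<Longrightarrow> N k \<le> n \<Longrightarrow> L2_norm M (\<lambda>x. s m x - s n x) < (1/2)^k"
    by metis
  \<comment> \<open>Partial sums of \<open>N\<close> dominate each \<open>N k\<close> and are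
    monotone, which gives the fast subsequence without a recursive choice.\<close>
  define r where "r k = (\<Sum>i\<le>k. N i)" for k
  have rN: "N k \<le> r k" for k unfolding r_def by (rule member_le_sum) auto
  have rmono: "r k \<le> r l" if "k \<le> l" for k l
    unfolding r_def using that by (intro sum_mono2) auto
  define d where "d k x = s (r (Suc k)) x - s (r k) x" for k x
  have dL2: "d k \<in> L2 M" for k unfolding d_def using L2_diff[OF s s] .
  have [measurable]: "d k \<in> borel_measurable M" for k using L2_measurable[OF dL2] .
  have dn: "(\<integral>x. cmod (d k x) \<partial>M) \<le> (1/2)^k" for k
  proof -
    have "L2_norm M (d k) < (1/2)^k"
      unfolding d_def[abs_def] using rN[of k] rmono[of k "Suc k"] by (intro N) auto
    then show ?thesis using L2_norm1_le(2)[OF dL2, of k] by simp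
  qed
  have "(\<integral>\<^sup>+x. (\<Sum>k. ennreal (cmod (d k x))) \<partial>M) = (\<Sum>k. \<integral>\<^sup>+x. ennreal (cmod (d k x)) \<partial>M)"
    by (rule nn_integral_suminf) auto
  also have "\<dots> \<le> (\<Sum>k. ennreal ((1/2)^k))"
  proof (rule suminf_le)
    fix k show "(\<integral>\<^sup>+x. ennreal (cmod (d k x)) \<partial>M) \<le> ennreal ((1/2)^k)"
      using dn[of k] L2_norm1_le(1)[OF dL2, of k]
      by (subst nn_integral_eq_integral) (auto intro!: ennreal_leI)
  qed auto
  also have "\<dots> = ennreal (\<Sum>k. (1/2)^k)"
    by (rule suminf_ennreal_eq) (auto intro!: summable_sums summable_geometric)
  also have "\<dots> < \<infinity>" by simp
  finally have "AE x in M. (\<Sum>k. ennreal (cmod (d k x))) \<noteq> \<infinity>"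
    by (intro nn_integral_PInf_AE) auto
  then have "AE x in M. convergent (\<lambda>k. s (r k) x)"
  proof eventually_elim
    case (elim x)
    then have "summable (\<lambda>k. cmod (d k x))"
      by (intro summable_suminf_not_top) (auto simp: top_unique)
    then have "summable (\<lambda>k. d k x)" by (rule summable_norm_cancel)
    then have "convergent (\<lambda>n. \<Sum>k<n. d k x)" by (simp add: summable_iff_convergent)
    moreover have "(\<Sum>k<n. d k x) = s (r n) x - s (r 0) x" for n
      unfolding d_def by (rule sum_lessThan_telescope)
    ultimately have "convergent (\<lambda>n. (s (r n) x - s (r 0) x) + s (r 0) x)"
      by (simp only: convergent_add_const_right_iff)
    then show ?case by simp
  qed
  moreover define f where "f x = lim (\<lambda>k. s (r k) x)" for x
  ultimately have lim: "AE x in M. (\<lambda>k. s (r k) x) \<longlonglongrightarrow> f x"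
    by (auto simp: convergent_LIMSEQ_iff)
  have [measurable]: "f \<in> borel_measurable M" unfolding f_def[abs_def] by measurable
  \<comment> \<open>Fatou in \<open>j\<close> with \<open>n\<close> fixed turns pointwise
    convergence of the subsequence into a norm estimate for the whole sequence.\<close>
  have key: "(\<lambda>x. f x - s n x) \<in> L2 M \<and> L2_norm M (\<lambda>x. f x - s n x) \<le> (1/2)^k"
    if "N k \<le> n" for n k
  proof -
    have "eventually (\<lambda>j. L2_norm M (\<lambda>x. s (r j) x - s n x) \<le> (1/2)^k) sequentially"
      unfolding eventually_sequentially
    proof (intro exI allI impI)
      fix j assume "k \<le> j"
      then show "L2_norm M (\<lambda>x. s (r j) x - s n x) \<le> (1/2)^k"
        using N[of k "r j" n] that rN[of k] rmono[of k j] by linarith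
    qed
    moreover have "AE x in M. (\<lambda>j. s (r j) x - s n x) \<longlonglongrightarrow> f x - s n x"
      using lim by eventually_elim (intro tendsto_intros)
    ultimately show ?thesis
      using L2_Fatou[where s="\<lambda>j x. s (r j) x - s n x" and f="\<lambda>x. f x - s n x" and c="(1/2)^k"]
        L2_diff[OF s s] by auto
  qed
  have "f \<in> L2 M"
    using L2_add[OF conjunct1[OF key[of 0 "N 0"]] s[of "N 0"]] by simp
  moreover have "(\<lambda>n. L2_norm M (\<lambda>x. s n x - f x)) \<longlonglongrightarrow> 0"
  proof (rule LIMSEQ_I)
    fix e :: real assume "0 < e"
    then obtain k where k: "(1/2)^k < e" using real_arch_pow_inv[of e "1/2"] by auto
    show "\<exists>no. \<forall>n\<ge>no. norm (L2_norm M (\<lambda>x. s n x - f x) - 0) < e"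
      using key[of k] k by (intro exI[of _ "N k"]) (auto simp: L2_norm_minus_commute[of M "s _" f] intro: le_less_trans)
  qed
  ultimately show ?thesis by blast
qed

section \<open>Bounded symmetric operators\<close>

definition L2_inner :: "'a measure \<Rightarrow> ('a \<Rightarrow> complex) \<Rightarrow> ('a \<Rightarrow> complex) \<Rightarrow> complex" where
  "L2_inner M f g = (\<integral>x. f x * cnj (g x) \<partial>M)"

lemma borel_measurable_cnj' [measurable (raw)]:
  fixes f :: "'a \<Rightarrow> complex"
  shows "f \<in> borel_measurable M \<Longrightarrow> (\<lambda>x. cnj (f x)) \<in> borel_measurable M"
  by (rule borel_measurable_continuous_on[of cnj]) (auto intro: continuous_intros)

lemma L2_inner_integrable:
  assumes f: "f \<in> L2 M" and g: "g \<in> L2 M"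
  shows "integrable M (\<lambda>x. f x * cnj (g x))"
proof -
  have [measurable]: "f \<in> borel_measurable M" "g \<in> borel_measurable M"
    using assms by (auto simp: L2_def)
  show ?thesis
    by (rule Bochner_Integration.integrable_bound[OF L2_integrable_mult[OF f g]])
      (auto simp: norm_mult)
qed

lemma L2_inner_bound:
  assumes f: "f \<in> L2 M" and g: "g \<in> L2 M"
  shows "cmod (L2_inner M f g) \<le> L2_norm M f * L2_norm M g"
proof -
  have "cmod (L2_inner M f g) \<le> (\<integral>x. cmod (f x * cnj (g x)) \<partial>M)"
    unfolding L2_inner_def by simp
  then show ?thesis using L2_Cauchy_Schwarz[OF f g] by (simp add: norm_mult)
qed

lemma L2_inner_lin_left:
  assumes "f \<in> L2 M" "g \<in> L2 M" "h \<in> L2 M"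
  shows "L2_inner M (\<lambda>x. a * f x + b * g x) h = a * L2_inner M f h + b * L2_inner M g h"
proof -
  have "L2_inner M (\<lambda>x. a * f x + b * g x) h
      = (\<integral>x. a * (f x * cnj (h x)) + b * (g x * cnj (h x)) \<partial>M)"
    unfolding L2_inner_def by (simp add: algebra_simps)
  also have "\<dots> = a * L2_inner M f h + b * L2_inner M g h"
    unfolding L2_inner_def
    using L2_inner_integrable[OF assms(1,3)] L2_inner_integrable[OF assms(2,3)] by simp
  finally show ?thesis .
qed

lemma L2_inner_cnj: "L2_inner M g f = cnj (L2_inner M f g)"
proof -
  have "cnj (L2_inner M f g) = (\<integral>x. cnj (f x * cnj (g x)) \<partial>M)"
    unfolding L2_inner_def by (rule Bochner_Integration.integral_cnj[symmetric])
  then show ?thesis by (simp add: L2_inner_def mult.commute)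
qed

lemma L2_inner_lin_right:
  assumes "f \<in> L2 M" "g \<in> L2 M" "h \<in> L2 M"
  shows "L2_inner M h (\<lambda>x. a * f x + b * g x) = cnj a * L2_inner M h f + cnj b * L2_inner M h g"
  by (subst L2_inner_cnj, subst L2_inner_lin_left[OF assms])
    (simp add: L2_inner_cnj[of M _ h])

lemma L2_inner_scale_left: "L2_inner M (\<lambda>x. a * f x) h = a * L2_inner M f h"
  unfolding L2_inner_def by (simp add: mult.assoc)

lemma L2_inner_self: "L2_inner M f f = of_real ((L2_norm M f)\<^sup>2)"
  unfolding L2_inner_def L2_norm_power2 complex_norm_square[symmetric]
  by (simp add: complex_norm_square[symmetric] flip: of_real_power)

lemma L2_inner_cong_AE:
  assumes "f \<in> borel_measurable M" "g \<in> borel_measurable M" "f' \<in> borel_measurable M"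
    "g' \<in> borel_measurable M" "AE x in M. f x = f' x" "AE x in M. g x = g' x"
  shows "L2_inner M f g = L2_inner M f' g'"
  unfolding L2_inner_def
proof (rule integral_cong_AE)
  show "AE x in M. f x * cnj (g x) = f' x * cnj (g' x)"
    using assms(5,6) by eventually_elim simp
qed (use assms(1-4) in \<open>simp_all\<close>)

lemma L2_lin:
  assumes "f \<in> L2 M" "g \<in> L2 M" shows "(\<lambda>x. a * f x + b * g x) \<in> L2 M"
  by (intro L2_add L2_scale assms)

text \<open>This expansion serves three times: for the contraction estimate, for comparing
  \<open>T - z\<close> with its adjoint, and for the distance between orthonormal vectors.\<close>

lemma L2_norm_diff_scale_power2:
  assumes f: "f \<in> L2 M" and g: "g \<in> L2 M"
  shows "(L2_norm M (\<lambda>x. f x - a * g x))\<^sup>2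
    = (L2_norm M f)\<^sup>2 - 2 * Re (cnj a * L2_inner M f g) + (cmod a)\<^sup>2 * (L2_norm M g)\<^sup>2"
proof -
  let ?h = "\<lambda>x. 1 * f x + (- a) * g x"
  have h: "?h \<in> L2 M" by (rule L2_lin[OF f g])
  have "L2_inner M ?h ?h = L2_inner M f f - cnj a * L2_inner M f g - a * L2_inner M g f
      + a * cnj a * L2_inner M g g"
    unfolding L2_inner_lin_left[OF f g h] L2_inner_lin_right[OF f g f] L2_inner_lin_right[OF f g g]
    by (simp add: algebra_simps)
  also have "a * L2_inner M g f = cnj (cnj a * L2_inner M f g)"
    using L2_inner_cnj[of M g f] by simp
  finally have "complex_of_real ((L2_norm M ?h)\<^sup>2) = of_real ((L2_norm M f)\<^sup>2)
      - (cnj a * L2_inner M f g + cnj (cnj a * L2_inner M f g))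
      + of_real ((cmod a)\<^sup>2 * (L2_norm M g)\<^sup>2)"
    by (simp add: L2_inner_self complex_norm_square[symmetric] flip: of_real_power)
  then have "Re (complex_of_real ((L2_norm M ?h)\<^sup>2)) = Re (of_real ((L2_norm M f)\<^sup>2)
      - (cnj a * L2_inner M f g + cnj (cnj a * L2_inner M f g))
      + of_real ((cmod a)\<^sup>2 * (L2_norm M g)\<^sup>2))" by simp
  then show ?thesis by simp
qed

lemma L2_Cauchy_geometric:
  assumes s: "\<And>n. s n \<in> L2 M" and k: "0 \<le> k" "k < 1"
    and d: "\<And>n. L2_norm M (\<lambda>x. s (Suc n) x - s n x) \<le> D * k ^ n"
  shows "L2_Cauchy M s"
proof -
  have D: "0 \<le> D" using d[of 0] order_trans[OF L2_norm_nonneg] by force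
  \<comment> \<open>Keeping the factor \<open>1 - k ^ j\<close> of the finite geometric sum makes
    the induction close exactly.\<close>
  have step: "L2_norm M (\<lambda>x. s (n + j) x - s n x) \<le> D * k ^ n / (1 - k) * (1 - k ^ j)" for n j
  proof (induction j)
    case (Suc j)
    have "L2_norm M (\<lambda>x. s (n + Suc j) x - s n x)
        \<le> L2_norm M (\<lambda>x. s (Suc (n + j)) x - s (n + j) x) + L2_norm M (\<lambda>x. s (n + j) x - s n x)"
      using L2_norm_triangle3[OF s s s] by simp
    also have "\<dots> \<le> D * k ^ (n + j) + D * k ^ n / (1 - k) * (1 - k ^ j)"
      using d[of "n + j"] Suc.IH by linarith
    also have "\<dots> = D * k ^ n / (1 - k) * (1 - k ^ Suc j)"
      using k by (simp add: field_simps power_add)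
    finally show ?case .
  qed (simp add: L2_norm_def)
  have bd: "L2_norm M (\<lambda>x. s m x - s n x) \<le> D / (1 - k) * k ^ n" if "n \<le> m" for m n
  proof -
    have "L2_norm M (\<lambda>x. s m x - s n x) \<le> D * k ^ n / (1 - k) * (1 - k ^ (m - n))"
      using step[of n "m - n"] that by simp
    also have "\<dots> \<le> D * k ^ n / (1 - k) * 1"
      by (rule mult_left_mono) (use k D in auto)
    finally show ?thesis by simp
  qed
  show ?thesis
    unfolding L2_Cauchy_def
  proof (intro allI impI)
    fix e :: real assume e: "0 < e"
    have "(\<lambda>n. D / (1 - k) * k ^ n) \<longlonglongrightarrow> D / (1 - k) * 0"
      by (intro tendsto_intros LIMSEQ_realpow_zero k)
    then have "eventually (\<lambda>n. D / (1 - k) * k ^ n < e) sequentially"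
      using order_tendstoD(2)[of _ 0 sequentially e] e by simp
    then obtain N where N: "\<And>n. N \<le> n \<Longrightarrow> D / (1 - k) * k ^ n < e"
      by (auto simp: eventually_sequentially)
    have "L2_norm M (\<lambda>x. s m x - s n x) < e" if "N \<le> m" "N \<le> n" for m n
    proof (cases "n \<le> m")
      case True
      then show ?thesis using bd[OF True] N[OF that(2)] by linarith
    next
      case False
      then show ?thesis using bd[of m n] N[OF that(1)]
        by (subst L2_norm_minus_commute) linarith
    qed
    then show "\<exists>N. \<forall>m\<ge>N. \<forall>n\<ge>N. L2_norm M (\<lambda>x. s m x - s n x) < e" by blast
  qed
qed

text \<open>Linearity of \<open>T\<close> is required only almost everywhere, since vectors are
  representatives. \<open>V_closed\<close> together with \<open>L2_complete\<close> makes
  \<open>V\<close> a Hilbert space, and an everywhere defined bounded symmetric \<open>T\<close> is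
  then self-adjoint.\<close>

locale symmetric_operator = prob_space M for M :: "'a measure" +
  fixes V :: "('a \<Rightarrow> complex) set" and T :: "('a \<Rightarrow> complex) \<Rightarrow> 'a \<Rightarrow> complex" and C :: real
  assumes V_L2: "f \<in> V \<Longrightarrow> f \<in> L2 M"
    and V_lin: "f \<in> V \<Longrightarrow> g \<in> V \<Longrightarrow> (\<lambda>x. a * f x + b * g x) \<in> V"
    and V_closed: "(\<And>n. s n \<in> V) \<Longrightarrow> f \<in> L2 M \<Longrightarrow>
      (\<lambda>n. L2_norm M (\<lambda>x. s n x - f x)) \<longlonglongrightarrow> 0 \<Longrightarrow> f \<in> V"
    and T_V: "f \<in> V \<Longrightarrow> T f \<in> V"
    and T_lin: "f \<in> V \<Longrightarrow> g \<in> V \<Longrightarrow>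
      AE x in M. T (\<lambda>x. a * f x + b * g x) x = a * T f x + b * T g x"
    and T_bounded: "f \<in> V \<Longrightarrow> L2_norm M (T f) \<le> C * L2_norm M f"
    and T_sym: "f \<in> V \<Longrightarrow> g \<in> V \<Longrightarrow> L2_inner M (T f) g = L2_inner M f (T g)"
    and C_nonneg: "0 \<le> C"
begin

definition Tz :: "complex \<Rightarrow> ('a \<Rightarrow> complex) \<Rightarrow> 'a \<Rightarrow> complex" where
  "Tz z f = (\<lambda>x. T f x - z * f x)"

lemma V_diff: "f \<in> V \<Longrightarrow> g \<in> V \<Longrightarrow> (\<lambda>x. f x - g x) \<in> V"
  using V_lin[of f g 1 "-1"] by simp

lemma V_add: "f \<in> V \<Longrightarrow> g \<in> V \<Longrightarrow> (\<lambda>x. f x + g x) \<in> V"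
  using V_lin[of f g 1 1] by simp

lemma V_scale: "f \<in> V \<Longrightarrow> (\<lambda>x. a * f x) \<in> V"
  using V_lin[of f f a 0] by simp

lemma V_measurable: "f \<in> V \<Longrightarrow> f \<in> borel_measurable M"
  using V_L2 L2_measurable by blast

lemma Tz_V: "f \<in> V \<Longrightarrow> Tz z f \<in> V"
  unfolding Tz_def using V_lin[OF T_V, of f f 1 "- z"] by simp

lemma Tz_lin:
  assumes "f \<in> V" "g \<in> V"
  shows "AE x in M. Tz z (\<lambda>x. a * f x + b * g x) x = a * Tz z f x + b * Tz z g x"
  using T_lin[OF assms, of a b] unfolding Tz_def
  by eventually_elim (simp add: algebra_simps)

lemma Tz_diff:
  assumes "f \<in> V" "g \<in> V"
  shows "AE x in M. Tz z (\<lambda>x. f x - g x) x = Tz z f x - Tz z g x"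
  using Tz_lin[OF assms, of z 1 "-1"] by simp

lemma Tz_bounded: "f \<in> V \<Longrightarrow> L2_norm M (Tz z f) \<le> (C + cmod z) * L2_norm M f"
  using L2_norm_triangle_diff[OF V_L2[OF T_V] L2_scale[OF V_L2], of f f z] T_bounded[of f]
  unfolding Tz_def by (simp add: L2_norm_scale algebra_simps)

lemma Tz_adjoint:
  assumes "f \<in> V" "g \<in> V"
  shows "L2_inner M (Tz z f) g = L2_inner M f (Tz (cnj z) g)"
  using L2_inner_lin_left[OF V_L2[OF T_V[OF assms(1)]] V_L2[OF assms(1)] V_L2[OF assms(2)], of 1 "-z"]
    L2_inner_lin_right[OF V_L2[OF T_V[OF assms(2)]] V_L2[OF assms(2)] V_L2[OF assms(1)], of 1 "-cnj z"]
    T_sym[OF assms]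
  unfolding Tz_def by simp

lemma inner_T_real: "f \<in> V \<Longrightarrow> L2_inner M (T f) f = of_real (Re (L2_inner M (T f) f))"
  using T_sym[of f f] L2_inner_cnj[of M f "T f"]
  by (metis Reals_cnj_iff of_real_Re)

text \<open>Normality of \<open>T - z\<close>: the two norms differ only through the cross term,
  which agrees because the quadratic form of \<open>T\<close> is real.\<close>

lemma norm_Tz_cnj:
  assumes "f \<in> V" shows "L2_norm M (Tz (cnj z) f) = L2_norm M (Tz z f)"
proof -
  obtain r where r: "L2_inner M (T f) f = of_real r" using inner_T_real[OF assms] by blast
  have "(L2_norm M (Tz (cnj z) f))\<^sup>2 = (L2_norm M (Tz z f))\<^sup>2"
    unfolding Tz_def using assms
    by (simp add: L2_norm_diff_scale_power2[OF V_L2[OF T_V] V_L2] r)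
  then show ?thesis by (simp add: power2_eq_iff_nonneg)
qed

lemma Tz_zero_norm: "f \<in> V \<Longrightarrow> L2_norm M f = 0 \<Longrightarrow> L2_norm M (Tz z f) = 0"
  using Tz_bounded[of f z] L2_norm_nonneg[of M "Tz z f"] by simp

text \<open>Compatibility with almost-everywhere equality is derived rather than assumed: a
  difference of norm zero is sent to norm zero by boundedness.\<close>

lemma Tz_cong:
  assumes f: "f \<in> V" and g: "g \<in> V" and eq: "AE x in M. f x = g x"
  shows "AE x in M. Tz z f x = Tz z g x"
proof -
  have "L2_norm M (\<lambda>x. f x - g x) = 0"
    using L2_norm_eq_0_iff[OF V_L2[OF V_diff[OF f g]]] eq by simp
  then have "AE x in M. Tz z (\<lambda>x. f x - g x) x = 0"
    using Tz_zero_norm[OF V_diff[OF f g]] L2_norm_eq_0_iff[OF V_L2[OF Tz_V[OF V_diff[OF f g]]]]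
    by simp
  then show ?thesis using Tz_diff[OF f g, of z] by eventually_elim simp
qed

section \<open>Lower bounds, surjectivity and the resolvent set\<close>

definition bounded_below :: "complex \<Rightarrow> bool" where
  "bounded_below z \<longleftrightarrow> (\<exists>c>0. \<forall>f\<in>V. c * L2_norm M f \<le> L2_norm M (Tz z f))"

text \<open>With \<open>B = T - z\<close> bounded below, \<open>f \<mapsto> f + s B\<^sup>*(g - B f)\<close> is a contraction for small \<open>s > 0\<close>,
  because \<open>B\<^sup>*B\<close> is bounded below; its fixed point solves \<open>B f = g\<close>.\<close>

lemma bounded_below_surj:
  assumes "bounded_below z" "g \<in> V"
  shows "\<exists>f\<in>V. AE x in M. Tz z f x = g x"
proof -
  obtain c0 where c0: "0 < c0" "\<And>f. f \<in> V \<Longrightarrow> c0 * L2_norm M f \<le> L2_norm M (Tz z f)"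
    using assms(1) unfolding bounded_below_def by blast
  \<comment> \<open>Shrinking the bound to at most 1 ensures \<open>s * c\<^sup>2 \<le> 1\<close>,
    so that the contraction factor \<open>k\<close> below is a real square root.\<close>
  define c where "c = min c0 1"
  have c: "0 < c" "c \<le> 1" using c0(1) by (auto simp: c_def)
  have cb: "c * L2_norm M f \<le> L2_norm M (Tz z f)" if "f \<in> V" for f
    using c0(2)[OF that] mult_right_mono[of c c0 "L2_norm M f"] by (simp add: c_def)
  define L where "L = C + cmod z + 1"
  have L: "1 \<le> L" using C_nonneg by (simp add: L_def)
  have Lb: "L2_norm M (Tz w f) \<le> L * L2_norm M f" if "f \<in> V" "w = z \<or> w = cnj z" for f w
    using Tz_bounded[OF that(1), of w] that(2) mult_right_mono[of "C + cmod z" L "L2_norm M f"]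
    by (auto simp: L_def)
  \<comment> \<open>\<open>L\<close> bounds both \<open>T - z\<close> and its adjoint, so with this
    \<open>s\<close> the quadratic term of the expansion consumes at most half of the linear gain
    \<open>2 * s * (L2_norm M (?B d))\<^sup>2\<close>.\<close>
  define s where "s = 1 / L\<^sup>2"
  have s: "0 < s" "s \<le> 1" "s * L\<^sup>2 = 1" using L by (auto simp: s_def)
  define k where "k = sqrt (1 - s * c\<^sup>2)"
  have sc: "0 < s * c\<^sup>2" "s * c\<^sup>2 \<le> 1"
    using s c mult_mono[of s 1 "c\<^sup>2" 1] by (auto simp: power_le_one)
  have k: "0 \<le> k" "k < 1" using sc by (auto simp: k_def)
  let ?B = "Tz z" and ?B' = "Tz (cnj z)"
  have contr: "L2_norm M (\<lambda>x. d x - of_real s * ?B' (?B d) x) \<le> k * L2_norm M d" if d: "d \<in> V" for d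
  proof (rule power2_le_imp_le)
    have "(L2_norm M (\<lambda>x. d x - of_real s * ?B' (?B d) x))\<^sup>2
        = (L2_norm M d)\<^sup>2 - 2 * s * (L2_norm M (?B d))\<^sup>2 + s\<^sup>2 * (L2_norm M (?B' (?B d)))\<^sup>2"
      using arg_cong[OF Tz_adjoint[OF d Tz_V[OF d, of z], of z], of Re]
      by (simp add: L2_norm_diff_scale_power2[OF V_L2[OF d] V_L2[OF Tz_V[OF Tz_V[OF d]]]]
          L2_inner_self del: of_real_power)
    also have "\<dots> \<le> (L2_norm M d)\<^sup>2 - 2 * s * (L2_norm M (?B d))\<^sup>2 + s\<^sup>2 * (L * L2_norm M (?B d))\<^sup>2"
      using Lb[OF Tz_V[OF d]] by (intro add_left_mono mult_left_mono power_mono) auto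
    also have "s\<^sup>2 * (L * L2_norm M (?B d))\<^sup>2 = s * (s * L\<^sup>2) * (L2_norm M (?B d))\<^sup>2"
      by (simp add: power2_eq_square mult_ac)
    also have "(L2_norm M d)\<^sup>2 - 2 * s * (L2_norm M (?B d))\<^sup>2 + s * (s * L\<^sup>2) * (L2_norm M (?B d))\<^sup>2
        = (L2_norm M d)\<^sup>2 - s * (L2_norm M (?B d))\<^sup>2" unfolding s(3) by simp
    also have "\<dots> \<le> (L2_norm M d)\<^sup>2 - s * (c * L2_norm M d)\<^sup>2"
      using cb[OF d] s c by (intro diff_left_mono mult_left_mono power_mono) auto
    also have "\<dots> = (k * L2_norm M d)\<^sup>2"
      using sc by (simp add: k_def power_mult_distrib algebra_simps)
    finally show "(L2_norm M (\<lambda>x. d x - of_real s * ?B' (?B d) x))\<^sup>2 \<le> (k * L2_norm M d)\<^sup>2" .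
    show "0 \<le> k * L2_norm M d" using k by simp
  qed
  define G where "G f = ?B' (\<lambda>x. g x - ?B f x)" for f
  have GV: "G f \<in> V" if "f \<in> V" for f
    unfolding G_def by (intro Tz_V V_diff assms(2) that)
  define F where "F = rec_nat g (\<lambda>_ f x. f x + of_real s * G f x)"
  have F0: "F 0 = g" and FS: "F (Suc n) = (\<lambda>x. F n x + of_real s * G (F n) x)" for n
    by (auto simp: F_def)
  have FV: "F n \<in> V" for n
    by (induction n) (auto simp: F0 FS assms(2) intro!: V_add V_scale GV)
  define d where "d n = (\<lambda>x. of_real s * G (F n) x)" for n
  have dV: "d n \<in> V" for n unfolding d_def by (intro V_scale GV FV)
  have Gdiff: "AE x in M. G f x - G h x = - ?B' (?B (\<lambda>x. f x - h x)) x" if "f \<in> V" "h \<in> V" for f h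
  proof -
    have "AE x in M. ?B' (\<lambda>x. (g x - ?B f x) - (g x - ?B h x)) x = G f x - G h x"
      unfolding G_def by (intro Tz_diff V_diff Tz_V assms(2) that)
    moreover have "AE x in M. ?B' (\<lambda>x. (g x - ?B f x) - (g x - ?B h x)) x
        = ?B' (\<lambda>x. (-1) * ?B (\<lambda>x. f x - h x) x + 0 * g x) x"
    proof (rule Tz_cong)
      show "AE x in M. (g x - ?B f x) - (g x - ?B h x) = (-1) * ?B (\<lambda>x. f x - h x) x + 0 * g x"
        using Tz_diff[OF that, of z] by eventually_elim simp
    qed (intro V_diff V_lin Tz_V that assms(2))+
    moreover have "AE x in M. ?B' (\<lambda>x. (-1) * ?B (\<lambda>x. f x - h x) x + 0 * g x) x
        = (-1) * ?B' (?B (\<lambda>x. f x - h x)) x + 0 * ?B' g x"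
      by (intro Tz_lin Tz_V V_diff that assms(2))
    ultimately show ?thesis by eventually_elim simp
  qed
  have dS: "L2_norm M (d (Suc n)) \<le> k * L2_norm M (d n)" for n
  proof -
    have "AE x in M. G (F (Suc n)) x - G (F n) x = - ?B' (?B (\<lambda>x. F (Suc n) x - F n x)) x"
      by (intro Gdiff FV)
    then have "AE x in M. d (Suc n) x = d n x - of_real s * ?B' (?B (d n)) x"
    proof eventually_elim
      case (elim x)
      have "(\<lambda>x. F (Suc n) x - F n x) = d n" by (simp add: FS d_def)
      with elim have "G (F (Suc n)) x = G (F n) x - ?B' (?B (d n)) x" by (simp add: algebra_simps)
      then have "of_real s * G (F (Suc n)) x = of_real s * G (F n) x - of_real s * ?B' (?B (d n)) x"
        by (simp add: right_diff_distrib)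
      then show ?case by (simp only: d_def)
    qed
    then have "L2_norm M (d (Suc n)) = L2_norm M (\<lambda>x. d n x - of_real s * ?B' (?B (d n)) x)"
      by (intro L2_norm_cong_AE V_measurable V_diff V_scale Tz_V dV)
    then show ?thesis using contr[OF dV, of n] by simp
  qed
  have dn: "L2_norm M (d n) \<le> L2_norm M (d 0) * k ^ n" for n
  proof (induction n)
    case (Suc n)
    have "L2_norm M (d (Suc n)) \<le> k * (L2_norm M (d 0) * k ^ n)"
      using dS[of n] mult_left_mono[OF Suc.IH k(1)] by linarith
    then show ?case by (simp add: mult_ac)
  qed simp
  have "L2_Cauchy M F"
  proof (rule L2_Cauchy_geometric[OF V_L2[OF FV] k])
    show "L2_norm M (\<lambda>x. F (Suc n) x - F n x) \<le> L2_norm M (d 0) * k ^ n" for n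
      using dn[of n] by (simp add: FS d_def)
  qed
  then obtain f where f: "f \<in> L2 M" "(\<lambda>n. L2_norm M (\<lambda>x. F n x - f x)) \<longlonglongrightarrow> 0"
    using L2_complete[where s=F, OF V_L2[OF FV]] by blast
  have fV: "f \<in> V" by (rule V_closed[OF FV f])
  have "L2_norm M (G f) \<le> L2_norm M (d 0) * k ^ n / s + L\<^sup>2 * L2_norm M (\<lambda>x. F n x - f x)" for n
  proof -
    have "L2_norm M (G f) \<le> L2_norm M (G (F n)) + L2_norm M (\<lambda>x. G (F n) x - G f x)"
      using L2_norm_triangle_diff[OF V_L2[OF GV[OF FV[of n]]] V_L2[OF V_diff[OF GV[OF FV[of n]] GV[OF fV]]]]
      by simp
    also have "L2_norm M (\<lambda>x. G (F n) x - G f x)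
        = L2_norm M (\<lambda>x. (-1) * ?B' (?B (\<lambda>x. F n x - f x)) x)"
      using Gdiff[OF FV fV, of n]
      by (intro L2_norm_cong_AE V_measurable V_diff V_scale Tz_V GV FV fV) simp
    also have "\<dots> = L2_norm M (?B' (?B (\<lambda>x. F n x - f x)))"
      unfolding L2_norm_scale by simp
    also have "\<dots> \<le> L * (L * L2_norm M (\<lambda>x. F n x - f x))"
    proof -
      have "L2_norm M (?B' (?B (\<lambda>x. F n x - f x))) \<le> L * L2_norm M (?B (\<lambda>x. F n x - f x))"
        by (intro Lb Tz_V V_diff FV fV) simp
      also have "L2_norm M (?B (\<lambda>x. F n x - f x)) \<le> L * L2_norm M (\<lambda>x. F n x - f x)"
        by (intro Lb V_diff FV fV) simp
      finally show ?thesis using L by (simp add: mult_left_mono)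
    qed
    also have "L2_norm M (G (F n)) = L2_norm M (d n) / s"
      unfolding d_def L2_norm_scale using s by simp
    also have "\<dots> \<le> L2_norm M (d 0) * k ^ n / s"
      using dn[of n] s by (intro divide_right_mono) auto
    finally show ?thesis by (simp add: power2_eq_square mult.assoc)
  qed
  moreover have "(\<lambda>n. L2_norm M (d 0) * k ^ n / s + L\<^sup>2 * L2_norm M (\<lambda>x. F n x - f x))
      \<longlonglongrightarrow> L2_norm M (d 0) * 0 / s + L\<^sup>2 * 0"
    using s by (intro tendsto_intros f LIMSEQ_realpow_zero k) auto
  ultimately have "L2_norm M (G f) \<le> 0"
    by (intro LIMSEQ_le_const[of _ 0]) auto
  \<comment> \<open>The limit satisfies the normal equation \<open>?B' (g - ?B f) = 0\<close>. By
    \<open>norm_Tz_cnj\<close> the adjoint has the same lower bound, so it is injective and the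
    residual itself vanishes.\<close>
  then have "c * L2_norm M (\<lambda>x. g x - ?B f x) \<le> 0"
    using cb[of "\<lambda>x. g x - ?B f x"] norm_Tz_cnj[of "\<lambda>x. g x - ?B f x" z]
      V_diff[OF assms(2) Tz_V[OF fV]] unfolding G_def by simp
  then have "L2_norm M (\<lambda>x. g x - ?B f x) = 0"
    using c L2_norm_nonneg[of M "\<lambda>x. g x - ?B f x"] by (simp add: mult_le_0_iff)
  then have "AE x in M. g x - ?B f x = 0"
    using L2_norm_eq_0_iff[OF V_L2[OF V_diff[OF assms(2) Tz_V[OF fV]]]] by blast
  then have "AE x in M. ?B f x = g x" by eventually_elim simp
  then show ?thesis using fV by blast
qed

text \<open>Surjectivity comes for free from \<open>bounded_below_surj\<close>, so membership in the
  spectrum reduces to a single inequality. The constant in \<open>resolvent_set\<close> may be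
  nonpositive, hence the replacement by \<open>\<bar>D\<bar> + 1\<close>.\<close>

lemma resolvent_set_iff: "z \<in> resolvent_set M V T \<longleftrightarrow> bounded_below z"
proof
  assume "z \<in> resolvent_set M V T"
  then obtain D where D: "\<And>f. f \<in> V \<Longrightarrow> L2_norm M f \<le> D * L2_norm M (Tz z f)"
    unfolding resolvent_set_def Tz_def by blast
  have "L2_norm M f \<le> (\<bar>D\<bar> + 1) * L2_norm M (Tz z f)" if "f \<in> V" for f
    using D[OF that] mult_right_mono[of D "\<bar>D\<bar> + 1" "L2_norm M (Tz z f)"] by force
  then show "bounded_below z"
    unfolding bounded_below_def by (intro exI[of _ "1 / (\<bar>D\<bar> + 1)"]) (auto simp: field_simps)
next
  assume b: "bounded_below z"
  then obtain c where "0 < c" "\<And>f. f \<in> V \<Longrightarrow> c * L2_norm M f \<le> L2_norm M (Tz z f)"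
    unfolding bounded_below_def by blast
  then have "\<exists>D. \<forall>f\<in>V. L2_norm M f \<le> D * L2_norm M (Tz z f)"
    by (intro exI[of _ "1 / c"]) (auto simp: field_simps)
  then show "z \<in> resolvent_set M V T"
    using bounded_below_surj[OF b] unfolding resolvent_set_def Tz_def by blast
qed

lemma spectrum_iff: "z \<in> spectrum M V T \<longleftrightarrow> \<not> bounded_below z"
  by (simp add: spectrum_def resolvent_set_iff)

lemma not_bounded_belowE:
  assumes "\<not> bounded_below z" "0 < e"
  obtains f where "f \<in> V" "L2_norm M f = 1" "L2_norm M (Tz z f) < e"
proof -
  obtain f where f: "f \<in> V" "L2_norm M (Tz z f) < e * L2_norm M f"
    using assms unfolding bounded_below_def by force
  have pos: "0 < L2_norm M f"
    using f(2) L2_norm_nonneg[of M f] L2_norm_nonneg[of M "Tz z f"] assms(2)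
    by (cases "L2_norm M f = 0") (simp_all add: less_le)
  define a where "a = complex_of_real (1 / L2_norm M f)"
  have "AE x in M. Tz z (\<lambda>x. a * f x) x = a * Tz z f x"
    using Tz_lin[OF f(1) f(1), of z a 0] by simp
  then have "L2_norm M (Tz z (\<lambda>x. a * f x)) = L2_norm M (\<lambda>x. a * Tz z f x)"
    by (intro L2_norm_cong_AE V_measurable V_scale Tz_V f)
  then have "L2_norm M (Tz z (\<lambda>x. a * f x)) = L2_norm M (Tz z f) / L2_norm M f"
    using pos unfolding L2_norm_scale by (simp add: a_def norm_divide)
  then have "L2_norm M (Tz z (\<lambda>x. a * f x)) < e"
    using f(2) pos by (simp add: pos_divide_less_eq)
  moreover have "L2_norm M (\<lambda>x. a * f x) = 1"
    unfolding L2_norm_scale using pos by (simp add: a_def norm_divide)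
  ultimately show ?thesis using that V_scale[OF f(1)] by blast
qed

text \<open>The form of \<open>T\<close> is real, so the imaginary part of the form of
  \<open>T - z\<close> is \<open>- Im z\<close> times the squared norm; Cauchy-Schwarz then gives
  the bound with constant \<open>\<bar>Im z\<bar>\<close>.\<close>

lemma bounded_below_nonreal:
  assumes "Im z \<noteq> 0" shows "bounded_below z"
  unfolding bounded_below_def
proof (intro exI[of _ "\<bar>Im z\<bar>"] conjI ballI)
  fix f assume f: "f \<in> V"
  obtain r where r: "L2_inner M (T f) f = of_real r" using inner_T_real[OF f] by blast
  have "L2_inner M (Tz z f) f = of_real r - z * of_real ((L2_norm M f)\<^sup>2)"
    using L2_inner_lin_left[OF V_L2[OF T_V[OF f]] V_L2[OF f] V_L2[OF f], of 1 "-z"]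
    by (simp add: Tz_def r L2_inner_self)
  then have "\<bar>Im z\<bar> * (L2_norm M f)\<^sup>2 = \<bar>Im (L2_inner M (Tz z f) f)\<bar>"
    by (simp add: abs_mult flip: of_real_power)
  also have "\<dots> \<le> L2_norm M (Tz z f) * L2_norm M f"
    using abs_Im_le_cmod L2_inner_bound[OF V_L2[OF Tz_V[OF f]] V_L2[OF f]] order_trans by blast
  finally show "\<bar>Im z\<bar> * L2_norm M f \<le> L2_norm M (Tz z f)"
    using L2_norm_nonneg[of M f]
    by (cases "L2_norm M f = 0") (auto simp: power2_eq_square mult.assoc[symmetric] less_le)
qed (use assms in simp)

text \<open>This rules out singular Weyl sequences at \<open>z\<close>: an orthonormal sequence of
  approximate eigenvectors has no Cauchy subsequence.\<close>

definition relatively_compact_at :: "complex \<Rightarrow> bool" where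
  "relatively_compact_at z \<longleftrightarrow>
    (\<forall>s. (\<forall>n. s n \<in> V \<and> L2_norm M (s n) = 1) \<longrightarrow> (\<lambda>n. L2_norm M (Tz z (s n))) \<longlonglongrightarrow> 0 \<longrightarrow>
      (\<exists>r. strict_mono r \<and> L2_Cauchy M (s \<circ> r)))"

lemma approximate_eigenvector_limit:
  assumes cpt: "relatively_compact_at z" and s: "\<And>n. s n \<in> V" "\<And>n. L2_norm M (s n) = 1"
    and lim: "(\<lambda>n. L2_norm M (Tz z (s n))) \<longlonglongrightarrow> 0"
  obtains r f where "strict_mono r" "f \<in> V" "L2_norm M f = 1"
    "(\<lambda>n. L2_norm M (\<lambda>x. s (r n) x - f x)) \<longlonglongrightarrow> 0" "AE x in M. Tz z f x = 0"
proof -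
  obtain r where r: "strict_mono r" "L2_Cauchy M (s \<circ> r)"
    using cpt s lim unfolding relatively_compact_at_def by blast
  have srV: "(s \<circ> r) n \<in> V" for n using s by simp
  obtain f where f: "f \<in> L2 M" "(\<lambda>n. L2_norm M (\<lambda>x. (s \<circ> r) n x - f x)) \<longlonglongrightarrow> 0"
    using L2_complete[where s="s \<circ> r", OF V_L2[OF srV] r(2)] by blast
  have fV: "f \<in> V" by (rule V_closed[OF srV f])
  have "\<bar>1 - L2_norm M f\<bar> \<le> L2_norm M (\<lambda>x. (s \<circ> r) n x - f x)" for n
    using L2_norm_triangle[OF L2_diff[OF V_L2[OF srV[of n]] f(1)] f(1)]
      L2_norm_triangle_diff[OF V_L2[OF srV[of n]] L2_diff[OF V_L2[OF srV[of n]] f(1)]] s(2)[of "r n"]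
    by simp
  then have "\<bar>1 - L2_norm M f\<bar> \<le> 0"
    using LIMSEQ_le_const[OF f(2)] by blast
  then have n1: "L2_norm M f = 1" by simp
  have lim': "(\<lambda>n. L2_norm M (Tz z (s (r n)))) \<longlonglongrightarrow> 0"
    using LIMSEQ_subseq_LIMSEQ[OF lim r(1)] by (simp add: o_def)
  have "L2_norm M (Tz z f) \<le> L2_norm M (Tz z (s (r n))) + (C + cmod z) * L2_norm M (\<lambda>x. (s \<circ> r) n x - f x)" for n
  proof -
    have "L2_norm M (Tz z f) \<le> L2_norm M (Tz z (s (r n))) + L2_norm M (\<lambda>x. Tz z (s (r n)) x - Tz z f x)"
      using L2_norm_triangle_diff[OF V_L2[OF Tz_V[OF s(1)[of "r n"], of z]]
          V_L2[OF V_diff[OF Tz_V[OF s(1)[of "r n"], of z] Tz_V[OF fV, of z]]]]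
      by simp
    also have "L2_norm M (\<lambda>x. Tz z (s (r n)) x - Tz z f x) = L2_norm M (Tz z (\<lambda>x. s (r n) x - f x))"
      using Tz_diff[OF s(1) fV, of z "r n"]
      by (intro L2_norm_cong_AE V_measurable V_diff Tz_V s fV) auto
    also have "\<dots> \<le> (C + cmod z) * L2_norm M (\<lambda>x. s (r n) x - f x)"
      by (rule Tz_bounded[OF V_diff[OF s(1) fV]])
    finally show ?thesis by simp
  qed
  moreover have "(\<lambda>n. L2_norm M (Tz z (s (r n))) + (C + cmod z) * L2_norm M (\<lambda>x. (s \<circ> r) n x - f x))
      \<longlonglongrightarrow> 0 + (C + cmod z) * 0"
    by (intro tendsto_intros lim' f)
  ultimately have "L2_norm M (Tz z f) \<le> 0"
    by (intro LIMSEQ_le_const[of _ 0]) auto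
  then have "AE x in M. Tz z f x = 0"
    using L2_norm_eq_0_iff[OF V_L2[OF Tz_V[OF fV]], of z] L2_norm_nonneg[of M "Tz z f"] by simp
  then show ?thesis using that[OF r(1) fV n1] f(2) by simp
qed

lemma eigenspace_iff: "f \<in> eigenspace M V T z \<longleftrightarrow> f \<in> V \<and> (AE x in M. Tz z f x = 0)"
  by (simp add: eigenspace_def Tz_def)

lemma eigenvalue_of_spectrum:
  assumes cpt: "relatively_compact_at z" and nb: "\<not> bounded_below z"
  shows "is_eigenvalue M V T z"
proof -
  have "\<exists>f. f \<in> V \<and> L2_norm M f = 1 \<and> L2_norm M (Tz z f) < inverse (real (Suc n))" for n
  proof -
    have "0 < inverse (real (Suc n))" by simp
    with nb show ?thesis by (rule not_bounded_belowE) blast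
  qed
  then obtain s where s: "\<And>n. s n \<in> V" "\<And>n. L2_norm M (s n) = 1"
    "\<And>n. L2_norm M (Tz z (s n)) < inverse (real (Suc n))" by metis
  have "(\<lambda>n. L2_norm M (Tz z (s n))) \<longlonglongrightarrow> 0"
  proof (rule real_tendsto_sandwich[OF _ _ tendsto_const LIMSEQ_inverse_real_of_nat])
    show "\<forall>\<^sub>F n in sequentially. L2_norm M (Tz z (s n)) \<le> inverse (real (Suc n))"
      using s(3) by (intro always_eventually allI less_imp_le)
  qed simp
  then obtain f where f: "f \<in> V" "L2_norm M f = 1" "AE x in M. Tz z f x = 0"
    by (rule approximate_eigenvector_limit[OF cpt s(1,2)])
  then show ?thesis
    unfolding is_eigenvalue_def using L2_norm_eq_0_iff[OF V_L2[OF f(1)]]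
    by (intro bexI[of _ f]) (auto simp: eigenspace_iff)
qed

text \<open>If \<open>y\<^sub>n \<rightarrow> z\<close> in the spectrum, pairing an almost-eigenvector at \<open>y\<^sub>n\<close> with the limiting
  eigenvector at \<open>z\<close> makes them almost orthogonal, which contradicts convergence.\<close>

lemma isolated_in_spectrum:
  assumes cpt: "relatively_compact_at (of_real z)" and nb: "\<not> bounded_below (of_real z)"
  shows "of_real z isolated_in spectrum M V T"
proof (rule ccontr)
  let ?z = "complex_of_real z"
  assume "\<not> ?z isolated_in spectrum M V T"
  moreover have "?z \<in> spectrum M V T" using nb by (simp add: spectrum_iff)
  ultimately have ex: "\<exists>y. y \<in> spectrum M V T \<and> dist ?z y < e \<and> y \<noteq> ?z" if "0 < e" for e
    using that unfolding isolated_in_dist_Ex_iff by blast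
  have "\<exists>y. y \<in> spectrum M V T \<and> dist ?z y < inverse (real (Suc n)) \<and> y \<noteq> ?z" for n
    by (rule ex) simp
  then obtain y where y: "\<And>n. y n \<in> spectrum M V T" "\<And>n. dist ?z (y n) < inverse (real (Suc n))"
    "\<And>n. y n \<noteq> ?z" by metis
  have "\<exists>f. f \<in> V \<and> L2_norm M f = 1 \<and> L2_norm M (Tz (y n) f) < cmod (?z - y n) * inverse (real (Suc n))" for n
  proof -
    have "0 < cmod (?z - y n) * inverse (real (Suc n))" using y(3)[of n] by simp
    with y(1)[of n] show ?thesis unfolding spectrum_iff by (rule not_bounded_belowE) blast
  qed
  then obtain s where s: "\<And>n. s n \<in> V" "\<And>n. L2_norm M (s n) = 1"
    "\<And>n. L2_norm M (Tz (y n) (s n)) < cmod (?z - y n) * inverse (real (Suc n))" by metis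
  have inv1: "inverse (real (Suc n)) \<le> 1" for n by (simp add: inverse_le_1_iff)
  have bd: "L2_norm M (Tz ?z (s n)) \<le> 2 * inverse (real (Suc n))" for n
  proof -
    have "L2_norm M (Tz ?z (s n)) = L2_norm M (\<lambda>x. Tz (y n) (s n) x + (y n - ?z) * s n x)"
      by (simp add: Tz_def algebra_simps)
    also have "\<dots> \<le> L2_norm M (Tz (y n) (s n)) + cmod (y n - ?z) * L2_norm M (s n)"
      using L2_norm_triangle[OF V_L2[OF Tz_V[OF s(1)]] L2_scale[OF V_L2[OF s(1)]], of "y n" n "y n - ?z" n]
      by (simp add: L2_norm_scale)
    also have "\<dots> \<le> cmod (?z - y n) + cmod (?z - y n)"
      using s(3)[of n] s(2)[of n] mult_left_mono[OF inv1[of n] norm_ge_zero[of "?z - y n"]]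
      by (simp add: norm_minus_commute)
    also have "\<dots> \<le> 2 * inverse (real (Suc n))"
      using y(2)[of n] by (simp add: dist_norm)
    finally show ?thesis .
  qed
  have "(\<lambda>n. L2_norm M (Tz ?z (s n))) \<longlonglongrightarrow> 0"
  proof (rule real_tendsto_sandwich[OF _ _ tendsto_const])
    show "(\<lambda>n. 2 * inverse (real (Suc n))) \<longlonglongrightarrow> 0"
      using tendsto_mult[OF tendsto_const LIMSEQ_inverse_real_of_nat, of 2] by simp
  qed (use bd in auto)
  then obtain r f where f: "strict_mono r" "f \<in> V" "L2_norm M f = 1"
    "(\<lambda>n. L2_norm M (\<lambda>x. s (r n) x - f x)) \<longlonglongrightarrow> 0" "AE x in M. Tz ?z f x = 0"
    by (rule approximate_eigenvector_limit[OF cpt s(1,2)])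
  have ip: "cmod (L2_inner M (s n) f) \<le> inverse (real (Suc n))" for n
  proof -
    have "AE x in M. Tz (cnj (y n)) f x = (?z - cnj (y n)) * f x"
      using f(5) by eventually_elim (simp add: Tz_def algebra_simps)
    then have "L2_inner M (s n) (Tz (cnj (y n)) f)
        = L2_inner M (s n) (\<lambda>x. (?z - cnj (y n)) * f x + 0 * f x)"
      by (intro L2_inner_cong_AE V_measurable V_lin Tz_V s f) auto
    also have "\<dots> = (?z - y n) * L2_inner M (s n) f"
      by (subst L2_inner_lin_right) (auto intro!: V_L2 s f)
    finally have "L2_inner M (Tz (y n) (s n)) f = (?z - y n) * L2_inner M (s n) f"
      using Tz_adjoint[OF s(1) f(2), of "y n" n] by simp
    then have "cmod (?z - y n) * cmod (L2_inner M (s n) f) \<le> cmod (?z - y n) * inverse (real (Suc n))"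
      using L2_inner_bound[OF V_L2[OF Tz_V[OF s(1)]] V_L2[OF f(2)], of "y n" n] s(3)[of n] f(3)
      by (simp add: norm_mult)
    then show ?thesis using y(3)[of n] by (subst (asm) mult_le_cancel_left_pos) auto
  qed
  have "1 \<le> L2_norm M (\<lambda>x. s (r n) x - f x) + inverse (real (Suc n))" for n
  proof -
    have "L2_inner M f f = L2_inner M (s (r n)) f - L2_inner M (\<lambda>x. s (r n) x - f x) f"
      using L2_inner_lin_left[OF V_L2[OF s(1)] V_L2[OF f(2)] V_L2[OF f(2)], of 1 "r n" "-1"] by simp
    then have "1 \<le> cmod (L2_inner M (s (r n)) f) + cmod (L2_inner M (\<lambda>x. s (r n) x - f x) f)"
      using norm_triangle_ineq4[of "L2_inner M (s (r n)) f" "L2_inner M (\<lambda>x. s (r n) x - f x) f"]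
      by (simp add: L2_inner_self f(3))
    moreover have "inverse (real (Suc (r n))) \<le> inverse (real (Suc n))"
      using seq_suble[OF f(1), of n] by (intro le_imp_inverse_le) auto
    ultimately show ?thesis
      using ip[of "r n"] L2_inner_bound[OF V_L2[OF V_diff[OF s(1) f(2)]] V_L2[OF f(2)], of "r n"]
      unfolding f(3) mult_1_right by linarith
  qed
  moreover have "(\<lambda>n. L2_norm M (\<lambda>x. s (r n) x - f x) + inverse (real (Suc n))) \<longlonglongrightarrow> 0 + 0"
    by (intro tendsto_intros f LIMSEQ_inverse_real_of_nat)
  ultimately have "(1::real) \<le> 0 + 0" using LIMSEQ_le_const by blast
  then show False by simp
qed

lemma eigenspace_lin:
  assumes "f \<in> eigenspace M V T z" "g \<in> eigenspace M V T z"
  shows "(\<lambda>x. a * f x + b * g x) \<in> eigenspace M V T z"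
proof -
  have "AE x in M. Tz z (\<lambda>x. a * f x + b * g x) x = 0"
    using Tz_lin[of f g z a b] assms unfolding eigenspace_iff by auto
  then show ?thesis using assms V_lin by (auto simp: eigenspace_iff)
qed

text \<open>One Gram-Schmidt step: infinite multiplicity supplies an eigenfunction outside the span
  of the family, and removing its projections leaves a nonzero remainder.\<close>

lemma eigenspace_orthogonal_step:
  fixes s :: "nat \<Rightarrow> 'a \<Rightarrow> complex"
  assumes nf: "\<not> finite_multiplicity M V T z"
    and s: "\<And>i. i < n \<Longrightarrow> s i \<in> eigenspace M V T z" "\<And>i. i < n \<Longrightarrow> L2_norm M (s i) = 1"
      "\<And>i j. i < n \<Longrightarrow> j < n \<Longrightarrow> i \<noteq> j \<Longrightarrow> L2_inner M (s i) (s j) = 0"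
  shows "\<exists>f\<in>eigenspace M V T z. L2_norm M f = 1 \<and> (\<forall>i<n. L2_inner M f (s i) = 0)"
proof -
  \<comment> \<open>\<open>finite_multiplicity\<close> sums over a set of functions, so the indexed
    family must be seen to have no repetitions before its sum can be reindexed.\<close>
  have inj: "inj_on s {..<n}"
  proof (rule inj_onI, rule ccontr)
    fix i j assume *: "i \<in> {..<n}" "j \<in> {..<n}" "s i = s j" "i \<noteq> j"
    have "L2_inner M (s i) (s j) = 0" by (rule s(3)) (use * in auto)
    then have "L2_inner M (s i) (s i) = 0" by (simp only: *(3))
    moreover have "L2_norm M (s i) = 1" by (rule s(2)) (use * in auto)
    ultimately show False by (simp add: L2_inner_self)
  qed
  have "\<not> (\<forall>f\<in>eigenspace M V T z. \<exists>c. AE x in M. f x = (\<Sum>b\<in>s ` {..<n}. c b * b x))"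
  proof
    assume "\<forall>f\<in>eigenspace M V T z. \<exists>c. AE x in M. f x = (\<Sum>b\<in>s ` {..<n}. c b * b x)"
    moreover have "finite (s ` {..<n})" "s ` {..<n} \<subseteq> eigenspace M V T z" using s(1) by auto
    ultimately have "finite_multiplicity M V T z"
      unfolding finite_multiplicity_def by (intro exI[of _ "s ` {..<n}"] conjI)
    then show False using nf by simp
  qed
  then obtain f where f: "f \<in> eigenspace M V T z"
    and nspan: "\<forall>c. \<not> (AE x in M. f x = (\<Sum>b\<in>s ` {..<n}. c b * b x))"
    unfolding bex_simps(8)[symmetric] by blast
  have L: "g \<in> L2 M" if "g \<in> eigenspace M V T z" for g
    using that V_L2 by (auto simp: eigenspace_iff)
  \<comment> \<open>Projections are removed one at a time. The coefficients use \<open>f\<close>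
    instead of the current remainder, which is the same by orthogonality of the family.\<close>
  define P where "P m x = f x - (\<Sum>i<m. L2_inner M f (s i) * s i x)" for m x
  have PS: "P (Suc m) = (\<lambda>x. 1 * P m x + (- L2_inner M f (s m)) * s m x)" for m
    by (simp add: P_def fun_eq_iff)
  have P: "P m \<in> eigenspace M V T z \<and>
      (\<forall>j<n. L2_inner M (P m) (s j) = (if j < m then 0 else L2_inner M f (s j)))" if "m \<le> n" for m
    using that
  proof (induction m)
    case 0
    have "P 0 = f" by (simp add: P_def fun_eq_iff)
    then show ?case using f by simp
  next
    case (Suc m)
    have "L2_inner M (P (Suc m)) (s j) = (if j < Suc m then 0 else L2_inner M f (s j))" if "j < n" for j
    proof -
      have "L2_inner M (P (Suc m)) (s j) = L2_inner M (P m) (s j) - L2_inner M f (s m) * L2_inner M (s m) (s j)"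
        unfolding PS using Suc that s(1)[of m] s(1)[of j] by (subst L2_inner_lin_left) (auto intro!: L)
      also have "\<dots> = (if j < Suc m then 0 else L2_inner M f (s j))"
        using Suc that s(3)[of m j] s(2)[of m] by (cases "j = m") (auto simp: L2_inner_self less_Suc_eq)
      finally show ?thesis .
    qed
    moreover have "P (Suc m) \<in> eigenspace M V T z"
      unfolding PS by (rule eigenspace_lin) (use Suc s(1)[of m] in auto)
    ultimately show ?case by blast
  qed
  have Pn: "P n \<in> eigenspace M V T z" "\<And>j. j < n \<Longrightarrow> L2_inner M (P n) (s j) = 0"
    using P[of n] by auto
  have "\<not> (AE x in M. P n x = 0)"
  proof
    assume "AE x in M. P n x = 0"
    then have "AE x in M. f x = (\<Sum>b\<in>s ` {..<n}. L2_inner M f b * b x)"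
      by eventually_elim (simp add: P_def sum.reindex[OF inj])
    then show False using nspan[rule_format] by blast
  qed
  then have pos: "0 < L2_norm M (P n)"
    using L2_norm_eq_0_iff[OF L[OF Pn(1)]] L2_norm_nonneg[of M "P n"] by linarith
  define a where "a = complex_of_real (1 / L2_norm M (P n))"
  have "(\<lambda>x. a * P n x) \<in> eigenspace M V T z"
    using eigenspace_lin[OF Pn(1) Pn(1), of a 0] by simp
  moreover have "L2_norm M (\<lambda>x. a * P n x) = 1"
    unfolding L2_norm_scale using pos by (simp add: a_def norm_divide)
  moreover have "L2_inner M (\<lambda>x. a * P n x) (s j) = 0" if "j < n" for j
    using Pn(2)[OF that] by (simp add: L2_inner_scale_left)
  ultimately show ?thesis by blast
qed

text \<open>Otherwise there is an infinite orthonormal sequence of eigenfunctions. It is a sequence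
  of approximate eigenvectors whose members have pairwise squared distance 2, so no subsequence is
  Cauchy.\<close>

lemma finite_multiplicity_at:
  assumes cpt: "relatively_compact_at z"
  shows "finite_multiplicity M V T z"
proof (rule ccontr)
  assume nf: "\<not> finite_multiplicity M V T z"
  define Q where "Q s n f \<longleftrightarrow> f \<in> eigenspace M V T z \<and> L2_norm M f = 1 \<and>
    (\<forall>i<n. L2_inner M f (s i) = 0)" for s :: "nat \<Rightarrow> 'a \<Rightarrow> complex" and n f
  have "\<exists>s. \<forall>n. Q s n (s n)"
  \<comment> \<open>Each new vector depends on all previous ones, not just on the last, so the
    choice is a course-of-values one.\<close>
  proof (rule dependent_wellorder_choice)
    show "Q s n r = Q t n r" if "\<And>m. m < n \<Longrightarrow> s m = t m" for r s t n
      using that by (auto simp: Q_def)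
    show "\<exists>r. Q s n r" if H: "\<And>m. m < n \<Longrightarrow> Q s m (s m)" for n s
    proof -
      have "L2_inner M (s i) (s j) = 0" if "i < n" "j < n" "i \<noteq> j" for i j
      proof (cases "j < i")
        case True
        then show ?thesis using H[OF that(1)] unfolding Q_def by blast
      next
        case False
        then have "L2_inner M (s j) (s i) = 0" using H[OF that(2)] that(3) unfolding Q_def by simp
        then show ?thesis using L2_inner_cnj[of M "s i" "s j"] by simp
      qed
      then show ?thesis
        using eigenspace_orthogonal_step[OF nf, of n s] H unfolding Q_def by blast
    qed
  qed
  then obtain s where s: "\<And>n. Q s n (s n)" by blast
  have sV: "s n \<in> V" "L2_norm M (s n) = 1" "AE x in M. Tz z (s n) x = 0" for n
    using s[of n] unfolding Q_def eigenspace_iff by blast+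
  have "L2_norm M (Tz z (s n)) = 0" for n
    using L2_norm_eq_0_iff[OF V_L2[OF Tz_V[OF sV(1)]]] sV(3) by blast
  then have "(\<lambda>n. L2_norm M (Tz z (s n))) \<longlonglongrightarrow> 0" by simp
  then obtain r where r: "strict_mono r" "L2_Cauchy M (s \<circ> r)"
    using cpt sV(1,2) unfolding relatively_compact_at_def by blast
  then obtain N where N: "\<And>m n. N \<le> m \<Longrightarrow> N \<le> n \<Longrightarrow> L2_norm M (\<lambda>x. s (r m) x - s (r n) x) < 1"
    unfolding L2_Cauchy_def o_def by (metis zero_less_one)
  have "r N < r (Suc N)" using r(1) by (simp add: strict_mono_def)
  then have "L2_inner M (s (r (Suc N))) (s (r N)) = 0" using s[of "r (Suc N)"] by (simp add: Q_def)
  then have "(L2_norm M (\<lambda>x. s (r (Suc N)) x - s (r N) x))\<^sup>2 = 2"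
    using L2_norm_diff_scale_power2[OF V_L2[OF sV(1)] V_L2[OF sV(1)], of "r (Suc N)" 1 "r N"]
    by (simp add: sV(2))
  moreover have "(L2_norm M (\<lambda>x. s (r (Suc N)) x - s (r N) x))\<^sup>2 \<le> 1\<^sup>2"
    using N[of "Suc N" N] by (intro power_mono) auto
  ultimately show False by simp
qed

lemma discrete_spectrum_of_real:
  assumes "relatively_compact_at (of_real z)" "of_real z \<in> spectrum M V T"
  shows "of_real z \<in> discrete_spectrum M V T"
  using assms isolated_in_spectrum eigenvalue_of_spectrum finite_multiplicity_at
  unfolding discrete_spectrum_def spectrum_iff by blast

text \<open>Since \<open>S\<close> has no isolated points, none of its points can be isolated in the spectrum,
  so no spectral theorem is needed to recognise them as essential spectrum.\<close>

theorem essential_spectrum_eqI: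
  assumes spec: "\<And>z. z \<in> S \<Longrightarrow> \<not> bounded_below (of_real z)"
    and perfect: "\<And>z e. z \<in> S \<Longrightarrow> 0 < e \<Longrightarrow> \<exists>y\<in>S. y \<noteq> z \<and> \<bar>y - z\<bar> < e"
    and cpt: "\<And>z. z \<notin> S \<Longrightarrow> relatively_compact_at (of_real z)"
  shows "essential_spectrum M V T = of_real ` S"
proof (intro equalityI subsetI)
  fix w assume w: "w \<in> essential_spectrum M V T"
  then have "w \<in> spectrum M V T" by (simp add: essential_spectrum_def)
  then have "Im w = 0" using bounded_below_nonreal spectrum_iff by blast
  then have w_eq: "w = of_real (Re w)" by (simp add: complex_eq_iff)
  have "Re w \<in> S"
    using discrete_spectrum_of_real[of "Re w"] cpt[of "Re w"] w w_eq
    unfolding essential_spectrum_def by auto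
  then show "w \<in> of_real ` S" using w_eq by blast
next
  fix w :: complex assume "w \<in> of_real ` S"
  then obtain z where z: "z \<in> S" "w = of_real z" by blast
  have "\<not> w isolated_in spectrum M V T"
  proof
    assume "w isolated_in spectrum M V T"
    then obtain e where e: "0 < e" "\<And>y. y \<in> spectrum M V T \<Longrightarrow> dist w y < e \<Longrightarrow> y = w"
      unfolding isolated_in_dist_Ex_iff by blast
    obtain y where y: "y \<in> S" "y \<noteq> z" "\<bar>y - z\<bar> < e" using perfect[OF z(1) e(1)] by blast
    have "dist w (of_real y) < e"
      using y(3) z(2) by (simp add: dist_norm abs_minus_commute flip: of_real_diff)
    then show False using e(2)[of "of_real y"] spec[OF y(1)] y(2) z(2) by (simp add: spectrum_iff)
  qed
  then show "w \<in> essential_spectrum M V T"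
    using spec[OF z(1)] z(2) by (simp add: essential_spectrum_def discrete_spectrum_def spectrum_iff)
qed

end

section \<open>Haar measure on the torus\<close>

lemma torus_sets [measurable]: "(torus :: (real ^ 'n) set) \<in> sets borel"
proof -
  have "(torus :: (real ^ 'n) set) = (\<Inter>i. {p. - pi < p $ i} \<inter> {p. p $ i \<le> pi})"
    by (auto simp: torus_def)
  also have "\<dots> \<in> sets borel"
    by (intro sets.countable_INT'' sets.Int borel_open borel_closed open_Collect_less closed_Collect_le
        continuous_intros) auto
  finally show ?thesis .
qed

lemma space_haar [simp]: "space haar = torus"
  by (simp add: haar_def space_scale_measure space_restrict_space)

lemma sets_haar: "sets haar = sets (restrict_space borel torus)"
  by (simp add: haar_def sets_restrict_space)

lemma sets_haar_iff: "A \<in> sets haar \<longleftrightarrow> A \<in> sets borel \<and> A \<subseteq> torus"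
  unfolding sets_haar by (subst sets_restrict_space_iff) auto

lemma measurable_haar1: "f \<in> measurable borel N \<Longrightarrow> f \<in> measurable haar N"
  using measurable_restrict_space1[of f borel N torus] measurable_cong_sets[OF sets_haar refl] by blast

lemma emeasure_haar:
  fixes A :: "(real ^ 'n) set"
  assumes "A \<in> sets borel" "A \<subseteq> torus"
  shows "emeasure haar A = ennreal (1 / (2 * pi) ^ CARD('n)) * emeasure lborel A"
  using assms by (simp add: haar_def emeasure_restrict_space)

lemma emeasure_lborel_cube:
  fixes a :: real
  defines "b \<equiv> \<chi> i. a :: real ^ 'n"
  assumes "0 \<le> a"
  shows "emeasure lborel (cbox (- b) b) = ennreal ((2 * a) ^ CARD('n))"
    "emeasure lborel (box (- b) b) = ennreal ((2 * a) ^ CARD('n))"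
proof -
  have bas: "\<exists>i. v = axis i 1" if "v \<in> Basis" for v :: "real ^ 'n"
    using that unfolding Basis_vec_def by auto
  have "(\<Prod>v\<in>Basis. (b - - b) \<bullet> v) = (\<Prod>v\<in>(Basis :: (real ^ 'n) set). 2 * a)"
  proof (rule prod.cong[OF refl])
    fix v :: "real ^ 'n" assume "v \<in> Basis"
    then obtain i where "v = axis i 1" using bas by blast
    then show "(b - - b) \<bullet> v = 2 * a" by (simp add: inner_axis b_def)
  qed
  moreover have "- b \<bullet> v \<le> b \<bullet> v" if v: "v \<in> Basis" for v
    using bas[OF v] assms(2) by (auto simp: inner_axis b_def)
  ultimately show "emeasure lborel (cbox (- b) b) = ennreal ((2 * a) ^ CARD('n))"
    "emeasure lborel (box (- b) b) = ennreal ((2 * a) ^ CARD('n))"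
    by (simp_all add: emeasure_lborel_cbox emeasure_lborel_box)
qed

text \<open>The half-open cube lies between an open and a closed cube of equal volume.\<close>

lemma emeasure_lborel_torus: "emeasure lborel (torus :: (real ^ 'n) set) = ennreal ((2 * pi) ^ CARD('n))"
proof (rule antisym)
  let ?b = "\<chi> i. pi :: real ^ 'n"
  have "emeasure lborel (torus :: (real ^ 'n) set) \<le> emeasure lborel (cbox (- ?b) ?b)"
    by (intro emeasure_mono) (auto simp: torus_def mem_box_cart less_imp_le)
  then show "emeasure lborel (torus :: (real ^ 'n) set) \<le> ennreal ((2 * pi) ^ CARD('n))"
    by (simp add: emeasure_lborel_cube)
  have "emeasure lborel (box (- ?b) ?b) \<le> emeasure lborel (torus :: (real ^ 'n) set)"
    by (intro emeasure_mono) (auto simp: torus_def mem_box_cart less_imp_le)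
  then show "ennreal ((2 * pi) ^ CARD('n)) \<le> emeasure lborel (torus :: (real ^ 'n) set)"
    by (simp add: emeasure_lborel_cube)
qed

interpretation haar: prob_space "haar :: (real ^ 'n) measure"
proof
  have "emeasure haar (torus :: (real ^ 'n) set) = 1"
    by (simp add: emeasure_haar emeasure_lborel_torus ennreal_mult[symmetric] del: ennreal_1 flip: ennreal_1)
  then show "emeasure haar (space haar :: (real ^ 'n) set) = 1" by simp
qed

interpretation haar2: pair_prob_space "haar :: (real ^ 'n) measure" "haar :: (real ^ 'n) measure" ..

section \<open>The period lattice and invariance of the Haar measure\<close>

definition lattice_vec :: "int ^ 'n \<Rightarrow> real ^ 'n" where
  "lattice_vec m = (\<chi> i. 2 * pi * of_int (m $ i))"

lemma wrap_eq_lattice: "\<exists>m. wrap p = p + lattice_vec m"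
proof -
  obtain m where "\<And>i. wrap p $ i = p $ i + 2 * pi * of_int (m i)"
    using wrap_eq_mod[of p] by metis
  then show ?thesis
    by (intro exI[of _ "\<chi> i. m i"]) (simp add: vec_eq_iff lattice_vec_def)
qed

lemma lattice_vec_minus: "lattice_vec (- m) = - lattice_vec m"
  by (simp add: lattice_vec_def vec_eq_iff)

lemma lattice_vec_add: "lattice_vec (m + n) = lattice_vec m + lattice_vec n"
  by (simp add: lattice_vec_def vec_eq_iff algebra_simps)

lemma lattice_unique:
  assumes "p + lattice_vec m \<in> torus" "p + lattice_vec n \<in> torus" shows "m = n"
proof -
  have "m $ i = n $ i" for i
  proof -
    have a: "- pi < p $ i + 2 * pi * of_int (m $ i)" "p $ i + 2 * pi * of_int (m $ i) \<le> pi"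
      "- pi < p $ i + 2 * pi * of_int (n $ i)" "p $ i + 2 * pi * of_int (n $ i) \<le> pi"
      using assms by (auto simp: torus_def lattice_vec_def)
    have "2 * pi * of_int (m $ i - n $ i) < 2 * pi * 1" "2 * pi * (-1) < 2 * pi * of_int (m $ i - n $ i)"
      using a by (auto simp: algebra_simps)
    then have "real_of_int (m $ i - n $ i) < 1" "-1 < real_of_int (m $ i - n $ i)"
      using pi_gt_zero mult_less_cancel_left_pos[of "2 * pi"] by (meson mult_pos_pos zero_less_numeral)+
    then show ?thesis by linarith
  qed
  then show ?thesis by (simp add: vec_eq_iff)
qed

lemma lattice_ex1: "\<exists>!m. p + lattice_vec m \<in> torus"
  using wrap_eq_lattice[of p] wrap_in_torus[of p] lattice_unique[of p] by metis

lemma wrap_eqI: "q \<in> torus \<Longrightarrow> q = p + lattice_vec m \<Longrightarrow> wrap p = q"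
  using wrap_eq_lattice[of p] wrap_in_torus[of p] lattice_unique[of p] by metis

lemma wrap_id: "p \<in> torus \<Longrightarrow> wrap p = p"
  by (rule wrap_eqI[of _ _ 0]) (auto simp: lattice_vec_def vec_eq_iff)

lemma wrap_lattice: "wrap (p + lattice_vec m) = wrap p"
proof -
  obtain n where n: "wrap p = p + lattice_vec n" using wrap_eq_lattice by blast
  have "lattice_vec n = lattice_vec m + lattice_vec (n - m)" by (simp flip: lattice_vec_add)
  then have "wrap p = (p + lattice_vec m) + lattice_vec (n - m)" using n by simp
  then show ?thesis by (rule wrap_eqI[OF wrap_in_torus])
qed

lemma wrap_measurable [measurable]: "wrap \<in> measurable borel (borel :: (real ^ 'n) measure)"
proof -
  have "(\<lambda>p. wrap p $ i) \<in> borel_measurable (borel :: (real ^ 'n) measure)" for i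
    unfolding wrap_def rmod_def by simp measurable
  then show ?thesis
    by (subst borel_measurable_euclidean_space)
      (auto simp: Basis_vec_def inner_axis)
qed

lemma wrap_measurable_haar: "f \<in> measurable N borel \<Longrightarrow> (\<lambda>x. wrap (f x)) \<in> measurable N haar"
  unfolding measurable_cong_sets[OF refl sets_haar]
  by (rule measurable_restrict_space2) (auto simp: wrap_in_torus)

lemma id_measurable_haar: "(\<lambda>x. x) \<in> measurable haar borel"
  by (rule measurable_haar1) simp

text \<open>The unique-existence hypothesis states covering and disjointness at once. It is applied
  to two tilings of space by lattice translates of a fundamental domain.\<close>

lemma emeasure_lborel_partition:
  fixes S :: "int ^ 'n \<Rightarrow> (real ^ 'n) set"
  assumes Q: "Q \<in> sets borel" and S: "\<And>m. S m \<in> sets borel" and ex1: "\<And>x. \<exists>!m. x \<in> S m"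
  shows "emeasure lborel Q = (\<integral>\<^sup>+m. emeasure lborel (Q \<inter> S m) \<partial>count_space UNIV)"
proof -
  have "x \<in> (\<Union>m. S m)" for x using ex1[of x] by (auto dest: ex1_implies_ex)
  then have "(\<Union>m. Q \<inter> S m) = Q" by auto
  then have "emeasure lborel Q = emeasure lborel (\<Union>m. Q \<inter> S m)" by simp
  also have "\<dots> = (\<integral>\<^sup>+m. emeasure lborel (Q \<inter> S m) \<partial>count_space UNIV)"
  proof (rule emeasure_UN_countable)
    show "disjoint_family (\<lambda>m. Q \<inter> S m)"
      unfolding disjoint_family_on_def
    proof (intro ballI impI)
      fix m n :: "int ^ 'n" assume "m \<noteq> n"
      then have "x \<notin> S m \<or> x \<notin> S n" for x using ex1_implies_ex[OF ex1[of x]] ex1[of x] by auto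
      then show "(Q \<inter> S m) \<inter> (Q \<inter> S n) = {}" by auto
    qed
  qed (use Q S in auto)
  finally show ?thesis .
qed

lemma emeasure_lborel_affine:
  fixes A :: "(real ^ 'n) set"
  assumes "A \<in> sets borel" "s = 1 \<or> s = -1"
  shows "emeasure lborel {x. c + s *\<^sub>R x \<in> A} = emeasure lborel A"
proof -
  have "lborel = distr lborel borel (\<lambda>x :: real ^ 'n. c + s *\<^sub>R x)"
    using lborel_affine[of s c] assms(2) by (auto simp: density_1)
  then have "emeasure lborel A = emeasure (distr lborel borel (\<lambda>x. c + s *\<^sub>R x)) A" by simp
  also have "\<dots> = emeasure lborel {x. c + s *\<^sub>R x \<in> A}"
    using assms(1) by (subst emeasure_distr) (auto simp: vimage_def)
  finally show ?thesis by simp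
qed

lemma emeasure_lborel_translate:
  fixes A :: "(real ^ 'n) set"
  assumes "A \<in> sets borel" shows "emeasure lborel {x. c + x \<in> A} = emeasure lborel A"
  using emeasure_lborel_affine[OF assms, of 1 c] by simp

text \<open>The image of the torus under \<open>p \<mapsto> a + s p\<close> is another fundamental
  domain of the lattice. Cutting it along the standard tiles and moving the pieces back by periods
  rearranges it into the torus, and the periodic set \<open>P\<close> is unaffected by these
  moves.\<close>

lemma distr_haar_affine:
  fixes a :: "real ^ 'n"
  assumes s: "s = 1 \<or> s = -1"
  shows "distr haar haar (\<lambda>p. wrap (a + s *\<^sub>R p)) = haar"
proof (rule measure_eqI)
  have m: "(\<lambda>p. wrap (a + s *\<^sub>R p)) \<in> measurable haar (haar :: (real ^ 'n) measure)"
    by (intro wrap_measurable_haar measurable_haar1) measurable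
  fix A :: "(real ^ 'n) set" assume "A \<in> sets (distr haar haar (\<lambda>p. wrap (a + s *\<^sub>R p)))"
  then have A: "A \<in> sets borel" "A \<subseteq> torus" "A \<in> sets haar" by (auto simp: sets_haar_iff)
  note [measurable] = A(1)
  define P where "P = {x. wrap x \<in> A}"
  define Q where "Q = {x. x \<in> P \<and> s *\<^sub>R (x - a) \<in> torus}"
  have [measurable]: "P \<in> sets borel" unfolding P_def by measurable
  have [measurable]: "Q \<in> sets borel" unfolding Q_def by measurable
  have P_lattice: "x + lattice_vec m \<in> P \<longleftrightarrow> x \<in> P" for x m by (simp add: P_def wrap_lattice)
  have ss: "s * s = 1" using s by auto
  have "emeasure (distr haar haar (\<lambda>p. wrap (a + s *\<^sub>R p))) A
      = emeasure haar {p\<in>torus. a + s *\<^sub>R p \<in> P}"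
    using m A(3) by (subst emeasure_distr) (auto simp: P_def vimage_def Int_def conj_commute)
  also have "\<dots> = ennreal (1 / (2 * pi) ^ CARD('n)) * emeasure lborel {p\<in>torus. a + s *\<^sub>R p \<in> P}"
    by (rule emeasure_haar) auto
  also have "{p\<in>torus. a + s *\<^sub>R p \<in> P} = {p. a + s *\<^sub>R p \<in> Q}"
    by (auto simp: Q_def ss)
  also have "emeasure lborel {p. a + s *\<^sub>R p \<in> Q} = emeasure lborel Q"
    by (rule emeasure_lborel_affine[OF _ s]) measurable
  \<comment> \<open>\<open>Q\<close> is the part of \<open>P\<close> inside the moved fundamental
    domain; it is cut along the translates of \<open>torus\<close>.\<close>
  also have "emeasure lborel Q = (\<integral>\<^sup>+m. emeasure lborel (Q \<inter> {x. x - lattice_vec m \<in> torus}) \<partial>count_space UNIV)"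
  proof (rule emeasure_lborel_partition)
    fix x :: "real ^ 'n"
    obtain m where m: "x + lattice_vec m \<in> torus" using lattice_ex1[of x] by blast
    show "\<exists>!m. x \<in> {x. x - lattice_vec m \<in> torus}"
    proof (rule ex1I[of _ "- m"])
      show "x \<in> {x. x - lattice_vec (- m) \<in> torus}" using m by (simp add: lattice_vec_minus)
      show "n = - m" if "x \<in> {x. x - lattice_vec n \<in> torus}" for n
        using lattice_unique[of x "- n" m] that m by (simp add: lattice_vec_minus) (metis minus_minus)
    qed
  qed measurable
  \<comment> \<open>The piece in tile \<open>m\<close> is translated by \<open>lattice_vec m\<close>
    back into \<open>torus\<close>.\<close>
  also have "\<dots> = (\<integral>\<^sup>+m. emeasure lborel ((torus \<inter> P) \<inter> {x. s *\<^sub>R (x + lattice_vec m - a) \<in> torus}) \<partial>count_space UNIV)"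
  proof (rule nn_integral_cong)
    fix m :: "int ^ 'n"
    have "emeasure lborel (Q \<inter> {x. x - lattice_vec m \<in> torus})
        = emeasure lborel {x. lattice_vec m + x \<in> Q \<inter> {x. x - lattice_vec m \<in> torus}}"
      by (rule emeasure_lborel_translate[symmetric]) measurable
    also have "{x. lattice_vec m + x \<in> Q \<inter> {x. x - lattice_vec m \<in> torus}}
        = (torus \<inter> P) \<inter> {x. s *\<^sub>R (x + lattice_vec m - a) \<in> torus}"
      using P_lattice[of _ m] by (auto simp: Q_def add.commute)
    finally show "emeasure lborel (Q \<inter> {x. x - lattice_vec m \<in> torus})
        = emeasure lborel ((torus \<inter> P) \<inter> {x. s *\<^sub>R (x + lattice_vec m - a) \<in> torus})" .
  qed
  \<comment> \<open>The shifted pieces tile \<open>torus \<inter> P\<close> because the translates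
    of the moved domain also cover each point exactly once. For \<open>s = -1\<close> the index
    changes sign.\<close>
  also have "\<dots> = emeasure lborel (torus \<inter> P)"
  proof (rule emeasure_lborel_partition[symmetric])
    fix x :: "real ^ 'n"
    show "\<exists>!m. x \<in> {x. s *\<^sub>R (x + lattice_vec m - a) \<in> torus}"
    proof (cases "s = 1")
      case True
      then show ?thesis using lattice_ex1[of "x - a"] by (simp add: algebra_simps)
    next
      case False
      then have s': "s = -1" using s by simp
      obtain m where m: "(a - x) + lattice_vec m \<in> torus" using lattice_ex1[of "a - x"] by blast
      show ?thesis
      proof (rule ex1I[of _ "- m"])
        show "x \<in> {x. s *\<^sub>R (x + lattice_vec (- m) - a) \<in> torus}"
          using m by (simp add: lattice_vec_minus s' algebra_simps)
        show "n = - m" if "x \<in> {x. s *\<^sub>R (x + lattice_vec n - a) \<in> torus}" for n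
          using lattice_unique[of "a - x" "- n" m] that m
          by (simp add: lattice_vec_minus s' algebra_simps) (metis minus_minus)
      qed
    qed
  qed measurable
  also have "torus \<inter> P = A" using A(2) by (auto simp: P_def wrap_id)
  also have "ennreal (1 / (2 * pi) ^ CARD('n)) * emeasure lborel A = emeasure haar A"
    using A by (simp add: emeasure_haar)
  finally show "emeasure (distr haar haar (\<lambda>p. wrap (a + s *\<^sub>R p))) A = emeasure haar A" .
qed simp

lemma distr_haar_reflect: "distr haar haar (\<lambda>p. wrap (a - p)) = haar"
  using distr_haar_affine[of "-1" a] by simp

lemma distr_haar_translate: "distr haar haar (\<lambda>p. wrap (a + p)) = haar"
  using distr_haar_affine[of 1 a] by simp

lemma wrap_reflect_measurable: "(\<lambda>p. wrap (a - p)) \<in> measurable haar haar"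
  by (intro wrap_measurable_haar measurable_haar1) measurable

lemma wrap_translate_measurable: "(\<lambda>p. wrap (a + p)) \<in> measurable haar haar"
  by (intro wrap_measurable_haar measurable_haar1) measurable

lemma integral_haar_reflect:
  fixes f :: "real ^ 'n \<Rightarrow> 'b::{banach, second_countable_topology}"
  assumes "f \<in> borel_measurable haar" shows "(\<integral>q. f (wrap (a - q)) \<partial>haar) = (\<integral>q. f q \<partial>haar)"
  using integral_distr[OF wrap_reflect_measurable[of a] assms] by (simp add: distr_haar_reflect)

lemma integral_haar_translate:
  fixes f :: "real ^ 'n \<Rightarrow> 'b::{banach, second_countable_topology}"
  assumes "f \<in> borel_measurable haar" shows "(\<integral>q. f (wrap (a + q)) \<partial>haar) = (\<integral>q. f q \<partial>haar)"
  using integral_distr[OF wrap_translate_measurable[of a] assms] by (simp add: distr_haar_translate)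

lemma wrap_diff_wrap: "wrap (a - wrap b) = wrap (a - b)"
proof -
  obtain m where "wrap b = b + lattice_vec m" using wrap_eq_lattice by blast
  then have "a - wrap b = (a - b) + lattice_vec (- m)" by (simp add: lattice_vec_minus)
  then have "wrap (a - wrap b) = wrap ((a - b) + lattice_vec (- m))" by (rule arg_cong)
  also have "\<dots> = wrap (a - b)" by (rule wrap_lattice)
  finally show ?thesis .
qed

lemma wrap_involution: "q \<in> torus \<Longrightarrow> wrap (a - wrap (a - q)) = q"
  by (simp add: wrap_diff_wrap wrap_id)

lemma measurable_haar_pair1:
  fixes f :: "(real ^ 'n) \<times> (real ^ 'm) \<Rightarrow> 'b"
  assumes f: "f \<in> measurable borel N" shows "f \<in> measurable (haar \<Otimes>\<^sub>M haar) N"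
proof -
  have "(\<lambda>x. (fst x, snd x)) \<in> measurable (haar \<Otimes>\<^sub>M haar) (borel :: ((real ^ 'n) \<times> (real ^ 'm)) measure)"
    unfolding borel_prod[symmetric]
    by (intro measurable_Pair measurable_compose[OF measurable_fst id_measurable_haar]
        measurable_compose[OF measurable_snd id_measurable_haar])
  from measurable_compose[OF this f] show ?thesis by simp
qed

abbreviation haar_sq :: "((real ^ 'n) \<times> (real ^ 'n)) measure" where
  "haar_sq \<equiv> haar \<Otimes>\<^sub>M haar"

abbreviation (input) reflect2 :: "real ^ 'n \<Rightarrow> (real ^ 'n) \<times> (real ^ 'n) \<Rightarrow> (real ^ 'n) \<times> (real ^ 'n)" where
  "reflect2 K \<equiv> \<lambda>(p, q). (p, wrap (K - p - q))"

lemma third_measurable: "(\<lambda>(p, q). wrap (K - p - q)) \<in> measurable haar_sq haar"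
  unfolding case_prod_beta
  by (intro wrap_measurable_haar measurable_haar_pair1 borel_measurable_continuous_onI continuous_intros)

lemma reflect2_measurable: "reflect2 K \<in> measurable haar_sq haar_sq"
  unfolding case_prod_beta
  using third_measurable[of K] unfolding case_prod_beta by (intro measurable_Pair measurable_fst)

text \<open>By Fubini, since for fixed \<open>p\<close> the second coordinate is reflected. Together
  with the swap this map generates the permutations of the three momenta.\<close>

lemma distr_reflect2: "distr haar_sq haar_sq (reflect2 K) = haar_sq"
proof (rule measure_eqI)
  fix A assume "A \<in> sets (distr haar_sq haar_sq (reflect2 K))"
  then have A[measurable]: "A \<in> sets haar_sq" by simp
  note [measurable] = reflect2_measurable
  have "emeasure (distr haar_sq haar_sq (reflect2 K)) A
      = (\<integral>\<^sup>+x. indicator A x \<partial>distr haar_sq haar_sq (reflect2 K))"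
    by simp
  also have "\<dots> = (\<integral>\<^sup>+x. indicator A (reflect2 K x) \<partial>haar_sq)"
    by (rule nn_integral_distr) auto
  also have "\<dots> = (\<integral>\<^sup>+p. \<integral>\<^sup>+q. indicator A (reflect2 K (p, q)) \<partial>haar \<partial>haar)"
    by (rule haar.nn_integral_fst[symmetric]) measurable
  also have "\<dots> = (\<integral>\<^sup>+p. \<integral>\<^sup>+q. indicator A (p, q) \<partial>haar \<partial>haar)"
  proof (rule nn_integral_cong)
    fix p :: "real ^ 'a" assume p: "p \<in> space haar"
    have m: "(\<lambda>q. indicator A (p, q) :: ennreal) \<in> borel_measurable haar"
      using p by measurable
    have "(\<integral>\<^sup>+q. indicator A (p, q) \<partial>distr haar haar (\<lambda>q. wrap (K - p - q)))
        = (\<integral>\<^sup>+q. indicator A (p, wrap (K - p - q)) \<partial>haar)"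
      by (rule nn_integral_distr[OF wrap_reflect_measurable]) (simp add: m)
    then show "(\<integral>\<^sup>+q. indicator A (reflect2 K (p, q)) \<partial>haar) = (\<integral>\<^sup>+q. indicator A (p, q) \<partial>haar)"
      unfolding distr_haar_reflect prod.case by (rule sym)
  qed
  also have "\<dots> = (\<integral>\<^sup>+x. indicator A x \<partial>haar_sq)"
    by (rule haar.nn_integral_fst) measurable
  also have "\<dots> = emeasure haar_sq A" by simp
  finally show "emeasure (distr haar_sq haar_sq (reflect2 K)) A = emeasure haar_sq A" .
qed simp

lemma distr_haar_swap:
  "distr haar_sq haar_sq (\<lambda>(p, q). (q, p)) = haar_sq"
  using haar2.distr_pair_swap[symmetric] .

lemma swap_measurable: "(\<lambda>(p, q). (q, p)) \<in> measurable haar_sq haar_sq"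
  by (rule measurable_pair_swap')

lemma distr_haar_fst: "distr haar_sq haar fst = haar"
proof (rule measure_eqI)
  fix A :: "(real ^ 'n) set" assume "A \<in> sets (distr haar_sq haar fst)"
  then have A: "A \<in> sets haar" by simp
  have haar_Times: "emeasure haar_sq (A \<times> torus) = emeasure haar A * emeasure haar (torus :: (real ^ 'n) set)"
    using haar.emeasure_pair_measure_Times[OF A sets.top[of "haar :: (real ^ 'n) measure"]] by simp
  have "emeasure haar (torus :: (real ^ 'n) set) = 1" using haar.emeasure_space_1 by simp
  moreover have "fst -` A \<inter> space haar_sq = A \<times> space haar"
    using sets.sets_into_space[OF A] by (auto simp: space_pair_measure)
  ultimately show "emeasure (distr haar_sq haar fst) A = emeasure haar A"
    using haar_Times by (simp add: emeasure_distr A)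
qed simp

lemma distr_haar_snd: "distr haar_sq haar snd = haar"
proof -
  have "distr haar_sq haar snd = distr (distr haar_sq haar_sq (\<lambda>(p, q). (q, p))) haar snd"
    by (simp add: distr_haar_swap)
  also have "\<dots> = distr haar_sq haar fst"
    unfolding distr_distr[OF measurable_snd swap_measurable] by (simp add: o_def case_prod_beta)
  finally show ?thesis by (simp add: distr_haar_fst)
qed

text \<open>The third momentum is \<open>snd\<close> after the measure-preserving
  \<open>reflect2 K\<close>.\<close>

lemma distr_haar_third: "distr haar_sq haar (\<lambda>(p, q). wrap (K - p - q)) = haar"
proof -
  have "distr haar_sq haar snd = distr (distr haar_sq haar_sq (reflect2 K)) haar snd"
    by (simp add: distr_reflect2)
  also have "\<dots> = distr haar_sq haar (\<lambda>(p, q). wrap (K - p - q))"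
    unfolding distr_distr[OF measurable_snd reflect2_measurable] by (simp add: o_def case_prod_beta')
  finally show ?thesis by (simp add: distr_haar_snd)
qed

lemma scale_interior_torus:
  assumes "p \<in> torus" "0 \<le> t" "t < 1" shows "\<bar>(t *\<^sub>R p) $ i\<bar> < pi"
proof -
  have "\<bar>p $ i\<bar> \<le> pi" using assms(1) by (auto simp: torus_def abs_le_iff less_imp_le) (metis add.inverse_inverse less_imp_le neg_le_iff_le)
  then have "t * \<bar>p $ i\<bar> \<le> t * pi" using assms by (intro mult_left_mono) auto
  also have "\<dots> < pi" using assms pi_gt_zero by (simp add: mult_less_cancel_right1)
  finally show ?thesis using assms by (simp add: abs_mult)
qed

text \<open>A point of the torus may lie on a face of the cube. Contracting it slightly towards the
  origin keeps it in \<open>U\<close> and moves it into the open cube, where a nonempty open set has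
  positive Lebesgue measure.\<close>

lemma emeasure_haar_open_pos:
  fixes U :: "(real ^ 'n) set"
  assumes "open U" "p \<in> U" "p \<in> torus"
  shows "0 < emeasure haar (U \<inter> torus)"
proof -
  have "((\<lambda>t. t *\<^sub>R p) \<longlongrightarrow> 1 *\<^sub>R p) (at_left (1::real))"
    by (intro tendsto_intros)
  then have "eventually (\<lambda>t. t *\<^sub>R p \<in> U) (at_left (1::real))"
    using topological_tendstoD[OF _ assms(1)] assms(2) by simp
  moreover have "eventually (\<lambda>t. t \<in> {0<..<1}) (at_left (1::real))"
    by (rule eventually_at_left_real) simp
  ultimately have "\<exists>t. t *\<^sub>R p \<in> U \<and> t \<in> {0<..<1::real}"
    by (intro eventually_happens'[OF trivial_limit_at_left_real] eventually_conj)
  then obtain t where t: "t *\<^sub>R p \<in> U" "0 < t" "t < 1" by auto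
  let ?I = "{x :: real ^ 'n. \<forall>i. \<bar>x $ i\<bar> < pi}"
  have "open ?I"
  proof -
    have "?I = (\<Inter>i. {x. \<bar>x $ i\<bar> < pi})" by auto
    also have "open \<dots>" by (intro open_INT ballI open_Collect_less continuous_intros) auto
    finally show ?thesis .
  qed
  then have o: "open (U \<inter> ?I)" using assms(1) by blast
  have ne: "t *\<^sub>R p \<in> U \<inter> ?I" using t scale_interior_torus[OF assms(3)] by auto
  have le: "?I \<subseteq> torus"
    by (auto simp: torus_def abs_less_iff less_imp_le) (metis minus_less_iff)
  have "emeasure lborel (U \<inter> ?I) \<noteq> 0"
  proof
    assume "emeasure lborel (U \<inter> ?I) = 0"
    then have "U \<inter> ?I \<in> null_sets lborel" using o by (auto intro: null_setsI)
    then have "negligible (U \<inter> ?I)"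
      unfolding negligible_iff_null_sets by (rule null_sets_completionI)
    then show False using open_not_negligible[OF o] ne by blast
  qed
  then have "0 < emeasure haar (U \<inter> ?I)"
    using o le by (subst emeasure_haar) (auto simp: ennreal_zero_less_mult_iff zero_less_iff_neq_zero)
  also have "\<dots> \<le> emeasure haar (U \<inter> torus)"
    using assms(1) le by (intro emeasure_mono) (auto simp: sets_haar_iff)
  finally show ?thesis .
qed

lemma emeasure_haar_sq_open_pos:
  fixes U :: "((real ^ 'n) \<times> (real ^ 'n)) set"
  assumes U: "open U" "(p, q) \<in> U" "p \<in> torus" "q \<in> torus"
  shows "0 < emeasure haar_sq (U \<inter> torus \<times> torus)"
proof -
  obtain A B where AB: "open A" "open B" "(p, q) \<in> A \<times> B" "A \<times> B \<subseteq> U"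
    using U(1,2) by (rule open_prod_elim)
  have A: "A \<inter> torus \<in> sets haar" and B: "B \<inter> torus \<in> sets haar"
    using AB by (auto simp: sets_haar_iff)
  have "0 < emeasure haar (A \<inter> torus) * emeasure haar (B \<inter> torus)"
    using emeasure_haar_open_pos[OF AB(1), of p] emeasure_haar_open_pos[OF AB(2), of q] AB(3) U
    by (simp add: ennreal_zero_less_mult_iff)
  also have "\<dots> = emeasure haar_sq ((A \<inter> torus) \<times> (B \<inter> torus))"
    by (rule haar.emeasure_pair_measure_Times[OF A B, symmetric])
  also have "\<dots> \<le> emeasure haar_sq (U \<inter> torus \<times> torus)"
  proof (rule emeasure_mono)
    have "(\<lambda>x. x) \<in> measurable haar_sq borel"
      by (rule measurable_haar_pair1) simp
    from measurable_sets[OF this, of U] show "U \<inter> torus \<times> torus \<in> sets haar_sq"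
      using U(1) by (simp add: space_pair_measure)
  qed (use AB(4) in auto)
  finally show ?thesis .
qed

section \<open>The one-particle energy\<close>

lemma eps_lattice: "\<epsilon> (p + lattice_vec m) = \<epsilon> p"
proof -
  have "cos (x + 2 * pi * of_int n) = cos x" for x and n :: int
    unfolding cos_add cos_int_2pin sin_int_2pin by simp
  then show ?thesis unfolding \<epsilon>_def lattice_vec_def by simp
qed

lemma eps_wrap [simp]: "\<epsilon> (wrap p) = \<epsilon> p"
proof -
  obtain m where "wrap p = p + lattice_vec m" using wrap_eq_lattice by blast
  then show ?thesis by (simp only: eps_lattice)
qed

lemma eps_cong_wrap: "wrap p = wrap q \<Longrightarrow> \<epsilon> p = \<epsilon> q"
  by (metis eps_wrap)

lemma eps_minus: "\<epsilon> (- p) = \<epsilon> p"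
  by (simp add: \<epsilon>_def)

lemma eps_nonneg: "0 \<le> \<epsilon> p"
  by (simp add: \<epsilon>_def sum_nonneg)

lemma eps_le: "\<epsilon> (p :: real ^ 'n) \<le> 2 * CARD('n)"
proof -
  have "\<epsilon> p \<le> (\<Sum>i\<in>(UNIV :: 'n set). 2)"
    unfolding \<epsilon>_def
  proof (rule sum_mono)
    fix i show "1 - cos (p $ i) \<le> 2" using cos_ge_minus_one[of "p $ i"] by linarith
  qed
  then show ?thesis by simp
qed

lemma continuous_eps [continuous_intros]:
  fixes f :: "'a::t2_space \<Rightarrow> real ^ 'n"
  shows "continuous_on A f \<Longrightarrow> continuous_on A (\<lambda>x. \<epsilon> (f x))"
  unfolding \<epsilon>_def by (intro continuous_intros)

lemma abs_cos_diff_le: "\<bar>cos x - cos y\<bar> \<le> \<bar>x - y :: real\<bar>"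
proof -
  have "\<bar>cos x - cos y\<bar> = 2 * \<bar>sin ((x + y) / 2)\<bar> * \<bar>sin ((y - x) / 2)\<bar>"
    by (simp add: cos_diff_cos abs_mult)
  also have "\<dots> \<le> 2 * 1 * \<bar>(y - x) / 2\<bar>"
    by (intro mult_mono abs_sin_le_one abs_sin_x_le_abs_x) auto
  finally show ?thesis by (simp add: abs_minus_commute)
qed

lemma eps_lipschitz:
  fixes p q :: "real ^ 'n"
  shows "\<bar>\<epsilon> p - \<epsilon> q\<bar> \<le> CARD('n) * norm (p - q)"
proof -
  have "\<bar>\<epsilon> p - \<epsilon> q\<bar> = \<bar>\<Sum>i\<in>UNIV. cos (q $ i) - cos (p $ i)\<bar>"
    by (simp add: \<epsilon>_def sum_subtractf)
  also have "\<dots> \<le> (\<Sum>i\<in>UNIV. \<bar>cos (q $ i) - cos (p $ i)\<bar>)" by (rule sum_abs)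
  also have "\<dots> \<le> (\<Sum>i\<in>(UNIV :: 'n set). norm (p - q))"
  proof (rule sum_mono)
    fix i
    have "\<bar>cos (q $ i) - cos (p $ i)\<bar> \<le> \<bar>(p - q) $ i\<bar>"
      using abs_cos_diff_le[of "q $ i" "p $ i"] by (simp add: abs_minus_commute)
    then show "\<bar>cos (q $ i) - cos (p $ i)\<bar> \<le> norm (p - q)"
      using component_le_norm_cart[of "p - q" i] by linarith
  qed
  finally show ?thesis by simp
qed

lemma eps_eq_0D:
  assumes "\<epsilon> (p - a) = 0" "p \<in> torus" shows "p = wrap a"
proof -
  have "\<forall>i\<in>UNIV. 1 - cos ((p - a) $ i) = 0"
    using assms(1) unfolding \<epsilon>_def by (subst (asm) sum_nonneg_eq_0_iff) auto
  then have "\<exists>n::int. (p - a) $ i = of_int n * 2 * pi" for i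
    using cos_one_2pi_int[of "(p - a) $ i"] by auto
  then obtain m where m: "\<And>i. (p - a) $ i = of_int (m i) * 2 * pi" by metis
  have "p = a + lattice_vec (\<chi> i. m i)"
    using m by (simp add: vec_eq_iff lattice_vec_def algebra_simps)
  then show ?thesis using wrap_eqI[OF assms(2)] by metis
qed

lemma eps_nbhd_sets: "{p \<in> torus. \<epsilon> (p - a) < r} \<in> sets haar"
proof -
  have "open {p. \<epsilon> (p - a) < r}" by (intro open_Collect_less continuous_intros)
  moreover have "{p \<in> torus. \<epsilon> (p - a) < r} = torus \<inter> {p. \<epsilon> (p - a) < r}" by auto
  ultimately show ?thesis by (auto simp: sets_haar_iff)
qed

text \<open>\<open>\<epsilon> (p - a)\<close> acts as a periodic distance from \<open>a\<close>: it
  vanishes in the torus only at \<open>wrap a\<close>, a null set, so continuity of the measure from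
  above applies.\<close>

lemma small_eps_nbhd:
  fixes a :: "real ^ 'n"
  assumes "0 < e"
  obtains r where "0 < r" "measure haar {p \<in> torus. \<epsilon> (p - a) < r} < e"
proof -
  define A where "A n = {p \<in> torus. \<epsilon> (p - a) < inverse (real (Suc n))}" for n
  have "(\<lambda>n. measure haar (A n)) \<longlonglongrightarrow> measure haar (\<Inter>n. A n)"
  proof (rule haar.finite_Lim_measure_decseq)
    show "range A \<subseteq> sets haar" unfolding A_def using eps_nbhd_sets by blast
    show "decseq A"
    proof (rule decseq_SucI)
      fix n
      have "inverse (real (Suc (Suc n))) \<le> inverse (real (Suc n))"
        by (rule le_imp_inverse_le) auto
      then show "A (Suc n) \<subseteq> A n" unfolding A_def by (auto simp del: of_nat_Suc inverse_le_iff_le intro: less_le_trans)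
    qed
  qed
  moreover have "measure haar (\<Inter>n. A n) = 0"
  proof -
    have "p = wrap a" if p: "p \<in> (\<Inter>n. A n)" for p
    proof (rule eps_eq_0D)
      have "\<epsilon> (p - a) \<le> inverse (real (Suc n))" for n using p by (auto simp: A_def less_imp_le)
      then have "\<epsilon> (p - a) \<le> 0"
        using LIMSEQ_le_const[OF LIMSEQ_inverse_real_of_nat] by blast
      then show "\<epsilon> (p - a) = 0" using eps_nonneg[of "p - a"] by simp
      show "p \<in> torus" using p by (auto simp: A_def)
    qed
    then have "(\<Inter>n. A n) \<subseteq> {wrap a}" by blast
    moreover have "{wrap a} \<in> sets haar" by (simp add: sets_haar_iff wrap_in_torus)
    ultimately have "measure haar (\<Inter>n. A n) \<le> measure haar {wrap a}"
      by (intro haar.finite_measure_mono)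
    also have "\<dots> = 0"
      by (simp add: measure_def emeasure_haar wrap_in_torus)
    finally show ?thesis by (simp add: measure_le_0_iff)
  qed
  ultimately have "eventually (\<lambda>n. measure haar (A n) < e) sequentially"
    using order_tendstoD(2)[of _ 0 sequentially e] assms by simp
  then obtain n where "measure haar (A n) < e" by (auto simp: eventually_sequentially)
  then show ?thesis using that[of "inverse (real (Suc n))"] unfolding A_def by simp
qed

section \<open>The two-particle operator\<close>

lemma integral_inverse_diff_props:
  fixes F :: "real ^ 'n \<Rightarrow> real"
  assumes F: "F \<in> borel_measurable haar" and m: "\<And>q. q \<in> torus \<Longrightarrow> m \<le> F q" and z: "z < m"
  shows "integrable haar (\<lambda>q. 1 / (F q - z))" "(\<integral>q. 1 / (F q - z) \<partial>haar) \<le> 1 / (m - z)"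
proof -
  note [measurable] = F
  have le: "1 / (F q - z) \<le> 1 / (m - z)" "0 \<le> 1 / (F q - z)" if "q \<in> torus" for q
    using m[OF that] z by (auto intro!: divide_left_mono mult_pos_pos)
  show i: "integrable haar (\<lambda>q. 1 / (F q - z))"
    by (rule haar.integrable_const_bound[where B="1 / (m - z)"])
      (use le in \<open>auto intro!: AE_I2\<close>)
  have "(\<integral>q. 1 / (F q - z) \<partial>haar) \<le> (\<integral>q. 1 / (m - z) \<partial>(haar :: (real ^ 'n) measure))"
    by (rule integral_mono[OF i]) (use le in auto)
  then show "(\<integral>q. 1 / (F q - z) \<partial>haar) \<le> 1 / (m - z)"
    by (simp add: haar.prob_space[simplified])
qed

lemma integral_inverse_diff_strict_mono:
  fixes F :: "real ^ 'n \<Rightarrow> real"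
  assumes F: "F \<in> borel_measurable haar" and m: "\<And>q. q \<in> torus \<Longrightarrow> m \<le> F q" and z: "z < z'" "z' < m"
  shows "(\<integral>q. 1 / (F q - z) \<partial>haar) < (\<integral>q. 1 / (F q - z') \<partial>haar)"
proof (rule haar.integral_less_AE_space)
  show "integrable haar (\<lambda>q. 1 / (F q - z))" "integrable haar (\<lambda>q. 1 / (F q - z'))"
    using integral_inverse_diff_props(1)[OF F m] z by auto
  show "AE q in haar. 1 / (F q - z) < 1 / (F q - z')"
  proof (rule AE_I2)
    fix q :: "real ^ 'n" assume "q \<in> space haar"
    then have "m \<le> F q" using m by simp
    then show "1 / (F q - z) < 1 / (F q - z')"
      using z by (intro divide_strict_left_mono mult_pos_pos) auto
  qed
  show "emeasure haar (space (haar :: (real ^ 'n) measure)) \<noteq> 0"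
    by (subst haar.emeasure_space_1) simp
qed

text \<open>The identity for the difference of two reciprocals gives the Lipschitz constant
  \<open>1 / (m - b)\<^sup>2\<close> on all of \<open>{..b}\<close>.\<close>

lemma continuous_integral_inverse_diff:
  fixes F :: "real ^ 'n \<Rightarrow> real"
  assumes F: "F \<in> borel_measurable haar" and m: "\<And>q. q \<in> torus \<Longrightarrow> m \<le> F q" and b: "b < m"
  shows "continuous_on {..b} (\<lambda>z. \<integral>q. 1 / (F q - z) \<partial>haar)"
proof (rule lipschitz_on_continuous_on[where L="1 / (m - b)\<^sup>2"], rule lipschitz_onI)
  fix z z' assume z: "z \<in> {..b}" "z' \<in> {..b}"
  have i: "integrable haar (\<lambda>q. 1 / (F q - z))" "integrable haar (\<lambda>q. 1 / (F q - z'))"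
    using integral_inverse_diff_props(1)[OF F m] z b by auto
  have "\<bar>(\<integral>q. 1 / (F q - z) \<partial>haar) - (\<integral>q. 1 / (F q - z') \<partial>haar)\<bar>
      = \<bar>\<integral>q. 1 / (F q - z) - 1 / (F q - z') \<partial>haar\<bar>"
    using i by simp
  also have "\<dots> \<le> (\<integral>q. \<bar>1 / (F q - z) - 1 / (F q - z')\<bar> \<partial>haar)"
    by (rule integral_abs_bound)
  also have "\<dots> \<le> (\<integral>q. 1 / (m - b)\<^sup>2 * \<bar>z - z'\<bar> \<partial>(haar :: (real ^ 'n) measure))"
  proof (rule integral_mono)
    fix q :: "real ^ 'n" assume "q \<in> space haar"
    then have q: "m - b \<le> F q - z" "m - b \<le> F q - z'" using m[of q] z by auto
    then have "1 / (F q - z) - 1 / (F q - z') = (z - z') / ((F q - z) * (F q - z'))"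
      using b by (simp add: field_simps)
    also have "\<bar>\<dots>\<bar> = \<bar>z - z'\<bar> / ((F q - z) * (F q - z'))"
      using q b by (simp add: abs_divide abs_mult)
    also have "\<dots> \<le> \<bar>z - z'\<bar> / (m - b)\<^sup>2"
    proof (rule divide_left_mono)
      show "(m - b)\<^sup>2 \<le> (F q - z) * (F q - z')"
        unfolding power2_eq_square using q b by (intro mult_mono) auto
      show "0 < (F q - z) * (F q - z') * (m - b)\<^sup>2"
        using q b by (intro mult_pos_pos) auto
    qed simp
    finally show "\<bar>1 / (F q - z) - 1 / (F q - z')\<bar> \<le> 1 / (m - b)\<^sup>2 * \<bar>z - z'\<bar>" by simp
  qed (use i in auto)
  also have "\<dots> = 1 / (m - b)\<^sup>2 * \<bar>z - z'\<bar>" by (simp add: haar.prob_space[simplified])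
  finally show "dist (\<integral>q. 1 / (F q - z) \<partial>haar) (\<integral>q. 1 / (F q - z') \<partial>haar) \<le> 1 / (m - b)\<^sup>2 * dist z z'"
    by (simp add: dist_real_def)
qed simp

text \<open>If the top power fits below \<open>y\<close>, it dominates half of the whole geometric
  sum; if not, it contributes nothing.\<close>

lemma sum_powers_below:
  fixes y :: real assumes "0 \<le> y"
  shows "(\<Sum>j\<le>J. if 2 ^ j \<le> y then 2 ^ j else 0) \<le> 2 * y"
proof (induction J)
  case 0
  show ?case using assms by (cases "1 \<le> y") simp_all
next
  case (Suc J)
  show ?case
  proof (cases "2 ^ Suc J \<le> y")
    case True
    have "(\<Sum>j\<le>Suc J. if 2 ^ j \<le> y then 2 ^ j else 0) \<le> (\<Sum>j\<le>Suc J. (2::real) ^ j)"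
      by (intro sum_mono) auto
    also have "\<dots> \<le> 2 * 2 ^ Suc J"
      by (simp add: lessThan_Suc_atMost[symmetric] geometric_sum del: lessThan_Suc sum.lessThan_Suc)
    finally show ?thesis using True by linarith
  next
    case False
    then show ?thesis using Suc by simp
  qed
qed

text \<open>Dyadic layers: the layer \<open>F - m \<le> 2\<^sup>-\<^sup>j\<close> has measure at least \<open>c 2\<^sup>-\<^sup>j\<close> and
  therefore contributes at least a constant to the integral.\<close>

lemma integral_inverse_diff_unbounded:
  fixes F :: "real ^ 'n \<Rightarrow> real"
  assumes F: "F \<in> borel_measurable haar" and m: "\<And>q. q \<in> torus \<Longrightarrow> m \<le> F q" and "0 < c"
    and layer: "\<And>j. c * (1/2) ^ j \<le> measure haar {q \<in> torus. F q - m \<le> (1/2) ^ j}"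
  shows "\<exists>b<m. A < (\<integral>q. 1 / (F q - b) \<partial>haar)"
proof -
  note [measurable] = F
  obtain J :: nat where J: "4 * A < c * real J"
    using reals_Archimedean2[of "4 * A / c"] \<open>0 < c\<close> by (auto simp: pos_divide_less_eq mult.commute)
  \<comment> \<open>At this depth below \<open>m\<close> the offset \<open>m - b\<close> is no
    larger than the height of any of the layers \<open>j \<le> J\<close>, so \<open>F - b\<close> is
    at most twice that height on the layer.\<close>
  define b where "b = m - (1/2) ^ J"
  define S where "S j = {q \<in> torus. F q - m \<le> (1/2) ^ j}" for j
  have S[measurable]: "S j \<in> sets haar" for j
  proof -
    have "S j = {q \<in> space haar. F q - m \<le> (1/2) ^ j}" by (simp add: S_def)
    also have "\<dots> \<in> sets haar" by measurable
    finally show ?thesis .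
  qed
  have b: "b < m" by (simp add: b_def)
  have iS: "integrable haar (\<lambda>q. 2 ^ j * indicat_real (S j) q)" for j
    by (intro integrable_mult_right integrable_real_indicator) (auto simp: haar.emeasure_finite less_top[symmetric])
  have "c * real J \<le> (\<Sum>j\<le>J. c)" using \<open>0 < c\<close> by (simp add: algebra_simps)
  also have "\<dots> \<le> (\<Sum>j\<le>J. 2 ^ j * measure haar (S j))"
  proof (rule sum_mono)
    fix j
    have "c = 2 ^ j * (c * (1/2) ^ j)" by (simp add: power_divide)
    also have "\<dots> \<le> 2 ^ j * measure haar (S j)"
      unfolding S_def by (intro mult_left_mono layer) simp
    finally show "c \<le> 2 ^ j * measure haar (S j)" .
  qed
  also have "\<dots> = (\<Sum>j\<le>J. \<integral>q. 2 ^ j * indicat_real (S j) q \<partial>haar)"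
  proof -
    have "S j \<inter> torus = S j" for j by (auto simp: S_def)
    then show ?thesis by simp
  qed
  also have "\<dots> = (\<integral>q. (\<Sum>j\<le>J. 2 ^ j * indicat_real (S j) q) \<partial>haar)"
    by (rule Bochner_Integration.integral_sum[symmetric]) (rule iS)
  \<comment> \<open>Layers containing \<open>q\<close> satisfy
    \<open>2 ^ j \<le> 2 / (F q - b)\<close>, and \<open>sum_powers_below\<close> costs another
    factor 2.\<close>
  also have "\<dots> \<le> (\<integral>q. 4 * (1 / (F q - b)) \<partial>haar)"
  proof (rule integral_mono)
    show "integrable haar (\<lambda>q. \<Sum>j\<le>J. 2 ^ j * indicat_real (S j) q)"
      by (rule Bochner_Integration.integrable_sum) (rule iS)
    show "integrable haar (\<lambda>q. 4 * (1 / (F q - b)))"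
      using integral_inverse_diff_props(1)[OF F m b] by (rule integrable_mult_right)
    fix q :: "real ^ 'n" assume "q \<in> space haar"
    then have x: "0 < F q - b" using m[of q] b by simp
    have "(\<Sum>j\<le>J. 2 ^ j * indicat_real (S j) q)
        \<le> (\<Sum>j\<le>J. if 2 ^ j \<le> 2 / (F q - b) then 2 ^ j else 0)"
    proof (rule sum_mono)
      fix j assume j: "j \<in> {..J}"
      have "2 ^ j \<le> 2 / (F q - b)" if "q \<in> S j"
      proof -
        have "(1/2::real) ^ J \<le> (1/2) ^ j" using j by (intro power_decreasing) auto
        moreover have "F q - m \<le> (1/2) ^ j" using that by (simp add: S_def)
        ultimately have "F q - b \<le> 2 * (1/2) ^ j" unfolding b_def by linarith
        then have "2 ^ j * (F q - b) \<le> 2 ^ j * (2 * (1/2) ^ j)" by (intro mult_left_mono) auto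
        also have "\<dots> = 2" by (simp add: power_divide)
        finally show ?thesis using x by (simp add: pos_le_divide_eq)
      qed
      then show "2 ^ j * indicat_real (S j) q \<le> (if 2 ^ j \<le> 2 / (F q - b) then 2 ^ j else 0)"
        by (auto simp: indicator_def)
    qed
    also have "\<dots> \<le> 2 * (2 / (F q - b))" by (rule sum_powers_below) (use x in simp)
    finally show "(\<Sum>j\<le>J. 2 ^ j * indicat_real (S j) q) \<le> 4 * (1 / (F q - b))" by simp
  qed
  also have "\<dots> = 4 * (\<integral>q. 1 / (F q - b) \<partial>haar)" by (rule integral_mult_right_zero)
  finally have "A < (\<integral>q. 1 / (F q - b) \<partial>haar)" using J by simp
  then show ?thesis using b by blast
qed

section \<open>The pair energy and the eigenvalue below it\<close>

lemma E_two_sum: "E_two k q = (\<Sum>i\<in>UNIV. 2 - 2 * cos (k $ i / 2) * cos (q $ i))"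
proof -
  have "(1 - cos (k $ i / 2 - q $ i)) + (1 - cos (k $ i / 2 + q $ i)) = 2 - 2 * cos (k $ i / 2) * cos (q $ i)" for i
    by (simp add: cos_add cos_diff)
  then show ?thesis
    unfolding E_two_def \<epsilon>_def by (simp add: sum.distrib[symmetric])
qed

lemma continuous_E_two: "continuous_on A (E_two k)"
  unfolding E_two_def[abs_def] by (intro continuous_intros)

lemma E_two_measurable: "E_two k \<in> borel_measurable haar"
  by (intro measurable_haar1 borel_measurable_continuous_onI continuous_E_two)

lemma E_two_nonneg: "0 \<le> E_two k q"
  unfolding E_two_def by (intro add_nonneg_nonneg eps_nonneg)

lemma E_two_wrap_minus: "E_two k (wrap (- q)) = E_two k q"
proof -
  obtain m where m: "wrap (- q) = - q + lattice_vec m" using wrap_eq_lattice by blast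
  have "(1/2) *\<^sub>R k - wrap (- q) = ((1/2) *\<^sub>R k + q) + lattice_vec (- m)"
    unfolding m lattice_vec_minus by simp
  moreover have "(1/2) *\<^sub>R k + wrap (- q) = ((1/2) *\<^sub>R k - q) + lattice_vec m"
    unfolding m by simp
  ultimately have "E_two k (wrap (- q)) = \<epsilon> ((1/2) *\<^sub>R k + q) + \<epsilon> ((1/2) *\<^sub>R k - q)"
    unfolding E_two_def by (simp only: eps_lattice)
  then show ?thesis by (simp add: E_two_def)
qed

lemma E_two_INF_le: "q \<in> torus \<Longrightarrow> (INF p\<in>torus. E_two k p) \<le> E_two k q"
  by (rule cINF_lower) (auto intro!: bdd_belowI2[where m=0] E_two_nonneg)

text \<open>\<open>1 + \<mu> * two_int k z\<close> is the perturbation determinant of the rank-one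
  term in \<open>h_op \<mu> k\<close>.\<close>

definition two_int :: "real ^ 'n \<Rightarrow> real \<Rightarrow> real" where
  "two_int k z = (\<integral>q. 1 / (E_two k q - z) \<partial>haar)"

text \<open>The interaction has rank one: an eigenfunction must be a multiple of
  \<open>1 / (E_two k - z)\<close>, and integrating the eigenvalue equation leaves a scalar
  condition on its integral \<open>c\<close>.\<close>

lemma is_eigenvalue_h_op_iff:
  fixes k :: "real ^ 'n"
  assumes z: "z < (INF p\<in>torus. E_two k p)"
  shows "is_eigenvalue haar L2_even (h_op \<mu> k) (of_real z) \<longleftrightarrow> 1 + \<mu> * two_int k z = 0"
proof
  let ?R = "\<lambda>q. 1 / (E_two k q - z)"
  have pos: "0 < E_two k q - z" if "q \<in> torus" for q using E_two_INF_le[OF that, of k] z by linarith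
  have iR: "integrable haar ?R"
    by (rule integral_inverse_diff_props(1)[OF E_two_measurable E_two_INF_le z])
  note [measurable] = borel_measurable_integrable[OF iR]
  {
    assume "is_eigenvalue haar L2_even (h_op \<mu> k) (of_real z)"
    then obtain f where f: "f \<in> L2_even" "AE q in haar. h_op \<mu> k f q = of_real z * f q"
      "\<not> (AE q in haar. f q = 0)"
      unfolding is_eigenvalue_def eigenspace_def by blast
    define c where "c = (\<integral>q. f q \<partial>haar)"
    have "f \<in> L2 haar" using f(1) by (simp add: L2_even_def)
    then have fm: "f \<in> borel_measurable haar" by (rule L2_measurable)
    have eq: "AE q in haar. f q = (- of_real \<mu> * c) * of_real (?R q)"
      using f(2) AE_space
    proof eventually_elim
      case (elim q)
      have "of_real (E_two k q - z) * f q = - of_real \<mu> * c"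
        using elim(1) by (simp add: h_op_def c_def algebra_simps add_eq_0_iff)
      moreover have "E_two k q - z \<noteq> 0" using pos elim(2) by force
      ultimately show ?case by (simp add: field_simps flip: of_real_diff)
    qed
    have "c = (\<integral>q. (- of_real \<mu> * c) * of_real (?R q) \<partial>haar)"
      unfolding c_def by (rule integral_cong_AE[OF fm _ eq[unfolded c_def]])
        measurable
    also have "\<dots> = (- of_real \<mu> * c) * of_real (two_int k z)"
      unfolding two_int_def integral_mult_right_zero integral_complex_of_real ..
    finally have "c + c * (of_real \<mu> * of_real (two_int k z)) = 0"
      by (simp add: add_eq_0_iff2 mult_ac)
    then have "c * of_real (1 + \<mu> * two_int k z) = 0" by (simp add: distrib_left)
    \<comment> \<open>With zero integral the interaction disappears and \<open>f\<close> vanishes,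
      because \<open>E_two k - z\<close> has no zeros.\<close>
    moreover have "c \<noteq> 0"
    proof
      assume "c = 0"
      then have "AE q in haar. f q = 0" using eq by simp
      then show False using f(3) by blast
    qed
    ultimately show "1 + \<mu> * two_int k z = 0" by (metis mult_eq_0_iff of_real_eq_0_iff)
  }
  assume eq: "1 + \<mu> * two_int k z = 0"
  let ?f = "\<lambda>q. complex_of_real (?R q)"
  have fm: "?f \<in> borel_measurable haar" by measurable
  have "?f \<in> L2 haar"
  proof (rule L2_dominated(1)[OF haar.L2_const(1)[of 1] fm])
    let ?m = "INF p\<in>torus. E_two k p"
    show "0 \<le> 1 / (?m - z)" using z by simp
    show "AE q in haar. cmod (?f q) \<le> 1 / (?m - z) * cmod 1"
    proof (rule AE_I2)
      fix q :: "real ^ 'n" assume "q \<in> space haar"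
      then have q: "q \<in> torus" by simp
      have "cmod (?f q) = ?R q" unfolding norm_of_real using pos[OF q] by simp
      also have "\<dots> \<le> 1 / (?m - z)"
        using E_two_INF_le[OF q, of k] z by (intro divide_left_mono mult_pos_pos) auto
      finally show "cmod (?f q) \<le> 1 / (?m - z) * cmod 1" by simp
    qed
  qed
  then have ev: "?f \<in> L2_even" by (simp add: L2_even_def E_two_wrap_minus)
  have "(\<integral>q. ?f q \<partial>haar) = of_real (two_int k z)"
    unfolding two_int_def by (rule integral_complex_of_real)
  moreover have "of_real \<mu> * complex_of_real (two_int k z) = - 1"
    using eq by (metis add.commute add_eq_0_iff of_real_1 of_real_minus of_real_mult)
  ultimately have "h_op \<mu> k ?f q = of_real z * ?f q" if "q \<in> torus" for q
    using pos[OF that] by (simp add: h_op_def field_simps flip: of_real_diff)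
  then have "?f \<in> eigenspace haar L2_even (h_op \<mu> k) (of_real z)"
    using ev by (auto simp: eigenspace_def intro!: AE_I2)
  moreover have "\<not> (AE q in haar. ?f q = 0)"
  proof
    assume "AE q in haar. ?f q = 0"
    then have "AE q in (haar :: (real ^ 'n) measure). False"
      using AE_space by eventually_elim (use pos in force)
    then show False by simp
  qed
  ultimately show "is_eigenvalue haar L2_even (h_op \<mu> k) (of_real z)"
    unfolding is_eigenvalue_def by (intro bexI[where x="?f"])
qed

lemma one_minus_cos_le: "2 * (1 - cos x) \<le> (x::real)\<^sup>2"
proof -
  have "cos x = 1 - 2 * (sin (x / 2))\<^sup>2" using cos_double_sin[of "x / 2"] by simp
  moreover have "(sin (x / 2))\<^sup>2 \<le> (x / 2)\<^sup>2"
    by (rule abs_le_square_iff[THEN iffD1, OF abs_sin_x_le_abs_x])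
  ultimately show ?thesis by (simp add: power_divide)
qed

text \<open>For a representative \<open>k\<close> in the torus all coefficients
  \<open>cos (k $ i / 2)\<close> lie between 0 and 1. Hence every summand is least at
  \<open>q = 0\<close> and exceeds its minimum by at most the square of the coordinate.\<close>

lemma E_two_INF:
  fixes k :: "real ^ 'n"
  assumes k: "k \<in> torus"
  shows "(INF p\<in>torus. E_two k p) = E_two k 0"
    "E_two k q - E_two k 0 \<le> (\<Sum>i\<in>UNIV. (q $ i)\<^sup>2)"
proof -
  have c: "0 \<le> cos (k $ i / 2)" for i
  proof (rule cos_ge_zero)
    have "- pi < k $ i" "k $ i \<le> pi" using k by (auto simp: torus_def)
    then show "- (pi / 2) \<le> k $ i / 2" "k $ i / 2 \<le> pi / 2" by linarith+
  qed
  have d: "E_two k q - E_two k 0 = (\<Sum>i\<in>UNIV. cos (k $ i / 2) * (2 * (1 - cos (q $ i))))" for q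
    by (simp add: E_two_sum sum_subtractf[symmetric] algebra_simps)
  have "0 \<le> E_two k q - E_two k 0" for q
    unfolding d using c by (intro sum_nonneg mult_nonneg_nonneg) auto
  moreover have t0: "(0 :: real ^ 'n) \<in> torus" by (simp add: torus_def)
  ultimately show "(INF p\<in>torus. E_two k p) = E_two k 0"
    by (intro antisym E_two_INF_le cINF_greatest) auto
  show "E_two k q - E_two k 0 \<le> (\<Sum>i\<in>UNIV. (q $ i)\<^sup>2)"
    unfolding d
  proof (rule sum_mono)
    fix i
    have "cos (k $ i / 2) * (2 * (1 - cos (q $ i))) \<le> 1 * (q $ i)\<^sup>2"
      using c[of i] by (intro mult_mono one_minus_cos_le) auto
    then show "cos (k $ i / 2) * (2 * (1 - cos (q $ i))) \<le> (q $ i)\<^sup>2" by simp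
  qed
qed

text \<open>With \<open>n\<close> the dimension and \<open>t\<close> the height, the cube of
  half-width \<open>sqrt (t / n)\<close> lies in the layer and has measure
  \<open>(a / pi) ^ n\<close>. As \<open>a / pi < 1\<close> and \<open>n \<le> 2\<close>, this is at
  least \<open>(a / pi)\<^sup>2\<close>, which is linear in \<open>t\<close>; this is where the
  dimension matters.\<close>

lemma E_two_layer:
  fixes k :: "real ^ 'n"
  assumes n: "CARD('n) = 1 \<or> CARD('n) = 2" and k: "k \<in> torus"
  shows "1 / (2 * pi\<^sup>2) * (1/2) ^ j \<le> measure haar {q \<in> torus. E_two k q - E_two k 0 \<le> (1/2) ^ j}"
proof -
  define t :: real where "t = (1/2) ^ j"
  define n where "n = CARD('n)"
  have t: "0 < t" "t \<le> 1" by (auto simp: t_def power_le_one)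
  have n12: "1 \<le> n" "n \<le> 2" using n by (auto simp: n_def)
  define a where "a = sqrt (t / n)"
  have a: "0 < a" "a\<^sup>2 = t / n" using t n12 by (auto simp: a_def)
  have "t / n \<le> 1" using t n12 by (simp add: divide_le_eq)
  then have a1: "a \<le> 1" by (simp add: a_def)
  then have api: "a < pi" using pi_gt3 by linarith
  let ?Q = "{q :: real ^ 'n. \<forall>i. \<bar>q $ i\<bar> \<le> a}"
  have Qt: "?Q \<subseteq> torus"
    using api by (auto simp: torus_def abs_le_iff) (smt (verit))+
  have Q: "?Q = cbox (- (\<chi> i. a)) (\<chi> i. a)"
    by (auto simp: mem_box_cart abs_le_iff minus_le_iff)
  then have Qb: "?Q \<in> sets borel" by simp
  have "emeasure haar ?Q = ennreal (1 / (2 * pi) ^ n * (2 * a) ^ n)"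
    using a unfolding emeasure_haar[OF Qb Qt] unfolding Q
    by (simp add: emeasure_lborel_cube n_def ennreal_mult[symmetric])
  also have "1 / (2 * pi) ^ n * (2 * a) ^ n = (a / pi) ^ n"
    by (simp add: power_mult_distrib power_divide)
  finally have mQ: "measure haar ?Q = (a / pi) ^ n"
    using a by (simp add: measure_def)
  have "1 / (2 * pi\<^sup>2) * t \<le> t / n / pi\<^sup>2"
    using t n12 by (simp add: field_simps)
  also have "\<dots> = (a / pi) ^ 2" using a by (simp add: power_divide)
  also have "\<dots> \<le> (a / pi) ^ n"
    using n12 a api by (intro power_decreasing) auto
  also have "\<dots> = measure haar ?Q" by (simp add: mQ)
  also have "\<dots> \<le> measure haar {q \<in> torus. E_two k q - E_two k 0 \<le> t}"
  proof (rule haar.finite_measure_mono)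
    have "{q \<in> torus. E_two k q - E_two k 0 \<le> t} = {q \<in> space haar. E_two k q - E_two k 0 \<le> t}" by simp
    also have "\<dots> \<in> sets haar" using E_two_measurable by measurable
    finally show "{q \<in> torus. E_two k q - E_two k 0 \<le> t} \<in> sets haar" .
    have "E_two k q - E_two k 0 \<le> t" if q: "q \<in> ?Q" for q
    proof -
      have "E_two k q - E_two k 0 \<le> (\<Sum>i\<in>UNIV. (q $ i)\<^sup>2)" by (rule E_two_INF(2)[OF k])
      also have "\<dots> \<le> (\<Sum>i\<in>(UNIV :: 'n set). t / n)"
        using q a by (intro sum_mono) (auto simp: a(2)[symmetric] abs_le_square_iff[symmetric])
      also have "\<dots> = t" using n12 by (simp add: n_def)
      finally show ?thesis .
    qed
    then show "?Q \<subseteq> {q \<in> torus. E_two k q - E_two k 0 \<le> t}" using Qt by blast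
  qed
  finally show ?thesis unfolding t_def .
qed

text \<open>\<open>two_int k\<close> is continuous and strictly increasing below the minimum of
  \<open>E_two k\<close>, small far below and unbounded near the minimum. It therefore takes the
  value \<open>- 1 / \<mu>\<close> exactly once, which makes the description in \<open>e_two\<close>
  definite.\<close>

lemma e_two_props:
  fixes k :: "real ^ 'n"
  assumes n: "CARD('n) = 1 \<or> CARD('n) = 2" and k: "k \<in> torus" and \<mu>: "\<mu> < 0"
  shows "e_two \<mu> k < (INF p\<in>torus. E_two k p)" "1 + \<mu> * two_int k (e_two \<mu> k) = 0"
    and "\<And>z. z < (INF p\<in>torus. E_two k p) \<Longrightarrow> 1 + \<mu> * two_int k z = 0 \<Longrightarrow> z = e_two \<mu> k"
proof -
  define m where "m = (INF p\<in>torus. E_two k p)"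
  have m: "m \<le> E_two k q" if "q \<in> torus" for q unfolding m_def by (rule E_two_INF_le[OF that])
  have uniq: "z = z'" if "z < m" "z' < m" "1 + \<mu> * two_int k z = 0" "1 + \<mu> * two_int k z' = 0" for z z'
  proof -
    have "\<mu> * two_int k z = \<mu> * two_int k z'" using that(3,4) by linarith
    then have "two_int k z = two_int k z'" using \<mu> by simp
    then show ?thesis
      using integral_inverse_diff_strict_mono[OF E_two_measurable m, of z z']
        integral_inverse_diff_strict_mono[OF E_two_measurable m, of z' z] that(1,2)
      unfolding two_int_def by (cases z z' rule: linorder_cases) auto
  qed
  have "\<exists>z<m. two_int k z = - 1 / \<mu>"
  proof -
    obtain b where b: "b < m" "- 1 / \<mu> < two_int k b"
      using integral_inverse_diff_unbounded[OF E_two_measurable m, of "1 / (2 * pi\<^sup>2)" "- 1 / \<mu>"]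
        E_two_layer[OF n k] E_two_INF(1)[OF k] unfolding m_def two_int_def by auto
    \<comment> \<open>At distance at least \<open>- 2 * \<mu>\<close> below \<open>m\<close> the
      integral is at most \<open>- 1 / (2 * \<mu>)\<close>; the minimum with \<open>b\<close> orders
      the endpoints for the intermediate value theorem.\<close>
    define a where "a = min b (m + 2 * \<mu>)"
    have a: "a \<le> b" "a < m" "a \<le> m + 2 * \<mu>" using b \<mu> by (auto simp: a_def)
    have "two_int k a \<le> 1 / (m - a)"
      unfolding two_int_def by (rule integral_inverse_diff_props(2)[OF E_two_measurable m a(2)])
    also have "\<dots> \<le> 1 / (- 2 * \<mu>)" using a \<mu> by (intro frac_le) auto
    also have "\<dots> \<le> - 1 / \<mu>" using \<mu> by (simp add: field_simps)
    finally have ua: "two_int k a \<le> - 1 / \<mu>" .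
    have "continuous_on {a..b} (two_int k)"
      unfolding two_int_def[abs_def]
      by (rule continuous_on_subset[OF continuous_integral_inverse_diff[OF E_two_measurable m b(1)]]) auto
    then obtain z where "a \<le> z" "z \<le> b" "two_int k z = - 1 / \<mu>"
      using IVT'[of "two_int k" a "- 1 / \<mu>" b] ua b a by auto
    then show ?thesis using b(1) by (intro exI[of _ z]) auto
  qed
  then obtain z where z: "z < m" "1 + \<mu> * two_int k z = 0" using \<mu> by (auto simp: field_simps)
  have "e_two \<mu> k = z"
    unfolding e_two_def m_def[symmetric]
  proof (rule the_equality)
    show "is_eigenvalue haar L2_even (h_op \<mu> k) (of_real z) \<and> z < m"
      using z is_eigenvalue_h_op_iff[of z k \<mu>] unfolding m_def by blast
    show "y = z" if "is_eigenvalue haar L2_even (h_op \<mu> k) (of_real y) \<and> y < m" for y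
      using uniq[of y z] z that is_eigenvalue_h_op_iff[of y k \<mu>] unfolding m_def by blast
  qed
  then show "e_two \<mu> k < (INF p\<in>torus. E_two k p)" "1 + \<mu> * two_int k (e_two \<mu> k) = 0"
    "\<And>z. z < (INF p\<in>torus. E_two k p) \<Longrightarrow> 1 + \<mu> * two_int k z = 0 \<Longrightarrow> z = e_two \<mu> k"
    using z uniq unfolding m_def by auto
qed

section \<open>The three-particle operator\<close>

lemma E_three_swap: "E_three K q p = E_three K p q"
proof -
  have "\<epsilon> (K - q - p) = \<epsilon> (K - p - q)" by (rule arg_cong[where f=\<epsilon>]) simp
  then show ?thesis by (simp add: E_three_def)
qed

lemma E_three_third: "E_three K p (wrap (K - p - q)) = E_three K p q"
proof -
  have "\<epsilon> (K - p - wrap (K - p - q)) = \<epsilon> q"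
    by (rule eps_cong_wrap) (simp add: wrap_diff_wrap)
  then show ?thesis by (simp add: E_three_def)
qed

lemma E_three_wrap_right: "E_three K p (wrap q) = E_three K p q"
proof -
  have "\<epsilon> (K - p - wrap q) = \<epsilon> (K - p - q)" by (rule eps_cong_wrap) (rule wrap_diff_wrap)
  then show ?thesis by (simp add: E_three_def)
qed

lemma E_three_wrap_left: "E_three K (wrap p) q = E_three K p q"
  using E_three_wrap_right[of K q p] by (simp add: E_three_swap[of K q])

lemma continuous_E_three [continuous_intros]:
  fixes f :: "'a::t2_space \<Rightarrow> real ^ 'n"
  shows "continuous_on A f \<Longrightarrow> continuous_on A g \<Longrightarrow> continuous_on A (\<lambda>x. E_three K (f x) (g x))"
  unfolding E_three_def by (intro continuous_intros)

lemma E_three_nonneg: "0 \<le> E_three K p q"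
  unfolding E_three_def by (intro add_nonneg_nonneg eps_nonneg)

lemma E_three_le: "E_three K p (q :: real ^ 'n) \<le> 6 * CARD('n)"
  unfolding E_three_def using eps_le[of "K - p - q"] eps_le[of p] eps_le[of q] by simp

lemma E_three_lipschitz:
  fixes p p' :: "real ^ 'n"
  shows "\<bar>E_three K p q - E_three K p' q\<bar> \<le> 2 * CARD('n) * norm (p - p')"
proof -
  have "\<bar>E_three K p q - E_three K p' q\<bar>
      \<le> \<bar>\<epsilon> (K - p - q) - \<epsilon> (K - p' - q)\<bar> + \<bar>\<epsilon> p - \<epsilon> p'\<bar>"
    unfolding E_three_def by linarith
  also have "\<dots> \<le> CARD('n) * norm ((K - p - q) - (K - p' - q)) + CARD('n) * norm (p - p')"
    by (intro add_mono eps_lipschitz)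
  finally show ?thesis by (simp add: norm_minus_commute)
qed

lemma E_min_le: "E_min K \<le> E_three K p q"
proof -
  have "E_min K \<le> (case (wrap p, wrap q) of (p, q) \<Rightarrow> E_three K p q)"
    unfolding E_min_def
    by (rule cINF_lower) (auto simp: wrap_in_torus intro!: bdd_belowI2[where m=0] E_three_nonneg)
  then show ?thesis by (simp add: E_three_wrap_left E_three_wrap_right)
qed

lemma E_max_ge: "E_three K p (q :: real ^ 'n) \<le> E_max K"
proof -
  have "(case (wrap p, wrap q) of (p, q) \<Rightarrow> E_three K p q) \<le> E_max K"
    unfolding E_max_def
    by (rule cSUP_upper) (auto simp: wrap_in_torus intro!: bdd_aboveI2[where M="6 * CARD('n)"] E_three_le)
  then show ?thesis by (simp add: E_three_wrap_left E_three_wrap_right)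
qed

section \<open>Marginals and sums over the three momenta\<close>

lemma space_haar_sq: "space haar_sq = torus \<times> torus"
  by (simp add: space_pair_measure)

lemma haar_sq_prob: "prob_space haar_sq"
  by (rule haar2.prob_space_axioms)

lemma AE_haar_fst:
  assumes "AE p in haar. P p" shows "AE x in haar_sq. P (fst x)"
proof -
  have "AE p in distr haar_sq haar fst. P p" unfolding distr_haar_fst by (rule assms)
  then show ?thesis by (rule AE_distrD[OF measurable_fst])
qed

lemma AE_haar_snd:
  assumes "AE p in haar. P p" shows "AE x in haar_sq. P (snd x)"
proof -
  have "AE p in distr haar_sq haar snd. P p" unfolding distr_haar_snd by (rule assms)
  then show ?thesis by (rule AE_distrD[OF measurable_snd])
qed

lemma AE_haar_third:
  assumes "AE p in haar. P p" shows "AE x in haar_sq. P (wrap (K - fst x - snd x))"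
  using AE_distrD[OF third_measurable[of K], of P] assms unfolding distr_haar_third case_prod_beta .

lemma AE_haar_sq_swap:
  assumes "AE x in haar_sq. P x" shows "AE x in haar_sq. P (snd x, fst x)"
  using AE_distrD[OF swap_measurable, of P] assms unfolding distr_haar_swap case_prod_beta .

lemma AE_haar_sq_reflect:
  assumes "AE x in haar_sq. P x" shows "AE x in haar_sq. P (fst x, wrap (K - fst x - snd x))"
  using AE_distrD[OF reflect2_measurable[of K], of P] assms unfolding distr_reflect2 case_prod_beta .

lemma third_measurable': "(\<lambda>x. wrap (K - fst x - snd x)) \<in> measurable haar_sq haar"
  using third_measurable[of K] by (simp add: case_prod_beta)

definition marginal :: "((real ^ 'n) \<times> (real ^ 'n) \<Rightarrow> complex) \<Rightarrow> real ^ 'n \<Rightarrow> complex" where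
  "marginal f p = (\<integral>q. f (p, q) \<partial>haar)"

text \<open>On the symmetric subspace this is three times the adjoint of \<open>marginal\<close>;
  see \<open>inner_sum3\<close>.\<close>

definition sum3 :: "real ^ 'n \<Rightarrow> (real ^ 'n \<Rightarrow> complex) \<Rightarrow> (real ^ 'n) \<times> (real ^ 'n) \<Rightarrow> complex" where
  "sum3 K u = (\<lambda>x. u (fst x) + u (snd x) + u (wrap (K - fst x - snd x)))"

lemma marginal_measurable:
  assumes "f \<in> borel_measurable haar_sq" shows "marginal f \<in> borel_measurable haar"
  unfolding marginal_def[abs_def]
  by (rule haar.borel_measurable_lebesgue_integral) (use assms in simp)

lemma section_measurable:
  assumes "f \<in> borel_measurable haar_sq" "p \<in> torus" shows "(\<lambda>q. f (p, q)) \<in> borel_measurable haar"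
  using measurable_compose[OF measurable_Pair1'[of p haar haar] assms(1)] assms(2) by simp

lemma AE_section_L2:
  assumes f: "f \<in> L2 haar_sq" shows "AE p in haar. (\<lambda>q. f (p, q)) \<in> L2 haar"
  using haar2.AE_integrable_fst'[OF L2_integrable_sq[OF f]] AE_space
  by eventually_elim (auto simp: L2_def intro: section_measurable[OF L2_measurable[OF f]])

lemma haar_indicator_L2:
  assumes N: "N \<in> sets haar"
  shows "(\<lambda>q. complex_of_real (indicat_real N q)) \<in> L2 haar"
    "(L2_norm haar (\<lambda>q. complex_of_real (indicat_real N q)))\<^sup>2 = measure haar N"
    "(\<integral>q. cmod (complex_of_real (indicat_real N q)) \<partial>haar) = measure haar N"
proof -
  show "(\<lambda>q. complex_of_real (indicat_real N q)) \<in> L2 haar"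
    by (rule L2_dominated(1)[OF haar.L2_const(1)[of 1], where c=1]) (use N in \<open>auto simp: indicator_def\<close>)
  have NT: "N \<inter> torus = N" using sets.sets_into_space[OF N] by auto
  then have i: "(\<integral>q. indicat_real N q \<partial>haar) = measure haar N" by simp
  have "(\<integral>q. (cmod (complex_of_real (indicat_real N q)))\<^sup>2 \<partial>haar) = (\<integral>q. indicat_real N q \<partial>haar)"
    by (intro Bochner_Integration.integral_cong) (auto simp: indicator_def)
  then show "(L2_norm haar (\<lambda>q. complex_of_real (indicat_real N q)))\<^sup>2 = measure haar N"
    by (simp add: L2_norm_power2 i NT)
  have "(\<integral>q. cmod (complex_of_real (indicat_real N q)) \<partial>haar) = (\<integral>q. indicat_real N q \<partial>haar)"
    by (intro Bochner_Integration.integral_cong) (auto simp: indicator_def)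
  then show "(\<integral>q. cmod (complex_of_real (indicat_real N q)) \<partial>haar) = measure haar N"
    by (simp add: i NT)
qed

text \<open>Cauchy-Schwarz on each section against the indicator of \<open>N\<close> produces the
  factor \<open>measure haar N\<close>. With \<open>N\<close> the torus it is the boundedness of
  \<open>marginal\<close>; with \<open>N\<close> small it makes the interaction negligible on trial
  functions.\<close>

lemma L2_norm_marginal_support:
  assumes f: "f \<in> L2 haar_sq" and N: "N \<in> sets haar"
    and supp: "\<And>p q. p \<in> torus \<Longrightarrow> q \<in> torus \<Longrightarrow> q \<notin> N \<Longrightarrow> f (p, q) = 0"
  shows "marginal f \<in> L2 haar" "(L2_norm haar (marginal f))\<^sup>2 \<le> measure haar N * (L2_norm haar_sq f)\<^sup>2"
proof -
  have mm: "marginal f \<in> borel_measurable haar" by (rule marginal_measurable[OF L2_measurable[OF f]])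
  note ind = haar_indicator_L2(1)[OF N] and ind_norm = haar_indicator_L2(2)[OF N]
  have bd: "AE p in haar. (cmod (marginal f p))\<^sup>2 \<le> measure haar N * (\<integral>q. (cmod (f (p, q)))\<^sup>2 \<partial>haar)"
    using AE_section_L2[OF f] AE_space
  proof eventually_elim
    case (elim p)
    have "cmod (marginal f p) \<le> (\<integral>q. cmod (f (p, q)) \<partial>haar)"
      unfolding marginal_def by simp
    also have "\<dots> = (\<integral>q. cmod (complex_of_real (indicat_real N q)) * cmod (f (p, q)) \<partial>haar)"
      using supp elim(2) by (intro Bochner_Integration.integral_cong) (auto simp: indicator_def)
    also have "\<dots> \<le> L2_norm haar (\<lambda>q. complex_of_real (indicat_real N q)) * L2_norm haar (\<lambda>q. f (p, q))"
      by (rule L2_Cauchy_Schwarz[OF ind elim(1)])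
    finally have "(cmod (marginal f p))\<^sup>2
        \<le> (L2_norm haar (\<lambda>q. complex_of_real (indicat_real N q)) * L2_norm haar (\<lambda>q. f (p, q)))\<^sup>2"
      by (intro power_mono) auto
    then show ?case unfolding power_mult_distrib unfolding ind_norm unfolding L2_norm_power2 .
  qed
  have i: "integrable haar (\<lambda>p. measure haar N * (\<integral>q. (cmod (f (p, q)))\<^sup>2 \<partial>haar))"
    using haar2.integrable_fst'[OF L2_integrable_sq[OF f]] by simp
  have i2: "integrable haar (\<lambda>p. (cmod (marginal f p))\<^sup>2)"
    by (rule Bochner_Integration.integrable_bound[OF i]) (use mm bd in auto)
  then show "marginal f \<in> L2 haar" using mm by (simp add: L2_def)
  have "(L2_norm haar (marginal f))\<^sup>2 \<le> (\<integral>p. measure haar N * (\<integral>q. (cmod (f (p, q)))\<^sup>2 \<partial>haar) \<partial>haar)"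
    unfolding L2_norm_power2 by (rule integral_mono_AE[OF i2 i bd])
  also have "\<dots> = measure haar N * (L2_norm haar_sq f)\<^sup>2"
    using haar2.integral_fst'[OF L2_integrable_sq[OF f]] by (simp add: L2_norm_power2)
  finally show "(L2_norm haar (marginal f))\<^sup>2 \<le> measure haar N * (L2_norm haar_sq f)\<^sup>2" .
qed

lemma marginal_L2:
  fixes f :: "(real ^ 'n) \<times> (real ^ 'n) \<Rightarrow> complex"
  assumes f: "f \<in> L2 haar_sq"
  shows "marginal f \<in> L2 haar" "L2_norm haar (marginal f) \<le> L2_norm haar_sq f"
proof -
  have "measure haar (torus :: (real ^ 'n) set) = 1" using haar.prob_space by simp
  then have "(L2_norm haar (marginal f))\<^sup>2 \<le> (L2_norm haar_sq f)\<^sup>2"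
    using L2_norm_marginal_support(2)[OF f sets.top] by simp
  then show "L2_norm haar (marginal f) \<le> L2_norm haar_sq f" by (rule power2_le_imp_le) simp
  show "marginal f \<in> L2 haar" by (rule L2_norm_marginal_support(1)[OF f sets.top]) simp
qed

lemma marginal_lin:
  assumes f: "f \<in> L2 haar_sq" and g: "g \<in> L2 haar_sq"
  shows "AE p in haar. marginal (\<lambda>x. a * f x + b * g x) p = a * marginal f p + b * marginal g p"
  using AE_section_L2[OF f] AE_section_L2[OF g]
proof eventually_elim
  case (elim p)
  then show ?case
    unfolding marginal_def using haar.L2_norm1_le(1)[OF elim(1)] haar.L2_norm1_le(1)[OF elim(2)] by simp
qed

lemma sum3_L2:
  assumes u: "u \<in> L2 haar"
  shows "sum3 K u \<in> L2 haar_sq" "L2_norm haar_sq (sum3 K u) \<le> 3 * L2_norm haar u"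
proof -
  note 1 = L2_measure_preserving[OF measurable_fst distr_haar_fst u]
  note 2 = L2_measure_preserving[OF measurable_snd distr_haar_snd u]
  note 3 = L2_measure_preserving[OF third_measurable' distr_haar_third[of K, unfolded case_prod_beta] u]
  show "sum3 K u \<in> L2 haar_sq" unfolding sum3_def by (intro L2_add 1 2 3)
  show "L2_norm haar_sq (sum3 K u) \<le> 3 * L2_norm haar u"
    unfolding sum3_def
    using L2_norm_triangle[OF L2_add[OF 1(1) 2(1)] 3(1)] L2_norm_triangle[OF 1(1) 2(1)] 1(2) 2(2) 3(2)
    by simp
qed

lemma sum3_cong_AE:
  assumes "AE p in haar. u p = v p" shows "AE x in haar_sq. sum3 K u x = sum3 K v x"
  using AE_haar_fst[OF assms] AE_haar_snd[OF assms] AE_haar_third[OF assms, of K]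
  by eventually_elim (simp add: sum3_def)

lemma sum3_lin: "sum3 K (\<lambda>p. a * u p + b * v p) x = a * sum3 K u x + b * sum3 K v x"
  by (simp add: sum3_def algebra_simps)

lemma sum3_swap: "sum3 K u (q, p) = sum3 K u (p, q)"
proof -
  have "wrap (K - q - p) = wrap (K - p - q)" by (rule arg_cong[where f=wrap]) simp
  then show ?thesis by (simp add: sum3_def)
qed

lemma sum3_third: "q \<in> torus \<Longrightarrow> sum3 K u (p, wrap (K - p - q)) = sum3 K u (p, q)"
  by (simp add: sum3_def wrap_involution)

definition mult_fun :: "((real ^ 'n) \<times> (real ^ 'n) \<Rightarrow> real) \<Rightarrow> ((real ^ 'n) \<times> (real ^ 'n) \<Rightarrow> complex)
    \<Rightarrow> (real ^ 'n) \<times> (real ^ 'n) \<Rightarrow> complex" where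
  "mult_fun R f = (\<lambda>x. of_real (R x) * f x)"

lemma mult_fun_L2:
  assumes R: "R \<in> borel_measurable haar_sq" "\<And>x. \<bar>R x\<bar> \<le> c" and f: "f \<in> L2 haar_sq"
  shows "mult_fun R f \<in> L2 haar_sq" "L2_norm haar_sq (mult_fun R f) \<le> c * L2_norm haar_sq f"
proof -
  note [measurable] = R(1) L2_measurable[OF f]
  have "mult_fun R f \<in> borel_measurable haar_sq" unfolding mult_fun_def by measurable
  moreover have "0 \<le> c" using R(2) abs_ge_zero order_trans by blast
  moreover have "AE x in haar_sq. cmod (mult_fun R f x) \<le> c * cmod (f x)"
    using R(2) by (auto simp: mult_fun_def norm_mult intro!: mult_right_mono)
  ultimately show "mult_fun R f \<in> L2 haar_sq" "L2_norm haar_sq (mult_fun R f) \<le> c * L2_norm haar_sq f"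
    using L2_dominated[OF f] by blast+
qed

abbreviation E3 :: "real ^ 'n \<Rightarrow> (real ^ 'n) \<times> (real ^ 'n) \<Rightarrow> real" where
  "E3 K \<equiv> \<lambda>x. E_three K (fst x) (snd x)"

lemma E3_measurable: "E3 K \<in> borel_measurable haar_sq"
  by (intro measurable_haar_pair1 borel_measurable_continuous_onI continuous_intros)

lemma E3_bounded: "\<bar>E3 K (x :: (real ^ 'n) \<times> (real ^ 'n))\<bar> \<le> 6 * CARD('n)"
  using E_three_nonneg[of K "fst x" "snd x"] E_three_le[of K "fst x" "snd x"] by simp

text \<open>\<open>H_op\<close> with its three partial integrals replaced by values of one marginal.
  The two agree almost everywhere on \<open>L2_sym K\<close>, and all estimates are carried out on
  this form.\<close>

definition H_form :: "real \<Rightarrow> real ^ 'n \<Rightarrow> ((real ^ 'n) \<times> (real ^ 'n) \<Rightarrow> complex)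
    \<Rightarrow> (real ^ 'n) \<times> (real ^ 'n) \<Rightarrow> complex" where
  "H_form \<mu> K f = (\<lambda>x. mult_fun (E3 K) f x + of_real \<mu> * sum3 K (marginal f) x)"

lemma H_form_L2:
  fixes \<mu> :: real and f :: "(real ^ 'n) \<times> (real ^ 'n) \<Rightarrow> complex"
  assumes f: "f \<in> L2 haar_sq"
  shows "H_form \<mu> K f \<in> L2 haar_sq"
    "L2_norm haar_sq (H_form \<mu> K f) \<le> (6 * CARD('n) + 3 * \<bar>\<mu>\<bar>) * L2_norm haar_sq f"
proof -
  note E = mult_fun_L2[OF E3_measurable E3_bounded f, of K]
  note S = sum3_L2[OF marginal_L2(1)[OF f], of K]
  show "H_form \<mu> K f \<in> L2 haar_sq" unfolding H_form_def by (intro L2_add L2_scale E S)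
  have "L2_norm haar_sq (H_form \<mu> K f)
      \<le> L2_norm haar_sq (mult_fun (E3 K) f) + \<bar>\<mu>\<bar> * L2_norm haar_sq (sum3 K (marginal f))"
    unfolding H_form_def using L2_norm_triangle[OF E(1) L2_scale[OF S(1)], of "of_real \<mu>"]
    by (simp add: L2_norm_scale)
  also have "\<dots> \<le> 6 * CARD('n) * L2_norm haar_sq f + \<bar>\<mu>\<bar> * (3 * L2_norm haar_sq f)"
    using E(2) S(2) marginal_L2(2)[OF f] by (intro add_mono mult_left_mono) auto
  finally show "L2_norm haar_sq (H_form \<mu> K f) \<le> (6 * CARD('n) + 3 * \<bar>\<mu>\<bar>) * L2_norm haar_sq f"
    by (simp add: algebra_simps)
qed

section \<open>The symmetric subspace and the operator on it\<close>

lemma L2_symD: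
  assumes "f \<in> L2_sym K"
  shows "f \<in> L2 haar_sq" "AE x in haar_sq. f x = f (snd x, fst x)"
    "AE x in haar_sq. f x = f (fst x, wrap (K - fst x - snd x))"
  using assms unfolding L2_sym_def by (auto simp: case_prod_beta)

lemma L2_symI:
  assumes "f \<in> L2 haar_sq" "AE x in haar_sq. f x = f (snd x, fst x)"
    "AE x in haar_sq. f x = f (fst x, wrap (K - fst x - snd x))"
  shows "f \<in> L2_sym K"
  using assms unfolding L2_sym_def by (auto simp: case_prod_beta)

lemma L2_sym_cong_AE:
  assumes f: "f \<in> L2_sym K" and g: "g \<in> borel_measurable haar_sq" and eq: "AE x in haar_sq. f x = g x"
  shows "g \<in> L2_sym K"
proof (rule L2_symI)
  show "g \<in> L2 haar_sq" by (rule L2_cong_AE[OF L2_symD(1)[OF f] g eq])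
  show "AE x in haar_sq. g x = g (snd x, fst x)"
    using eq AE_haar_sq_swap[OF eq] L2_symD(2)[OF f] by eventually_elim simp
  show "AE x in haar_sq. g x = g (fst x, wrap (K - fst x - snd x))"
    using eq AE_haar_sq_reflect[OF eq, of K] L2_symD(3)[OF f] by eventually_elim simp
qed

lemma L2_sym_lin:
  assumes "f \<in> L2_sym K" "g \<in> L2_sym K" shows "(\<lambda>x. a * f x + b * g x) \<in> L2_sym K"
proof (rule L2_symI)
  show "(\<lambda>x. a * f x + b * g x) \<in> L2 haar_sq" 
    by (rule L2_lin[OF L2_symD(1)[OF assms(1)] L2_symD(1)[OF assms(2)]])
  show "AE x in haar_sq. a * f x + b * g x = a * f (snd x, fst x) + b * g (snd x, fst x)"
    using L2_symD(2)[OF assms(1)] L2_symD(2)[OF assms(2)] by eventually_elim simp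
  show "AE x in haar_sq. a * f x + b * g x
      = a * f (fst x, wrap (K - fst x - snd x)) + b * g (fst x, wrap (K - fst x - snd x))"
    using L2_symD(3)[OF assms(1)] L2_symD(3)[OF assms(2)] by eventually_elim simp
qed

text \<open>Invariance of \<open>s n\<close> allows writing \<open>f - f \<circ> r\<close> as a
  difference of two errors, and \<open>r\<close> preserves the norm of the error.\<close>

lemma invariance_closed:
  assumes r: "r \<in> measurable haar_sq haar_sq" "distr haar_sq haar_sq r = haar_sq"
    and s: "\<And>n. s n \<in> L2 haar_sq" "\<And>n. AE x in haar_sq. s n x = s n (r x)"
    and f: "f \<in> L2 haar_sq" and lim: "(\<lambda>n. L2_norm haar_sq (\<lambda>x. s n x - f x)) \<longlonglongrightarrow> 0"
  shows "AE x in haar_sq. f x = f (r x)"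
proof -
  have fr: "(\<lambda>x. f (r x)) \<in> L2 haar_sq" by (rule L2_measure_preserving(1)[OF r f])
  have le: "L2_norm haar_sq (\<lambda>x. f x - f (r x)) \<le> 2 * L2_norm haar_sq (\<lambda>x. s n x - f x)" for n
  proof -
    have d: "(\<lambda>x. s n x - f x) \<in> L2 haar_sq" by (intro L2_diff s f)
    note dr = L2_measure_preserving[OF r d]
    have "L2_norm haar_sq (\<lambda>x. f x - f (r x)) = L2_norm haar_sq (\<lambda>x. (s n (r x) - f (r x)) - (s n x - f x))"
    proof (rule L2_norm_cong_AE)
      show "(\<lambda>x. f x - f (r x)) \<in> borel_measurable haar_sq"
        "(\<lambda>x. (s n (r x) - f (r x)) - (s n x - f x)) \<in> borel_measurable haar_sq"
        by (intro L2_measurable[OF L2_diff] f fr dr d)+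
      show "AE x in haar_sq. f x - f (r x) = (s n (r x) - f (r x)) - (s n x - f x)"
        using s(2)[of n] by eventually_elim simp
    qed
    also have "\<dots> \<le> L2_norm haar_sq (\<lambda>x. s n (r x) - f (r x)) + L2_norm haar_sq (\<lambda>x. s n x - f x)"
      by (rule L2_norm_triangle_diff[OF dr(1) d])
    finally show ?thesis using dr(2) by simp
  qed
  have "(\<lambda>n. 2 * L2_norm haar_sq (\<lambda>x. s n x - f x)) \<longlonglongrightarrow> 2 * 0"
    by (intro tendsto_intros lim)
  then have "L2_norm haar_sq (\<lambda>x. f x - f (r x)) \<le> 0" using LIMSEQ_le_const le by fastforce
  then have "L2_norm haar_sq (\<lambda>x. f x - f (r x)) = 0"
    using L2_norm_nonneg[of haar_sq "\<lambda>x. f x - f (r x)"] by linarith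
  then show ?thesis using L2_norm_eq_0_iff[OF L2_diff[OF f fr]] by simp
qed

lemma L2_sym_closed:
  assumes s: "\<And>n. s n \<in> L2_sym K" and f: "f \<in> L2 haar_sq"
    and lim: "(\<lambda>n. L2_norm haar_sq (\<lambda>x. s n x - f x)) \<longlonglongrightarrow> 0"
  shows "f \<in> L2_sym K"
proof (rule L2_symI[OF f])
  show "AE x in haar_sq. f x = f (snd x, fst x)"
    using invariance_closed[OF swap_measurable distr_haar_swap L2_symD(1)[OF s] _ f lim] L2_symD(2)[OF s]
    by (simp add: case_prod_beta)
  show "AE x in haar_sq. f x = f (fst x, wrap (K - fst x - snd x))"
    using invariance_closed[OF reflect2_measurable[of K] distr_reflect2 L2_symD(1)[OF s] _ f lim] L2_symD(3)[OF s]
    by (simp add: case_prod_beta)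
qed

lemma H_form_sym:
  assumes f: "f \<in> L2_sym K" shows "H_form \<mu> K f \<in> L2_sym K"
proof (rule L2_symI)
  show "H_form \<mu> K f \<in> L2 haar_sq" by (rule H_form_L2(1)[OF L2_symD(1)[OF f]])
  show "AE x in haar_sq. H_form \<mu> K f x = H_form \<mu> K f (snd x, fst x)"
    using L2_symD(2)[OF f]
    by eventually_elim (simp add: H_form_def mult_fun_def E_three_swap[of K "snd _"] sum3_swap[of K _ "snd _"])
  show "AE x in haar_sq. H_form \<mu> K f x = H_form \<mu> K f (fst x, wrap (K - fst x - snd x))"
    using L2_symD(3)[OF f] AE_space
    by eventually_elim (auto simp: H_form_def mult_fun_def E_three_third sum3_third space_haar_sq)
qed

text \<open>Symmetry holds only off a null set of pairs; by Fubini almost every section of that null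
  set is null, so the two partial integrals agree for almost every \<open>q\<close>.\<close>

lemma marginal_swapped:
  assumes f: "f \<in> L2_sym K" shows "AE q in haar. (\<integral>t. f (t, q) \<partial>haar) = marginal f q"
  using haar2.AE_pair[OF L2_symD(2)[OF f]] AE_space
proof eventually_elim
  case (elim q)
  have fm: "f \<in> borel_measurable haar_sq" by (rule L2_measurable[OF L2_symD(1)[OF f]])
  have q: "q \<in> torus" using elim(2) by simp
  show ?case
    unfolding marginal_def
  proof (rule integral_cong_AE)
    show "(\<lambda>t. f (t, q)) \<in> borel_measurable haar"
      using measurable_compose[OF measurable_Pair2'[of q haar haar] fm] q by simp
    show "(\<lambda>t. f (q, t)) \<in> borel_measurable haar" by (rule section_measurable[OF fm q])
    show "AE t in haar. f (t, q) = f (q, t)" using elim(1) by eventually_elim simp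
  qed
qed

lemma H_op_eq:
  assumes f: "f \<in> L2_sym K" shows "AE x in haar_sq. H_op \<mu> K f x = H_form \<mu> K f x"
  using AE_haar_snd[OF marginal_swapped[OF f]] AE_haar_third[OF marginal_swapped[OF f], of K]
proof eventually_elim
  case (elim x)
  then show ?case
    by (simp add: H_op_def H_form_def mult_fun_def sum3_def marginal_def case_prod_beta)
qed

lemma H_op_measurable:
  assumes f: "f \<in> borel_measurable haar_sq" shows "H_op \<mu> K f \<in> borel_measurable haar_sq"
proof -
  have sw: "(\<lambda>q. \<integral>t. f (t, q) \<partial>haar) \<in> borel_measurable haar"
  proof (rule haar.borel_measurable_lebesgue_integral)
    show "(\<lambda>(q, t). f (t, q)) \<in> borel_measurable haar_sq"
      using measurable_compose[OF swap_measurable f] by (simp add: case_prod_beta)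
  qed
  note [measurable] = f E3_measurable[of K] measurable_compose[OF measurable_fst marginal_measurable[OF f]]
    measurable_compose[OF measurable_snd sw] measurable_compose[OF third_measurable'[of K] sw]
  have "H_op \<mu> K f = (\<lambda>x. of_real (E3 K x) * f x + of_real \<mu> *
      (marginal f (fst x) + (\<integral>t. f (t, snd x) \<partial>haar) + (\<integral>t. f (t, wrap (K - fst x - snd x)) \<partial>haar)))"
    by (auto simp: fun_eq_iff H_op_def marginal_def)
  also have "\<dots> \<in> borel_measurable haar_sq" by measurable
  finally show ?thesis .
qed

lemma H_op_sym:
  assumes f: "f \<in> L2_sym K" shows "H_op \<mu> K f \<in> L2_sym K"
proof (rule L2_sym_cong_AE[OF H_form_sym[OF f]])
  show "H_op \<mu> K f \<in> borel_measurable haar_sq"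
    by (rule H_op_measurable[OF L2_measurable[OF L2_symD(1)[OF f]]])
  show "AE x in haar_sq. H_form \<mu> K f x = H_op \<mu> K f x"
    using H_op_eq[OF f, of \<mu>] by eventually_elim simp
qed

lemma integral_haar_sq_invariant:
  fixes F :: "(real ^ 'n) \<times> (real ^ 'n) \<Rightarrow> complex"
  assumes "r \<in> measurable haar_sq haar_sq" "distr haar_sq haar_sq r = haar_sq" "F \<in> borel_measurable haar_sq"
  shows "(\<integral>x. F (r x) \<partial>haar_sq) = (\<integral>x. F x \<partial>haar_sq)"
  using integral_distr[OF assms(1,3)] assms(2) by simp

text \<open>The symmetry of \<open>g\<close> and the invariance of the measure under swap and
  reflection carry each of the three terms to the first one, which Fubini turns into a
  marginal.\<close>

lemma inner_sum3:
  assumes u: "u \<in> L2 haar" and g: "g \<in> L2_sym K"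
  shows "L2_inner haar_sq (sum3 K u) g = 3 * L2_inner haar u (marginal g)"
proof -
  note g2 = L2_symD(1)[OF g]
  note u1 = L2_measure_preserving(1)[OF measurable_fst distr_haar_fst u]
  note u2 = L2_measure_preserving(1)[OF measurable_snd distr_haar_snd u]
  note u3 = L2_measure_preserving(1)[OF third_measurable' distr_haar_third[of K, unfolded case_prod_beta] u]
  note [measurable] = L2_measurable[OF u1] L2_measurable[OF u2] L2_measurable[OF u3] L2_measurable[OF g2]
  have 1: "L2_inner haar_sq (\<lambda>x. u (fst x)) g = L2_inner haar u (marginal g)"
  proof -
    have "L2_inner haar_sq (\<lambda>x. u (fst x)) g = (\<integral>p. (\<integral>q. u p * cnj (g (p, q)) \<partial>haar) \<partial>haar)"
      unfolding L2_inner_def using haar2.integral_fst'[OF L2_inner_integrable[OF u1 g2]] by simp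
    also have "\<dots> = L2_inner haar u (marginal g)"
      unfolding L2_inner_def marginal_def by simp
    finally show ?thesis .
  qed
  have 2: "L2_inner haar_sq (\<lambda>x. u (snd x)) g = L2_inner haar_sq (\<lambda>x. u (fst x)) g"
  proof -
    have "L2_inner haar_sq (\<lambda>x. u (fst x)) g = (\<integral>x. u (snd x) * cnj (g (snd x, fst x)) \<partial>haar_sq)"
      unfolding L2_inner_def
      using integral_haar_sq_invariant[OF swap_measurable distr_haar_swap, of "\<lambda>x. u (fst x) * cnj (g x)"]
      by (simp add: case_prod_beta)
    also have "\<dots> = L2_inner haar_sq (\<lambda>x. u (snd x)) g"
      unfolding L2_inner_def
    proof (rule integral_cong_AE)
      show "AE x in haar_sq. u (snd x) * cnj (g (snd x, fst x)) = u (snd x) * cnj (g x)"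
        using L2_symD(2)[OF g] by eventually_elim simp
      have "(\<lambda>x. g (snd x, fst x)) \<in> borel_measurable haar_sq"
        using measurable_compose[OF swap_measurable L2_measurable[OF g2]] by (simp add: case_prod_beta)
      then show "(\<lambda>x. u (snd x) * cnj (g (snd x, fst x))) \<in> borel_measurable haar_sq" by measurable
    qed measurable
    finally show ?thesis by simp
  qed
  have 3: "L2_inner haar_sq (\<lambda>x. u (wrap (K - fst x - snd x))) g = L2_inner haar_sq (\<lambda>x. u (snd x)) g"
  proof -
    have "L2_inner haar_sq (\<lambda>x. u (snd x)) g
        = (\<integral>x. u (wrap (K - fst x - snd x)) * cnj (g (fst x, wrap (K - fst x - snd x))) \<partial>haar_sq)"
      unfolding L2_inner_def
      using integral_haar_sq_invariant[OF reflect2_measurable[of K] distr_reflect2, of "\<lambda>x. u (snd x) * cnj (g x)"]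
      by (simp add: case_prod_beta)
    also have "\<dots> = L2_inner haar_sq (\<lambda>x. u (wrap (K - fst x - snd x))) g"
      unfolding L2_inner_def
    proof (rule integral_cong_AE)
      show "AE x in haar_sq. u (wrap (K - fst x - snd x)) * cnj (g (fst x, wrap (K - fst x - snd x)))
          = u (wrap (K - fst x - snd x)) * cnj (g x)"
        using L2_symD(3)[OF g] by eventually_elim simp
      have "(\<lambda>x. g (fst x, wrap (K - fst x - snd x))) \<in> borel_measurable haar_sq"
        using measurable_compose[OF reflect2_measurable[of K] L2_measurable[OF g2]] by (simp add: case_prod_beta)
      then show "(\<lambda>x. u (wrap (K - fst x - snd x)) * cnj (g (fst x, wrap (K - fst x - snd x))))
          \<in> borel_measurable haar_sq" by measurable
    qed measurable
    finally show ?thesis by simp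
  qed
  have "L2_inner haar_sq (sum3 K u) g = L2_inner haar_sq (\<lambda>x. u (fst x)) g
      + L2_inner haar_sq (\<lambda>x. u (snd x)) g + L2_inner haar_sq (\<lambda>x. u (wrap (K - fst x - snd x))) g"
    using L2_inner_lin_left[OF L2_add[OF u1 u2] u3 g2, of 1 1] L2_inner_lin_left[OF u1 u2 g2, of 1 1]
    by (simp add: sum3_def)
  then show ?thesis using 1 2 3 by simp
qed

text \<open>Both summands on the right are visibly Hermitian, which gives the symmetry of the
  operator.\<close>

lemma H_form_inner:
  assumes f: "f \<in> L2_sym K" and g: "g \<in> L2_sym K"
  shows "L2_inner haar_sq (H_form \<mu> K f) g
    = L2_inner haar_sq (mult_fun (E3 K) f) g + 3 * of_real \<mu> * L2_inner haar (marginal f) (marginal g)"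
proof -
  note f2 = L2_symD(1)[OF f] and g2 = L2_symD(1)[OF g]
  have "L2_inner haar_sq (H_form \<mu> K f) g = L2_inner haar_sq (mult_fun (E3 K) f) g
      + of_real \<mu> * L2_inner haar_sq (sum3 K (marginal f)) g"
    using L2_inner_lin_left[OF mult_fun_L2(1)[OF E3_measurable E3_bounded f2] sum3_L2(1)[OF marginal_L2(1)[OF f2]] g2, of 1 K "of_real \<mu>" K]
    by (simp add: H_form_def)
  then show ?thesis using inner_sum3[OF marginal_L2(1)[OF f2] g] by simp
qed

lemma H_form_symmetric:
  assumes f: "f \<in> L2_sym K" and g: "g \<in> L2_sym K"
  shows "L2_inner haar_sq (H_form \<mu> K f) g = L2_inner haar_sq f (H_form \<mu> K g)"
proof -
  have "L2_inner haar_sq f (H_form \<mu> K g) = cnj (L2_inner haar_sq (H_form \<mu> K g) f)"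
    by (rule L2_inner_cnj)
  also have "\<dots> = cnj (L2_inner haar_sq (mult_fun (E3 K) g) f)
      + 3 * of_real \<mu> * cnj (L2_inner haar (marginal g) (marginal f))"
    unfolding H_form_inner[OF g f] by simp
  also have "cnj (L2_inner haar (marginal g) (marginal f)) = L2_inner haar (marginal f) (marginal g)"
    by (rule L2_inner_cnj[symmetric])
  also have "cnj (L2_inner haar_sq (mult_fun (E3 K) g) f) = L2_inner haar_sq f (mult_fun (E3 K) g)"
    by (rule L2_inner_cnj[symmetric])
  also have "\<dots> = L2_inner haar_sq (mult_fun (E3 K) f) g"
    unfolding L2_inner_def mult_fun_def by (simp add: mult_ac)
  finally show ?thesis using H_form_inner[OF f g] by simp
qed

lemma symmetric_operator_H_op:
  fixes \<mu> :: real and K :: "real ^ 'n"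
  shows "symmetric_operator haar_sq (L2_sym K) (H_op \<mu> K) (6 * CARD('n) + 3 * \<bar>\<mu>\<bar>)"
proof (intro symmetric_operator.intro symmetric_operator_axioms.intro haar_sq_prob)
  have meas: "H_op \<mu> K f \<in> borel_measurable haar_sq" "H_form \<mu> K f \<in> borel_measurable haar_sq"
    "f \<in> borel_measurable haar_sq" if "f \<in> L2_sym K" for f
    using H_op_sym[OF that] H_form_sym[OF that] that L2_symD(1) L2_measurable by blast+
  show "f \<in> L2 haar_sq" if "f \<in> L2_sym K" for f by (rule L2_symD(1)[OF that])
  show "(\<lambda>x. a * f x + b * g x) \<in> L2_sym K" if "f \<in> L2_sym K" "g \<in> L2_sym K" for f g a b
    by (rule L2_sym_lin[OF that])
  show "f \<in> L2_sym K" if "\<And>n. s n \<in> L2_sym K" "f \<in> L2 haar_sq"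
    "(\<lambda>n. L2_norm haar_sq (\<lambda>x. s n x - f x)) \<longlonglongrightarrow> 0" for s f
    by (rule L2_sym_closed[OF that])
  show "H_op \<mu> K f \<in> L2_sym K" if "f \<in> L2_sym K" for f by (rule H_op_sym[OF that])
  show "AE x in haar_sq. H_op \<mu> K (\<lambda>x. a * f x + b * g x) x = a * H_op \<mu> K f x + b * H_op \<mu> K g x"
    if f: "f \<in> L2_sym K" and g: "g \<in> L2_sym K" for f g a b
    using H_op_eq[OF f, of \<mu>] H_op_eq[OF g, of \<mu>] H_op_eq[OF L2_sym_lin[OF f g, of a b], of \<mu>]
      sum3_cong_AE[OF marginal_lin[OF L2_symD(1)[OF f] L2_symD(1)[OF g]], of K a b]
  proof eventually_elim
    case (elim x)
    then show ?case
      unfolding elim(1) elim(2) elim(3) by (simp add: H_form_def mult_fun_def sum3_lin algebra_simps)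
  qed
  show "L2_norm haar_sq (H_op \<mu> K f) \<le> (6 * CARD('n) + 3 * \<bar>\<mu>\<bar>) * L2_norm haar_sq f"
    if f: "f \<in> L2_sym K" for f
    using H_form_L2(2)[OF L2_symD(1)[OF f], of \<mu> K] L2_norm_cong_AE[OF meas(1)[OF f] meas(2)[OF f] H_op_eq[OF f]]
    by simp
  show "L2_inner haar_sq (H_op \<mu> K f) g = L2_inner haar_sq f (H_op \<mu> K g)"
    if f: "f \<in> L2_sym K" and g: "g \<in> L2_sym K" for f g
  proof -
    have "L2_inner haar_sq (H_op \<mu> K f) g = L2_inner haar_sq (H_form \<mu> K f) g"
      by (rule L2_inner_cong_AE[OF meas(1)[OF f] meas(3)[OF g] meas(2)[OF f] meas(3)[OF g] H_op_eq[OF f]]) simp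
    also have "\<dots> = L2_inner haar_sq f (H_form \<mu> K g)" by (rule H_form_symmetric[OF f g])
    also have "\<dots> = L2_inner haar_sq f (H_op \<mu> K g)"
      by (rule L2_inner_cong_AE[OF meas(3)[OF f] meas(2)[OF g] meas(3)[OF f] meas(1)[OF g]])
        (use AE_symmetric[OF H_op_eq[OF g]] in auto)
    finally show ?thesis .
  qed
  show "0 \<le> real (6 * CARD('n)) + 3 * \<bar>\<mu>\<bar>" by simp
qed

section \<open>The Faddeev equation\<close>

text \<open>The bound on the absolute value treats \<open>z\<close> below \<open>E_min K\<close> and
  \<open>z\<close> above \<open>E_max K\<close> at once; the sign of \<open>R\<close> is left
  open.\<close>

locale resolvent_gap =
  fixes K :: "real ^ 'n" and z d :: real
  assumes d_pos: "0 < d" and gap: "\<And>p q. d \<le> \<bar>E_three K p q - z\<bar>"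
begin

definition R :: "real ^ 'n \<Rightarrow> real ^ 'n \<Rightarrow> real" where
  "R p q = 1 / (E_three K p q - z)"

definition r :: "real ^ 'n \<Rightarrow> real" where
  "r p = (\<integral>q. R p q \<partial>haar)"

definition RI :: "(real ^ 'n \<Rightarrow> complex) \<Rightarrow> real ^ 'n \<Rightarrow> complex" where
  "RI u p = (\<integral>q. of_real (R p q) * u q \<partial>haar)"

lemma gap_nonzero: "E_three K p q - z \<noteq> 0"
  using gap[of p q] d_pos by auto

lemma R_bound: "\<bar>R p q\<bar> \<le> 1 / d"
  unfolding R_def abs_divide using gap[of p q] d_pos by (auto intro!: divide_left_mono mult_pos_pos)

lemma continuous_R:
  fixes f :: "'a::t2_space \<Rightarrow> real ^ 'n"
  shows "continuous_on A f \<Longrightarrow> continuous_on A g \<Longrightarrow> continuous_on A (\<lambda>x. R (f x) (g x))"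
  unfolding R_def using gap_nonzero by (intro continuous_intros) auto

lemma R_measurable: "(\<lambda>x. R (fst x) (snd x)) \<in> borel_measurable haar_sq"
  by (intro measurable_haar_pair1 borel_measurable_continuous_onI continuous_R continuous_intros)

lemma R_section_measurable: "R p \<in> borel_measurable haar"
proof -
  have "(\<lambda>q. R p q) \<in> borel_measurable haar"
    by (intro measurable_haar1 borel_measurable_continuous_onI continuous_R continuous_intros)
  then show ?thesis .
qed

lemma R_swap: "R q p = R p q" by (simp add: R_def E_three_swap[of K q p])

lemma R_third: "R p (wrap (K - p - q)) = R p q" by (simp add: R_def E_three_third)

text \<open>The difference of two reciprocals is the difference of the energies times both
  reciprocals, each at most \<open>1 / d\<close>; the constant \<open>2 * CARD('n)\<close> is that
  of \<open>E_three\<close>.\<close>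

lemma R_lipschitz: "\<bar>R p q - R p' q\<bar> \<le> 2 * CARD('n) / d\<^sup>2 * norm (p - p')"
proof -
  have "R p q - R p' q = (E_three K p' q - E_three K p q) * (R p q * R p' q)"
    unfolding R_def using gap_nonzero[of p q] gap_nonzero[of p' q] by (simp add: field_simps)
  then have "\<bar>R p q - R p' q\<bar> = \<bar>E_three K p' q - E_three K p q\<bar> * (\<bar>R p q\<bar> * \<bar>R p' q\<bar>)"
    by (simp add: abs_mult)
  also have "\<dots> \<le> (2 * CARD('n) * norm (p' - p)) * (1 / d * (1 / d))"
    using d_pos by (intro mult_mono E_three_lipschitz R_bound) auto
  finally show ?thesis by (simp add: power2_eq_square norm_minus_commute)
qed

lemma R_integrable: "integrable haar (R p)"
  by (rule haar.integrable_const_bound[where B="1 / d"]) (use R_bound R_section_measurable in auto)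

lemma r_lipschitz: "\<bar>r p - r p'\<bar> \<le> 2 * CARD('n) / d\<^sup>2 * norm (p - p')"
proof -
  have "\<bar>r p - r p'\<bar> = \<bar>\<integral>q. R p q - R p' q \<partial>haar\<bar>"
    unfolding r_def using R_integrable by simp
  also have "\<dots> \<le> (\<integral>q. \<bar>R p q - R p' q\<bar> \<partial>haar)" by (rule integral_abs_bound)
  also have "\<dots> \<le> (\<integral>q. 2 * CARD('n) / d\<^sup>2 * norm (p - p') \<partial>(haar :: (real ^ 'n) measure))"
    by (rule integral_mono) (use R_integrable R_lipschitz in auto)
  finally show ?thesis by (simp add: haar.prob_space[simplified])
qed

lemma continuous_r: "continuous_on A r"
proof (rule lipschitz_on_continuous_on[where L="2 * CARD('n) / d\<^sup>2"], rule lipschitz_onI)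
  fix x y show "dist (r x) (r y) \<le> 2 * CARD('n) / d\<^sup>2 * dist x y"
    using r_lipschitz[of x y] by (simp add: dist_norm)
qed simp

lemma RI_integrable:
  assumes u: "u \<in> L2 haar" shows "integrable haar (\<lambda>q. of_real (R p q) * u q)"
proof (rule Bochner_Integration.integrable_bound)
  note [measurable] = L2_measurable[OF u] R_section_measurable[of p]
  show "integrable haar (\<lambda>q. of_real (1 / d) * u q)"
    using haar.L2_norm1_le(1)[OF u] by simp
  show "(\<lambda>q. of_real (R p q) * u q) \<in> borel_measurable haar" by measurable
  show "AE q in haar. norm (complex_of_real (R p q) * u q) \<le> norm (of_real (1 / d) * u q)"
  proof (rule AE_I2)
    fix q
    have "\<bar>R p q\<bar> * cmod (u q) \<le> \<bar>1 / d\<bar> * cmod (u q)"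
      using R_bound[of p q] d_pos by (intro mult_right_mono) auto
    then show "norm (complex_of_real (R p q) * u q) \<le> norm (of_real (1 / d) * u q)"
      unfolding norm_mult norm_of_real .
  qed
qed

lemma RI_bound:
  assumes u: "u \<in> L2 haar" shows "cmod (RI u p) \<le> 1 / d * (\<integral>q. cmod (u q) \<partial>haar)"
proof -
  have "cmod (RI u p) \<le> (\<integral>q. cmod (of_real (R p q) * u q) \<partial>haar)"
    unfolding RI_def by simp
  also have "\<dots> \<le> (\<integral>q. 1 / d * cmod (u q) \<partial>haar)"
  proof (rule integral_mono)
    show "integrable haar (\<lambda>q. cmod (of_real (R p q) * u q))" using RI_integrable[OF u] by simp
    show "integrable haar (\<lambda>q. 1 / d * cmod (u q))" using haar.L2_norm1_le(1)[OF u] by simp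
    show "cmod (of_real (R p q) * u q) \<le> 1 / d * cmod (u q)" for q
      unfolding norm_mult norm_of_real by (intro mult_right_mono R_bound) simp
  qed
  finally show ?thesis by simp
qed

text \<open>The modulus of continuity depends on \<open>u\<close> only through its norm, so a
  bounded family of \<open>u\<close> has equicontinuous images.\<close>

lemma RI_lipschitz:
  assumes u: "u \<in> L2 haar"
  shows "cmod (RI u p - RI u p') \<le> 2 * CARD('n) / d\<^sup>2 * norm (p - p') * L2_norm haar u"
proof -
  let ?L = "2 * CARD('n) / d\<^sup>2 * norm (p - p')"
  have L: "0 \<le> ?L" by simp
  have "cmod (RI u p - RI u p') = cmod (\<integral>q. of_real (R p q) * u q - of_real (R p' q) * u q \<partial>haar)"
    unfolding RI_def using RI_integrable[OF u] by simp
  also have "\<dots> \<le> (\<integral>q. cmod (of_real (R p q) * u q - of_real (R p' q) * u q) \<partial>haar)" by simp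
  also have "\<dots> \<le> (\<integral>q. ?L * cmod (u q) \<partial>haar)"
  proof (rule integral_mono)
    show "integrable haar (\<lambda>q. cmod (of_real (R p q) * u q - of_real (R p' q) * u q))"
      using RI_integrable[OF u] by simp
    show "integrable haar (\<lambda>q. ?L * cmod (u q))" using haar.L2_norm1_le(1)[OF u] by simp
    fix q
    have "cmod (of_real (R p q) * u q - of_real (R p' q) * u q) = \<bar>R p q - R p' q\<bar> * cmod (u q)"
      by (simp add: norm_mult flip: left_diff_distrib of_real_diff)
    then show "cmod (of_real (R p q) * u q - of_real (R p' q) * u q) \<le> ?L * cmod (u q)"
      using mult_right_mono[OF R_lipschitz norm_ge_zero] by simp
  qed
  also have "\<dots> = ?L * (\<integral>q. cmod (u q) \<partial>haar)" by (rule integral_mult_right_zero)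
  also have "\<dots> \<le> ?L * L2_norm haar u"
    by (rule mult_left_mono[OF haar.L2_norm1_le(2)[OF u] L])
  finally show ?thesis .
qed

lemma RI_L2:
  assumes u: "u \<in> L2 haar" shows "RI u \<in> L2 haar"
proof (rule L2_dominated(1)[OF haar.L2_const(1)[of 1]])
  have "continuous_on UNIV (RI u)"
  proof (rule lipschitz_on_continuous_on[where L="2 * CARD('n) / d\<^sup>2 * L2_norm haar u"], rule lipschitz_onI)
    fix x y show "dist (RI u x) (RI u y) \<le> 2 * CARD('n) / d\<^sup>2 * L2_norm haar u * dist x y"
      using RI_lipschitz[OF u, of x y] by (simp add: dist_norm mult_ac)
  qed simp
  then show "RI u \<in> borel_measurable haar"
    by (intro measurable_haar1 borel_measurable_continuous_onI)
  show "0 \<le> 1 / d * (\<integral>q. cmod (u q) \<partial>haar)" using d_pos by simp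
  show "AE p in haar. cmod (RI u p) \<le> 1 / d * (\<integral>q. cmod (u q) \<partial>haar) * cmod 1"
    using RI_bound[OF u] by simp
qed

abbreviation R2 :: "(real ^ 'n) \<times> (real ^ 'n) \<Rightarrow> real" where
  "R2 \<equiv> \<lambda>x. R (fst x) (snd x)"

text \<open>The value \<open>u p\<close> leaves the integral and yields \<open>r p\<close>. The
  other two terms coincide because \<open>q \<mapsto> wrap (K - p - q)\<close> preserves both the
  measure and \<open>R p\<close>; this is the factor 2.\<close>

lemma marginal_R_sum3:
  assumes u: "u \<in> L2 haar"
  shows "marginal (mult_fun R2 (sum3 K u)) p = of_real (r p) * u p + 2 * RI u p"
proof -
  note uw = L2_measure_preserving[OF wrap_reflect_measurable distr_haar_reflect u, of "K - p"]
  have "marginal (mult_fun R2 (sum3 K u)) p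
      = (\<integral>q. of_real (R p q) * u p + of_real (R p q) * u q + of_real (R p q) * u (wrap (K - p - q)) \<partial>haar)"
    unfolding marginal_def mult_fun_def sum3_def by (simp add: distrib_left)
  also have "\<dots> = (\<integral>q. of_real (R p q) * u p \<partial>haar) + RI u p + RI (\<lambda>q. u (wrap (K - p - q))) p"
    unfolding RI_def using RI_integrable[OF u, of p] RI_integrable[OF uw(1), of p] R_integrable[of p] by simp
  also have "(\<integral>q. of_real (R p q) * u p \<partial>haar) = of_real (r p) * u p"
    unfolding r_def by simp
  also have "RI (\<lambda>q. u (wrap (K - p - q))) p = RI u p"
    using integral_haar_reflect[OF borel_measurable_integrable[OF RI_integrable[OF u, of p]], of "K - p"]
    unfolding RI_def R_third .
  finally show ?thesis by simp
qed

lemma mult_R2_L2: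
  assumes "f \<in> L2 haar_sq"
  shows "mult_fun R2 f \<in> L2 haar_sq" "L2_norm haar_sq (mult_fun R2 f) \<le> 1 / d * L2_norm haar_sq f"
  by (rule mult_fun_L2[OF R_measurable R_bound assms])+

text \<open>The first equation is the pointwise identity obtained on multiplying by
  \<open>R2\<close>, and shows that \<open>f\<close> is recovered from its marginal and the defect
  \<open>g\<close>. Taking marginals of it gives a closed equation for the marginal.\<close>

lemma faddeev:
  fixes \<mu> :: real
  assumes f: "f \<in> L2 haar_sq"
  defines "g \<equiv> \<lambda>x. H_form \<mu> K f x - of_real z * f x"
  shows "f = (\<lambda>x. 1 * mult_fun R2 g x + (- of_real \<mu>) * mult_fun R2 (sum3 K (marginal f)) x)"
    and "AE p in haar. of_real (1 + \<mu> * r p) * marginal f p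
      = marginal (mult_fun R2 g) p - 2 * of_real \<mu> * RI (marginal f) p"
proof -
  show eq: "f = (\<lambda>x. 1 * mult_fun R2 g x + (- of_real \<mu>) * mult_fun R2 (sum3 K (marginal f)) x)"
  proof (rule ext)
    fix x :: "(real ^ 'n) \<times> (real ^ 'n)"
    have "g x - of_real \<mu> * sum3 K (marginal f) x = of_real (E3 K x - z) * f x"
      by (simp add: g_def H_form_def mult_fun_def algebra_simps)
    then have "of_real (R2 x) * (g x - of_real \<mu> * sum3 K (marginal f) x)
        = of_real (R2 x * (E3 K x - z)) * f x" by simp
    also have "R2 x * (E3 K x - z) = 1" using gap_nonzero by (simp add: R_def)
    finally show "f x = 1 * mult_fun R2 g x + (- of_real \<mu>) * mult_fun R2 (sum3 K (marginal f)) x"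
      by (simp add: mult_fun_def algebra_simps)
  qed
  have g: "g \<in> L2 haar_sq" unfolding g_def by (intro L2_diff L2_scale H_form_L2(1) f)
  have u: "marginal f \<in> L2 haar" by (rule marginal_L2(1)[OF f])
  have "AE p in haar. marginal f p = 1 * marginal (mult_fun R2 g) p
      + (- of_real \<mu>) * marginal (mult_fun R2 (sum3 K (marginal f))) p"
    using marginal_lin[OF mult_R2_L2(1)[OF g] mult_R2_L2(1)[OF sum3_L2(1)[OF u]], of 1 "- of_real \<mu>" K]
    unfolding eq[symmetric] .
  then show "AE p in haar. of_real (1 + \<mu> * r p) * marginal f p
      = marginal (mult_fun R2 g) p - 2 * of_real \<mu> * RI (marginal f) p"
  proof eventually_elim
    case (elim p)
    have "marginal f p = marginal (mult_fun R2 g) p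
        - of_real \<mu> * (of_real (r p) * marginal f p + 2 * RI (marginal f) p)"
      using elim unfolding marginal_R_sum3[OF u] by simp
    then show ?case by (simp add: algebra_simps)
  qed
qed

lemma Tz_norm:
  fixes \<mu> :: real
  assumes f: "f \<in> L2_sym K"
  shows "L2_norm haar_sq (symmetric_operator.Tz (H_op \<mu> K) (of_real z) f)
    = L2_norm haar_sq (\<lambda>x. H_form \<mu> K f x - of_real z * f x)"
proof -
  interpret symmetric_operator haar_sq "L2_sym K" "H_op \<mu> K" "6 * CARD('n) + 3 * \<bar>\<mu>\<bar>"
    by (rule symmetric_operator_H_op)
  show ?thesis
  proof (rule L2_norm_cong_AE)
    show "Tz (of_real z) f \<in> borel_measurable haar_sq" by (rule V_measurable[OF Tz_V[OF f]])
    show "(\<lambda>x. H_form \<mu> K f x - of_real z * f x) \<in> borel_measurable haar_sq"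
      by (rule L2_measurable[OF L2_diff[OF H_form_L2(1) L2_scale]]) (rule L2_symD(1)[OF f])+
    show "AE x in haar_sq. Tz (of_real z) f x = H_form \<mu> K f x - of_real z * f x"
      using H_op_eq[OF f, of \<mu>] by eventually_elim (simp add: Tz_def)
  qed
qed

text \<open>Stated for two functions, so that it yields the Cauchy property directly, with no limit
  function. Each use of \<open>R2\<close> costs \<open>1 / d\<close>, solving for the marginal costs
  \<open>1 / \<delta>\<close>, \<open>sum3\<close> costs 3, and the integral term carries
  \<open>2 * \<bar>\<mu>\<bar>\<close>.\<close>

lemma faddeev_difference_bound:
  fixes \<mu> :: real
  assumes f: "f \<in> L2 haar_sq" and f': "f' \<in> L2 haar_sq" and \<delta>: "0 < \<delta>"
    and D: "\<And>p. p \<in> torus \<Longrightarrow> \<delta> \<le> \<bar>1 + \<mu> * r p\<bar>" and e: "0 \<le> e"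
    and close: "\<And>p. p \<in> torus \<Longrightarrow> cmod (RI (marginal f) p - RI (marginal f') p) \<le> e"
  defines "G \<equiv> \<lambda>f. L2_norm haar_sq (\<lambda>x. H_form \<mu> K f x - of_real z * f x)"
  shows "L2_norm haar_sq (\<lambda>x. f x - f' x)
    \<le> (1 / d + 3 * \<bar>\<mu>\<bar> / (d * \<delta> * d)) * (G f + G f') + 6 * \<mu>\<^sup>2 / (d * \<delta>) * e"
proof -
  let ?u = "marginal f" and ?u' = "marginal f'"
  define g where "g = (\<lambda>x. H_form \<mu> K f x - of_real z * f x)"
  define g' where "g' = (\<lambda>x. H_form \<mu> K f' x - of_real z * f' x)"
  have g: "g \<in> L2 haar_sq" unfolding g_def by (intro L2_diff L2_scale H_form_L2(1) f)
  have g': "g' \<in> L2 haar_sq" unfolding g'_def by (intro L2_diff L2_scale H_form_L2(1) f')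
  have u: "?u \<in> L2 haar" and u': "?u' \<in> L2 haar" by (rule marginal_L2(1)[OF f], rule marginal_L2(1)[OF f'])
  have Rg: "marginal (mult_fun R2 g) \<in> L2 haar" "L2_norm haar (marginal (mult_fun R2 g)) \<le> 1 / d * G f"
    using marginal_L2[OF mult_R2_L2(1)[OF g]] mult_R2_L2(2)[OF g] by (auto simp: G_def g_def)
  have Rg': "marginal (mult_fun R2 g') \<in> L2 haar" "L2_norm haar (marginal (mult_fun R2 g')) \<le> 1 / d * G f'"
    using marginal_L2[OF mult_R2_L2(1)[OF g']] mult_R2_L2(2)[OF g'] by (auto simp: G_def g'_def)
  \<comment> \<open>The difference of the right-hand sides of the two Faddeev equations.\<close>
  define w where "w p = (marginal (mult_fun R2 g) p - marginal (mult_fun R2 g') p)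
      - 2 * of_real \<mu> * (RI ?u p - RI ?u' p)" for p
  have RIe: "(\<lambda>p. RI ?u p - RI ?u' p) \<in> L2 haar" by (intro L2_diff RI_L2 u u')
  have w: "w \<in> L2 haar" unfolding w_def[abs_def] by (intro L2_diff Rg Rg' L2_scale RIe RI_L2 u u')
  have RIe_norm: "L2_norm haar (\<lambda>p. RI ?u p - RI ?u' p) \<le> e"
  proof -
    have "AE p in haar. cmod (RI ?u p - RI ?u' p) \<le> e * cmod 1"
      using close by (intro AE_I2) simp
    then show ?thesis
      using L2_dominated(2)[OF haar.L2_const(1)[of 1] L2_measurable[OF RIe] e] by (simp add: haar.L2_const(2))
  qed
  have wn: "L2_norm haar w \<le> 1 / d * (G f + G f') + 2 * \<bar>\<mu>\<bar> * e"
  proof -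
    have "L2_norm haar w \<le> L2_norm haar (\<lambda>p. marginal (mult_fun R2 g) p - marginal (mult_fun R2 g') p)
        + L2_norm haar (\<lambda>p. 2 * of_real \<mu> * (RI ?u p - RI ?u' p))"
      unfolding w_def[abs_def] by (rule L2_norm_triangle_diff[OF L2_diff[OF Rg(1) Rg'(1)] L2_scale[OF RIe]])
    also have "L2_norm haar (\<lambda>p. 2 * of_real \<mu> * (RI ?u p - RI ?u' p)) \<le> 2 * \<bar>\<mu>\<bar> * e"
      unfolding L2_norm_scale using RIe_norm by (simp add: norm_mult mult_left_mono)
    also have "L2_norm haar (\<lambda>p. marginal (mult_fun R2 g) p - marginal (mult_fun R2 g') p)
        \<le> 1 / d * G f + 1 / d * G f'"
      using L2_norm_triangle_diff[OF Rg(1) Rg'(1)] Rg(2) Rg'(2) by linarith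
    finally show ?thesis by (simp add: distrib_left)
  qed
  have un: "L2_norm haar (\<lambda>p. ?u p - ?u' p) \<le> 1 / \<delta> * L2_norm haar w"
  proof (rule L2_dominated(2)[OF w L2_measurable[OF L2_diff[OF u u']]])
    show "AE p in haar. cmod (?u p - ?u' p) \<le> 1 / \<delta> * cmod (w p)"
      using faddeev(2)[OF f, of \<mu>] faddeev(2)[OF f', of \<mu>] AE_space
    proof eventually_elim
      case (elim p)
      have "of_real (1 + \<mu> * r p) * (?u p - ?u' p) = w p"
        unfolding right_diff_distrib elim(1) elim(2) w_def g_def g'_def by (simp add: algebra_simps)
      then have "\<bar>1 + \<mu> * r p\<bar> * cmod (?u p - ?u' p) = cmod (w p)"
        by (metis norm_mult norm_of_real)
      moreover have "\<delta> * cmod (?u p - ?u' p) \<le> \<bar>1 + \<mu> * r p\<bar> * cmod (?u p - ?u' p)"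
        using D elim(3) by (intro mult_right_mono) auto
      ultimately show ?case using \<delta> by (simp add: field_simps)
    qed
  qed (use \<delta> in simp)
  have "L2_norm haar_sq (\<lambda>x. f x - f' x)
      = L2_norm haar_sq (\<lambda>x. (mult_fun R2 g x - mult_fun R2 g' x)
        - of_real \<mu> * mult_fun R2 (sum3 K (\<lambda>p. 1 * ?u p + (-1) * ?u' p)) x)"
  proof (rule arg_cong[where f="L2_norm haar_sq"], rule ext)
    fix x
    have a: "f x = mult_fun R2 g x - of_real \<mu> * mult_fun R2 (sum3 K ?u) x"
      using fun_cong[OF faddeev(1)[OF f, of \<mu>], of x] unfolding g_def by simp
    have b: "f' x = mult_fun R2 g' x - of_real \<mu> * mult_fun R2 (sum3 K ?u') x"
      using fun_cong[OF faddeev(1)[OF f', of \<mu>], of x] unfolding g'_def by simp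
    show "f x - f' x = (mult_fun R2 g x - mult_fun R2 g' x)
        - of_real \<mu> * mult_fun R2 (sum3 K (\<lambda>p. 1 * ?u p + (-1) * ?u' p)) x"
      unfolding a b mult_fun_def sum3_lin by (simp add: algebra_simps)
  qed
  also have "\<dots> \<le> L2_norm haar_sq (\<lambda>x. mult_fun R2 g x - mult_fun R2 g' x)
      + \<bar>\<mu>\<bar> * L2_norm haar_sq (mult_fun R2 (sum3 K (\<lambda>p. 1 * ?u p + (-1) * ?u' p)))"
    using L2_norm_triangle_diff[OF L2_diff[OF mult_R2_L2(1)[OF g] mult_R2_L2(1)[OF g']]
        L2_scale[OF mult_R2_L2(1)[OF sum3_L2(1)[OF L2_lin[OF u u']]]], of "of_real \<mu>"]
    unfolding L2_norm_scale norm_of_real .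
  also have "\<dots> \<le> (1 / d * G f + 1 / d * G f') + \<bar>\<mu>\<bar> * (1 / d * (3 * L2_norm haar (\<lambda>p. ?u p - ?u' p)))"
  proof (intro add_mono mult_left_mono)
    show "L2_norm haar_sq (\<lambda>x. mult_fun R2 g x - mult_fun R2 g' x) \<le> 1 / d * G f + 1 / d * G f'"
      using L2_norm_triangle_diff[OF mult_R2_L2(1)[OF g] mult_R2_L2(1)[OF g']]
        mult_R2_L2(2)[OF g] mult_R2_L2(2)[OF g'] unfolding G_def g_def g'_def by linarith
    have "L2_norm haar_sq (sum3 K (\<lambda>p. 1 * ?u p + (-1) * ?u' p)) \<le> 3 * L2_norm haar (\<lambda>p. ?u p - ?u' p)"
      using sum3_L2(2)[OF L2_lin[OF u u', of 1 "-1"], of K] by simp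
    then show "L2_norm haar_sq (mult_fun R2 (sum3 K (\<lambda>p. 1 * ?u p + (-1) * ?u' p)))
        \<le> 1 / d * (3 * L2_norm haar (\<lambda>p. ?u p - ?u' p))"
      using mult_R2_L2(2)[OF sum3_L2(1)[OF L2_lin[OF u u', of 1 "-1"], of K]] d_pos
      by (elim order_trans) (simp add: divide_right_mono)
  qed simp
  also have "\<dots> \<le> (1 / d * G f + 1 / d * G f')
      + \<bar>\<mu>\<bar> * (1 / d * (3 * (1 / \<delta> * (1 / d * (G f + G f') + 2 * \<bar>\<mu>\<bar> * e))))"
  proof -
    have "L2_norm haar (\<lambda>p. ?u p - ?u' p) \<le> 1 / \<delta> * (1 / d * (G f + G f') + 2 * \<bar>\<mu>\<bar> * e)"
      using un mult_left_mono[OF wn, of "1 / \<delta>"] \<delta> by simp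
    then show ?thesis using d_pos by (intro add_left_mono mult_left_mono) auto
  qed
  also have "\<dots> = (1 / d + 3 * \<bar>\<mu>\<bar> / (d * \<delta> * d)) * (G f + G f') + 6 * (\<bar>\<mu>\<bar> * \<bar>\<mu>\<bar>) / (d * \<delta>) * e"
    using d_pos \<delta> by (simp add: field_simps)
  finally show ?thesis by (simp add: power2_eq_square)
qed

text \<open>Bounded sequences of marginals are mapped by \<open>RI\<close> to equicontinuous ones, so Arzela--Ascoli
  applies to the right-hand side of the Faddeev equation.\<close>

lemma relatively_compact:
  fixes \<mu> :: real
  assumes nz: "\<And>p. 1 + \<mu> * r p \<noteq> 0"
  shows "symmetric_operator.relatively_compact_at haar_sq (L2_sym K) (H_op \<mu> K) (of_real z)"
proof -
  interpret symmetric_operator haar_sq "L2_sym K" "H_op \<mu> K" "6 * CARD('n) + 3 * \<bar>\<mu>\<bar>"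
    by (rule symmetric_operator_H_op)
  \<comment> \<open>The torus is half-open; its closed cube is compact, as needed both for a
    positive minimum of \<open>\<bar>1 + \<mu> * r p\<bar>\<close> and for Arzela-Ascoli.\<close>
  let ?B = "cbox (- (\<chi> i. pi)) (\<chi> i. pi) :: (real ^ 'n) set"
  have tB: "torus \<subseteq> ?B" by (auto simp: torus_def mem_box_cart less_imp_le)
  obtain \<delta> where \<delta>: "0 < \<delta>" "\<And>p. p \<in> torus \<Longrightarrow> \<delta> \<le> \<bar>1 + \<mu> * r p\<bar>"
  proof -
    have "continuous_on ?B (\<lambda>p. \<bar>1 + \<mu> * r p\<bar>)" by (intro continuous_intros continuous_r)
    moreover have "?B \<noteq> {}" using tB wrap_in_torus by blast
    ultimately obtain p0 where "\<And>p. p \<in> ?B \<Longrightarrow> \<bar>1 + \<mu> * r p0\<bar> \<le> \<bar>1 + \<mu> * r p\<bar>"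
      using continuous_attains_inf[of ?B "\<lambda>p. \<bar>1 + \<mu> * r p\<bar>"] compact_cbox by blast
    then show ?thesis using that[of "\<bar>1 + \<mu> * r p0\<bar>"] nz tB by auto
  qed
  show ?thesis
    unfolding relatively_compact_at_def
  proof (intro allI impI)
    fix s assume s: "\<forall>n. s n \<in> L2_sym K \<and> L2_norm haar_sq (s n) = 1"
      and lim: "(\<lambda>n. L2_norm haar_sq (Tz (of_real z) (s n))) \<longlonglongrightarrow> 0"
    define G where "G n = L2_norm haar_sq (\<lambda>x. H_form \<mu> K (s n) x - of_real z * s n x)" for n
    have sV: "s n \<in> L2_sym K" and s1: "L2_norm haar_sq (s n) = 1" and s2: "s n \<in> L2 haar_sq" for n
      using s L2_symD(1) by auto
    have limG: "G \<longlonglongrightarrow> 0" using lim unfolding Tz_norm[OF sV] G_def[abs_def] .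
    have u: "marginal (s n) \<in> L2 haar" "L2_norm haar (marginal (s n)) \<le> 1" for n
      using marginal_L2[OF s2[of n]] s1[of n] by auto
    have u1: "(\<integral>q. cmod (marginal (s n) q) \<partial>haar) \<le> 1" for n
      using haar.L2_norm1_le(2)[OF u(1)] u(2) order_trans by blast
    define L where "L = 2 * CARD('n) / d\<^sup>2"
    have L: "0 < L" using d_pos by (simp add: L_def)
    obtain g k where k: "strict_mono (k :: nat \<Rightarrow> nat)"
      and conv: "\<And>e. 0 < e \<Longrightarrow> \<exists>N. \<forall>n x. n \<ge> N \<and> x \<in> ?B \<longrightarrow> norm (RI (marginal (s (k n))) x - g x) < e"
    proof (rule Arzela_Ascoli[of ?B "\<lambda>n. RI (marginal (s n))" "1 / d"])
      show "norm (RI (marginal (s n)) x) \<le> 1 / d" for n x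
        using RI_bound[OF u(1), of n x] mult_left_mono[OF u1[of n], of "1 / d"] d_pos by simp
      fix x :: "real ^ 'n" and e :: real assume "0 < e"
      show "\<exists>d>0. \<forall>n y. y \<in> ?B \<and> norm (x - y) < d \<longrightarrow>
          norm (RI (marginal (s n)) x - RI (marginal (s n)) y) < e"
      proof (intro exI[of _ "e / L"] conjI allI impI)
        show "0 < e / L" using \<open>0 < e\<close> L by simp
        fix n y assume "y \<in> ?B \<and> norm (x - y) < e / L"
        then have "L * norm (x - y) < e" using L by (simp add: field_simps)
        moreover have "L * norm (x - y) * L2_norm haar (marginal (s n)) \<le> L * norm (x - y) * 1"
          using u(2)[of n] L by (intro mult_left_mono) auto
        moreover have "norm (RI (marginal (s n)) x - RI (marginal (s n)) y)
            \<le> L * norm (x - y) * L2_norm haar (marginal (s n))"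
          using RI_lipschitz[OF u(1), of n x y] unfolding L_def .
        ultimately show "norm (RI (marginal (s n)) x - RI (marginal (s n)) y) < e" by simp
      qed
    qed (use compact_cbox in auto)
    define A where "A = 1 / d + 3 * \<bar>\<mu>\<bar> / (d * \<delta> * d)"
    define C' where "C' = 6 * \<mu>\<^sup>2 / (d * \<delta>)"
    have A: "0 < A" using d_pos \<delta>(1) by (auto simp: A_def intro!: add_pos_nonneg)
    have C': "0 \<le> C'" using d_pos \<delta>(1) by (simp add: C'_def)
    have "L2_Cauchy haar_sq (s \<circ> k)"
      unfolding L2_Cauchy_def
    proof (intro allI impI)
      fix e :: real assume e: "0 < e"
      \<comment> \<open>Two members of the sequence differ by at most \<open>2 * e'\<close> through
        the uniform limit \<open>g\<close>. The \<open>+ 1\<close> keeps the denominator positive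
        when \<open>C'\<close> is zero and the final inequality strict.\<close>
      define e' where "e' = e / (4 * (C' + 1))"
      have e': "0 < e'" using e C' by (simp add: e'_def)
      obtain N1 where N1: "\<And>n x. n \<ge> N1 \<Longrightarrow> x \<in> ?B \<Longrightarrow> norm (RI (marginal (s (k n))) x - g x) < e'"
        using conv[OF e'] by blast
      have "eventually (\<lambda>n. G n < e / (4 * A)) sequentially"
        using order_tendstoD(2)[OF limG] e A by simp
      then obtain N2 where N2: "\<And>n. n \<ge> N2 \<Longrightarrow> G n < e / (4 * A)"
        by (auto simp: eventually_sequentially)
      have "L2_norm haar_sq (\<lambda>x. (s \<circ> k) m x - (s \<circ> k) n x) < e"
        if "max N1 N2 \<le> m" "max N1 N2 \<le> n" for m n
      proof -
        have close: "cmod (RI (marginal (s (k m))) p - RI (marginal (s (k n))) p) \<le> 2 * e'" if "p \<in> torus" for p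
          using N1[of m p] N1[of n p] that tB \<open>max N1 N2 \<le> m\<close> \<open>max N1 N2 \<le> n\<close>
            norm_triangle_ineq4[of "RI (marginal (s (k m))) p - g p" "RI (marginal (s (k n))) p - g p"]
          by auto
        have "L2_norm haar_sq (\<lambda>x. s (k m) x - s (k n) x) \<le> A * (G (k m) + G (k n)) + C' * (2 * e')"
          unfolding A_def C'_def G_def
          by (rule faddeev_difference_bound[OF s2 s2 \<delta> _ close]) (use e' in auto)
        also have "\<dots> \<le> A * (e / (4 * A) + e / (4 * A)) + C' * (2 * e')"
          using N2[of "k m"] N2[of "k n"] seq_suble[OF k, of m] seq_suble[OF k, of n] that A
          by (intro add_right_mono mult_left_mono add_mono) auto
        also have "A * (e / (4 * A) + e / (4 * A)) = e / 2" using A by (simp add: field_simps)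
        also have "C' * (2 * e') = e / 2 * (C' / (C' + 1))" using C' by (simp add: e'_def field_simps)
        also have "e / 2 + e / 2 * (C' / (C' + 1)) < e / 2 + e / 2 * 1"
          using e C' by (intro add_strict_left_mono mult_strict_left_mono) auto
        finally show ?thesis by simp
      qed
      then show "\<exists>N. \<forall>m\<ge>N. \<forall>n\<ge>N. L2_norm haar_sq (\<lambda>x. (s \<circ> k) m x - (s \<circ> k) n x) < e" by blast
    qed
    then show "\<exists>r. strict_mono r \<and> L2_Cauchy haar_sq (s \<circ> r)" using k by blast
  qed
qed

end

section \<open>The essential spectrum\<close>

text \<open>Here \<open>s\<close> will be the norm of \<open>u\<close>, \<open>t\<close> that of the
  error \<open>w\<close>, and \<open>a = 3 * \<bar>\<mu>\<bar>\<close>. The last hypothesis is what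
  a lower bound \<open>c\<close> would force on the trial function.\<close>

lemma small_defect_contradiction:
  fixes c a s t :: real
  assumes "0 < s" "0 < c" "0 \<le> a" "t \<le> c / (2 * (c + a)) * s" and "c * (s - t) \<le> a * t"
  shows False
proof -
  have "c * s \<le> (c + a) * t" using assms(5) by (simp add: algebra_simps)
  also have "\<dots> \<le> (c + a) * (c / (2 * (c + a)) * s)" using assms by (intro mult_left_mono) auto
  also have "\<dots> = c * s / 2"
  proof -
    have half: "y * (c / (2 * y) * s) = c * s / 2" if "y \<noteq> 0" for y :: real using that by simp
    show ?thesis by (rule half) (use assms(2,3) in linarith)
  qed
  finally show False using assms by (simp add: mult_pos_pos)
qed

text \<open>Trial function \<open>f(p, q) = -\<mu> R(p, q) (u(p) + u(q) + u(K - p - q))\<close>, with \<open>u\<close> the indicator of a small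
  neighbourhood of \<open>p0\<close>: its marginal is \<open>u - w\<close> with \<open>w\<close> small compared to \<open>u\<close>, and
  \<open>(H - z) f\<close> only involves \<open>w\<close>.\<close>

lemma (in resolvent_gap) not_bounded_below_of_zero:
  fixes \<mu> :: real
  assumes p0: "p0 \<in> torus" and zero: "1 + \<mu> * r p0 = 0"
  shows "\<not> symmetric_operator.bounded_below haar_sq (L2_sym K) (H_op \<mu> K) (of_real z)"
proof
  interpret symmetric_operator haar_sq "L2_sym K" "H_op \<mu> K" "6 * CARD('n) + 3 * \<bar>\<mu>\<bar>"
    by (rule symmetric_operator_H_op)
  assume "bounded_below (of_real z)"
  then obtain c where c: "0 < c" "\<And>f. f \<in> L2_sym K \<Longrightarrow> c * L2_norm haar_sq f \<le> L2_norm haar_sq (Tz (of_real z) f)"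
    unfolding bounded_below_def by blast
  \<comment> \<open>The ratio of error to \<open>u\<close> demanded by
    \<open>small_defect_contradiction\<close> with \<open>a = 3 * \<bar>\<mu>\<bar>\<close>.\<close>
  define \<theta> where "\<theta> = c / (2 * (c + 3 * \<bar>\<mu>\<bar>))"
  have \<theta>: "0 < \<theta>" using c(1) by (auto simp: \<theta>_def intro!: divide_pos_pos add_pos_nonneg)
  \<comment> \<open>An upper bound for the norm of \<open>u\<close> under which the integral part of
    \<open>w\<close> stays below \<open>\<theta> / 2\<close> times that norm; the other half is left
    to \<open>1 + \<mu> * r\<close>.\<close>
  define \<kappa> where "\<kappa> = \<theta> * d / (4 * (\<bar>\<mu>\<bar> + 1))"
  have \<kappa>: "0 < \<kappa>" using \<theta> d_pos by (auto simp: \<kappa>_def intro!: divide_pos_pos)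
  obtain \<rho> where \<rho>: "0 < \<rho>" "measure haar {p \<in> torus. \<epsilon> (p - p0) < \<rho>} < \<kappa>\<^sup>2"
    using small_eps_nbhd[of "\<kappa>\<^sup>2" p0] \<kappa> by auto
  define U where "U = {p. \<bar>1 + \<mu> * r p\<bar> < \<theta> / 2} \<inter> {p. \<epsilon> (p - p0) < \<rho>}"
  have U: "open U"
    unfolding U_def by (intro open_Int open_Collect_less continuous_intros continuous_r)
  have p0U: "p0 \<in> U" using zero \<theta> \<rho>(1) by (simp add: U_def \<epsilon>_def)
  define N where "N = U \<inter> torus"
  have N: "N \<in> sets haar" using U by (auto simp: N_def sets_haar_iff)
  have "0 < emeasure haar N" unfolding N_def by (rule emeasure_haar_open_pos[OF U p0U p0])
  then have mpos: "0 < measure haar N" by (simp add: haar.emeasure_eq_measure)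
  have "measure haar N \<le> measure haar {p \<in> torus. \<epsilon> (p - p0) < \<rho>}"
    by (rule haar.finite_measure_mono[OF _ eps_nbhd_sets]) (auto simp: N_def U_def)
  then have msmall: "measure haar N < \<kappa>\<^sup>2" using \<rho>(2) by linarith
  define u where "u = (\<lambda>q. complex_of_real (indicat_real N q))"
  note u = haar_indicator_L2[OF N, folded u_def]
  have u3: "(\<integral>q. cmod (u q) \<partial>haar) = measure haar N"
    unfolding u_def by (rule haar_indicator_L2(3)[OF N])
  define s where "s = L2_norm haar u"
  have s2: "s\<^sup>2 = measure haar N" unfolding s_def by (rule u(2))
  have "s\<^sup>2 < \<kappa>\<^sup>2" "s \<noteq> 0" using mpos msmall s2 by auto
  then have s: "0 < s" "s < \<kappa>"
    using \<kappa> power2_less_imp_less[of s \<kappa>] L2_norm_nonneg[of haar u] by (auto simp: s_def less_le)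
  define w where "w p = of_real (1 + \<mu> * r p) * u p + 2 * of_real \<mu> * RI u p" for p
  have w1: "(\<lambda>p. of_real (1 + \<mu> * r p) * u p) \<in> L2 haar"
      "L2_norm haar (\<lambda>p. of_real (1 + \<mu> * r p) * u p) \<le> \<theta> / 2 * s"
  proof -
    have "(\<lambda>p. 1 + \<mu> * r p) \<in> borel_measurable haar"
      by (intro measurable_haar1 borel_measurable_continuous_onI continuous_intros continuous_r)
    then have m: "(\<lambda>p. of_real (1 + \<mu> * r p) * u p) \<in> borel_measurable haar"
      using L2_measurable[OF u(1)] by measurable
    have "cmod (of_real (1 + \<mu> * r p) * u p) \<le> \<theta> / 2 * cmod (u p)" for p
    proof (cases "p \<in> N")
      case True
      then show ?thesis unfolding norm_mult norm_of_real by (simp add: N_def U_def u_def)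
    qed (simp add: u_def)
    then show "(\<lambda>p. of_real (1 + \<mu> * r p) * u p) \<in> L2 haar"
      "L2_norm haar (\<lambda>p. of_real (1 + \<mu> * r p) * u p) \<le> \<theta> / 2 * s"
      unfolding s_def using L2_dominated[OF u(1) m, of "\<theta> / 2"] \<theta> by auto
  qed
  \<comment> \<open>For an indicator the integral is the square of the norm, so \<open>RI u\<close>
    is of second order in \<open>s\<close> and negligible beside \<open>u\<close> once
    \<open>N\<close> is small.\<close>
  have RIn: "L2_norm haar (RI u) \<le> 1 / d * s\<^sup>2"
  proof -
    have "cmod (RI u p) \<le> 1 / d * s\<^sup>2" for p
      using RI_bound[OF u(1), of p] unfolding u3 s2 .
    then show ?thesis
      using L2_dominated(2)[OF haar.L2_const(1)[of 1] L2_measurable[OF RI_L2[OF u(1)]], of "1 / d * s\<^sup>2"] d_pos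
      by (simp add: haar.L2_const(2))
  qed
  have w: "w \<in> L2 haar" unfolding w_def[abs_def] by (intro L2_add w1 L2_scale RI_L2 u)
  have wn: "L2_norm haar w \<le> \<theta> * s"
  proof -
    have "L2_norm haar w \<le> L2_norm haar (\<lambda>p. of_real (1 + \<mu> * r p) * u p) + L2_norm haar (\<lambda>p. 2 * of_real \<mu> * RI u p)"
      unfolding w_def[abs_def] by (rule L2_norm_triangle[OF w1(1) L2_scale[OF RI_L2[OF u(1)]]])
    also have "L2_norm haar (\<lambda>p. 2 * of_real \<mu> * RI u p) = 2 * \<bar>\<mu>\<bar> * L2_norm haar (RI u)"
      unfolding L2_norm_scale by (simp add: norm_mult)
    also have "\<dots> \<le> 2 * \<bar>\<mu>\<bar> * (1 / d * s\<^sup>2)" by (intro mult_left_mono RIn) simp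
    also have "\<dots> \<le> 2 * \<bar>\<mu>\<bar> * (1 / d * (\<kappa> * s))"
      using s d_pos by (intro mult_left_mono) (auto simp: power2_eq_square)
    also have "\<dots> = \<theta> / 2 * (\<bar>\<mu>\<bar> / (\<bar>\<mu>\<bar> + 1)) * s"
      using d_pos by (simp add: \<kappa>_def field_simps)
    also have "\<dots> \<le> \<theta> / 2 * 1 * s"
      using s \<theta> by (intro mult_right_mono mult_left_mono) auto
    finally show ?thesis using w1(2) by simp
  qed
  define f where "f = (\<lambda>x. (- of_real \<mu>) * mult_fun R2 (sum3 K u) x)"
  have fL2: "f \<in> L2 haar_sq"
    unfolding f_def by (rule L2_scale[OF mult_R2_L2(1)[OF sum3_L2(1)[OF u(1)]]])
  have f: "f \<in> L2_sym K"
  proof (rule L2_symI[OF fL2])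
    show "AE x in haar_sq. f x = f (snd x, fst x)"
      by (auto simp: f_def mult_fun_def R_swap[of "snd _"] sum3_swap[of K _ "snd _"])
    show "AE x in haar_sq. f x = f (fst x, wrap (K - fst x - snd x))"
      by (rule AE_I2) (auto simp: f_def mult_fun_def R_third sum3_third space_haar_sq)
  qed
  have mf: "marginal f = (\<lambda>p. 1 * u p + (-1) * w p)"
  proof (rule ext)
    fix p
    have "marginal f p = (- of_real \<mu>) * marginal (mult_fun R2 (sum3 K u)) p"
      unfolding marginal_def f_def by (rule integral_mult_right_zero)
    then show "marginal f p = 1 * u p + (-1) * w p"
      unfolding marginal_R_sum3[OF u(1)] w_def by (simp add: algebra_simps)
  qed
  have Hf: "H_form \<mu> K f x - of_real z * f x = (- of_real \<mu>) * sum3 K w x" for x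
  proof -
    have "of_real (E3 K x - z) * f x = (- of_real \<mu>) * (of_real ((E3 K x - z) * R2 x) * sum3 K u x)"
      unfolding f_def mult_fun_def of_real_mult by (simp only: mult_ac)
    also have "(E3 K x - z) * R2 x = 1" using gap_nonzero by (simp add: R_def)
    finally have "of_real (E3 K x) * f x - of_real z * f x = (- of_real \<mu>) * sum3 K u x"
      by (simp add: left_diff_distrib)
    then show ?thesis
      unfolding H_form_def mult_fun_def mf sum3_lin by (simp add: algebra_simps)
  qed
  have "L2_norm haar_sq (Tz (of_real z) f) = \<bar>\<mu>\<bar> * L2_norm haar_sq (sum3 K w)"
    unfolding Tz_norm[OF f] Hf L2_norm_scale by simp
  also have "\<dots> \<le> \<bar>\<mu>\<bar> * (3 * L2_norm haar w)" by (intro mult_left_mono sum3_L2 w) simp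
  finally have up: "L2_norm haar_sq (Tz (of_real z) f) \<le> 3 * \<bar>\<mu>\<bar> * L2_norm haar w" by simp
  \<comment> \<open>A lower bound for \<open>f\<close> itself: its marginal is \<open>u - w\<close>,
    and taking marginals does not increase the norm.\<close>
  have "s \<le> L2_norm haar (marginal f) + L2_norm haar w"
    using L2_norm_triangle[OF marginal_L2(1)[OF fL2] w] unfolding mf s_def by simp
  then have "s - L2_norm haar w \<le> L2_norm haar_sq f" using marginal_L2(2)[OF fL2] by linarith
  then have "c * (s - L2_norm haar w) \<le> 3 * \<bar>\<mu>\<bar> * L2_norm haar w"
    using c(2)[OF f] up mult_left_mono[of "s - L2_norm haar w" "L2_norm haar_sq f" c] c(1) by linarith
  then show False
    using small_defect_contradiction[of s c "3 * \<bar>\<mu>\<bar>" "L2_norm haar w"] s c(1) wn unfolding \<theta>_def by simp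
qed

section \<open>Points of the three-particle interval\<close>

lemma convex_torus: "convex (torus :: (real ^ 'n) set)"
proof (rule convexI)
  fix x y :: "real ^ 'n" and u v :: real
  assume xy: "x \<in> torus" "y \<in> torus" and uv: "0 \<le> u" "0 \<le> v" "u + v = 1"
  have "u *\<^sub>R (x $ i) + v *\<^sub>R (y $ i) \<in> {- pi<..pi}" for i
    by (rule convexD[OF convex_real_interval(6)]) (use xy uv in \<open>auto simp: torus_def\<close>)
  then show "u *\<^sub>R x + v *\<^sub>R y \<in> torus" by (auto simp: torus_def)
qed

lemma connected_torus: "connected (torus :: (real ^ 'n) set)"
  by (rule convex_connected[OF convex_torus])

text \<open>The half-open torus is not compact, so attainment of the bounds is avoided: values close
  to both ends exist, and the range of the energy is connected. Approximation is all that the trial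
  functions require.\<close>

lemma E_three_approx:
  fixes K :: "real ^ 'n"
  assumes z: "z \<in> {E_min K..E_max K}" and e: "0 < e"
  obtains p q where "p \<in> torus" "q \<in> torus" "\<bar>E_three K p q - z\<bar> < e"
proof -
  define I where "I = (\<lambda>(p, q). E_three K p q) ` (torus \<times> torus)"
  have ne: "(torus \<times> torus :: ((real ^ 'n) \<times> (real ^ 'n)) set) \<noteq> {}" using wrap_in_torus by blast
  have "\<exists>x\<in>I. x < z + e"
  proof -
    have "Inf I < z + e" using z e unfolding I_def E_min_def by simp
    then show ?thesis using cInf_lessD[of I] ne unfolding I_def by blast
  qed
  moreover have "\<exists>y\<in>I. z - e < y"
  proof -
    have "z - e < Sup I" using z e unfolding I_def E_max_def by simp
    then show ?thesis using less_cSupD[of I] ne unfolding I_def by blast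
  qed
  ultimately obtain x y where xy: "x \<in> I" "y \<in> I" "x < z + e" "z - e < y" by blast
  have "connected I"
    unfolding I_def case_prod_beta
    by (intro connected_continuous_image connected_Times connected_torus continuous_intros)
  then have "z \<in> I" if "x \<le> z" "z \<le> y"
    using connected_contains_Icc[of I x y] xy that by auto
  then have "\<exists>v\<in>I. \<bar>v - z\<bar> < e"
  proof (cases "x \<le> z \<and> z \<le> y")
    case False
    then show ?thesis using xy by (cases "x \<le> z") (auto intro: bexI[of _ y] bexI[of _ x])
  qed (use e in \<open>auto intro: bexI[of _ z]\<close>)
  then show ?thesis using that unfolding I_def by auto
qed

text \<open>Trial function: the indicator of a symmetric set of pairs with energy near \<open>z\<close> all of whose
  momenta lie in \<open>N\<close>. A small \<open>N\<close> makes its marginal negligible, whatever the size of the set.\<close>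

lemma not_bounded_below_interval:
  fixes K :: "real ^ 'n" and \<mu> :: real
  assumes z: "z \<in> {E_min K..E_max K}"
  shows "\<not> symmetric_operator.bounded_below haar_sq (L2_sym K) (H_op \<mu> K) (of_real z)"
proof
  interpret symmetric_operator haar_sq "L2_sym K" "H_op \<mu> K" "6 * CARD('n) + 3 * \<bar>\<mu>\<bar>"
    by (rule symmetric_operator_H_op)
  assume "bounded_below (of_real z)"
  then obtain c where c: "0 < c" "\<And>f. f \<in> L2_sym K \<Longrightarrow> c * L2_norm haar_sq f \<le> L2_norm haar_sq (Tz (of_real z) f)"
    unfolding bounded_below_def by blast
  obtain p0 q0 where pq: "p0 \<in> torus" "q0 \<in> torus" "\<bar>E_three K p0 q0 - z\<bar> < c / 2"
    using E_three_approx[OF z, of "c / 2"] c(1) by auto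
  \<comment> \<open>The interaction then contributes at most
    \<open>3 * \<bar>\<mu>\<bar> * \<kappa> \<le> 3 / 8 * c\<close>, which together with
    \<open>c / 2\<close> from the energy stays below \<open>c\<close>.\<close>
  define \<kappa> where "\<kappa> = c / (8 * (\<bar>\<mu>\<bar> + 1))"
  have \<kappa>: "0 < \<kappa>" using c(1) by (auto simp: \<kappa>_def intro!: divide_pos_pos)
  define a where "a = (\<lambda>i::nat. if i = 0 then p0 else if i = 1 then q0 else K - p0 - q0)"
  have "\<exists>\<rho>. 0 < \<rho> \<and> measure haar {p \<in> torus. \<epsilon> (p - a i) < \<rho>} < \<kappa>\<^sup>2 / 3" for i
  proof -
    have "0 < \<kappa>\<^sup>2 / 3" using \<kappa> by simp
    then show ?thesis by (rule small_eps_nbhd[of _ "a i"]) (intro exI conjI)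
  qed
  then have "\<exists>\<rho>. \<forall>i. 0 < \<rho> i \<and> measure haar {p \<in> torus. \<epsilon> (p - a i) < \<rho> i} < \<kappa>\<^sup>2 / 3"
    by (intro choice allI)
  then obtain \<rho> where "\<forall>i. 0 < \<rho> i \<and> measure haar {p \<in> torus. \<epsilon> (p - a i) < \<rho> i} < \<kappa>\<^sup>2 / 3"
    by (rule exE)
  then have \<rho>: "0 < \<rho> i" "measure haar {p \<in> torus. \<epsilon> (p - a i) < \<rho> i} < \<kappa>\<^sup>2 / 3" for i
    by simp_all
  \<comment> \<open>One neighbourhood for each of the three momenta, each with a third of the
    allowed measure. Their union, rather than a product, permits every momentum to be near any of
    the three centres and so makes the set permutation-invariant.\<close>
  define A where "A p \<longleftrightarrow> (\<exists>i<3. \<epsilon> (p - a i) < \<rho> i)" for p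
  have A_wrap: "A (wrap p) \<longleftrightarrow> A p" for p
  proof -
    have "\<epsilon> (wrap p - a i) = \<epsilon> (p - a i)" for i
      using wrap_diff_wrap[of "a i" p] eps_cong_wrap[of "a i - wrap p" "a i - p"]
        eps_minus[of "a i - wrap p"] eps_minus[of "a i - p"] by simp
    then show ?thesis by (simp add: A_def)
  qed
  have A_open: "open {x. A (f x)}" if "continuous_on UNIV f" for f :: "(real ^ 'n) \<times> (real ^ 'n) \<Rightarrow> real ^ 'n"
  proof -
    have "{x. A (f x)} = (\<Union>i\<in>{..<3}. {x. \<epsilon> (f x - a i) < \<rho> i})" by (auto simp: A_def)
    also have "open \<dots>" by (intro open_UN ballI open_Collect_less continuous_intros that)
    finally show ?thesis .
  qed
  define N where "N = {p \<in> torus. A p}"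
  have N_eq: "N = (\<Union>i\<in>{..<3}. {p \<in> torus. \<epsilon> (p - a i) < \<rho> i})" by (auto simp: N_def A_def)
  have N: "N \<in> sets haar" unfolding N_eq using eps_nbhd_sets by blast
  have "measure haar N \<le> (\<Sum>i<3. measure haar {p \<in> torus. \<epsilon> (p - a i) < \<rho> i})"
    unfolding N_eq by (rule haar.finite_measure_subadditive_finite) (use eps_nbhd_sets in auto)
  also have "\<dots> \<le> (\<Sum>i<(3::nat). \<kappa>\<^sup>2 / 3)" by (intro sum_mono less_imp_le \<rho>)
  finally have mN: "measure haar N \<le> \<kappa>\<^sup>2" by simp
  define U where "U = {x. \<bar>E3 K x - z\<bar> < c / 2} \<inter> {x. A (fst x)} \<inter> {x. A (snd x)} \<inter> {x. A (K - fst x - snd x)}"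
  have U: "open U"
    unfolding U_def by (intro open_Int A_open open_Collect_less continuous_intros)
  have e0: "\<epsilon> (0 :: real ^ 'n) = 0" by (simp add: \<epsilon>_def)
  have A0: "A (a i)" if "i < 3" for i using that \<rho>(1)[of i] e0 by (auto simp: A_def intro!: exI[of _ i])
  have inU: "(p0, q0) \<in> U"
    using A0[of 0] A0[of 1] A0[of 2] pq(3) by (simp add: U_def a_def)
  define W where "W = U \<inter> torus \<times> torus"
  have W: "W \<in> sets haar_sq"
  proof -
    have "(\<lambda>x. x) \<in> measurable haar_sq borel" by (rule measurable_haar_pair1) simp
    from measurable_sets[OF this, of U] show ?thesis using U by (simp add: space_haar_sq W_def)
  qed
  have Wpos: "0 < emeasure haar_sq W"
    unfolding W_def by (rule emeasure_haar_sq_open_pos[OF U inU pq(1,2)])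
  have W_swap: "(q, p) \<in> W \<longleftrightarrow> (p, q) \<in> W" for p q
  proof -
    have "A (K - q - p) = A (K - p - q)" by (rule arg_cong[where f=A]) simp
    then show ?thesis by (auto simp: W_def U_def E_three_swap[of K q p])
  qed
  have W_third: "(p, wrap (K - p - q)) \<in> W \<longleftrightarrow> (p, q) \<in> W" if "q \<in> torus" for p q
  proof -
    have "A (K - p - wrap (K - p - q)) \<longleftrightarrow> A q"
      using A_wrap[of "K - p - wrap (K - p - q)"] by (simp only: wrap_involution[OF that])
    then show ?thesis using that by (auto simp: W_def U_def E_three_third A_wrap wrap_in_torus)
  qed
  define f where "f = (\<lambda>x. complex_of_real (indicat_real W x))"
  have fm: "f \<in> borel_measurable haar_sq" using W by (simp add: f_def)
  have fL2: "f \<in> L2 haar_sq"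
    by (rule L2_dominated(1)[OF haar2.L2_const(1)[of 1] fm, where c=1]) (auto simp: f_def indicator_def)
  have f: "f \<in> L2_sym K"
  proof (rule L2_symI[OF fL2])
    show "AE x in haar_sq. f x = f (snd x, fst x)"
      by (auto simp: f_def indicator_def W_swap)
    show "AE x in haar_sq. f x = f (fst x, wrap (K - fst x - snd x))"
      by (rule AE_I2) (auto simp: f_def indicator_def W_third space_haar_sq)
  qed
  have fpos: "0 < L2_norm haar_sq f"
  proof (rule ccontr)
    assume "\<not> 0 < L2_norm haar_sq f"
    then have "L2_norm haar_sq f = 0" using L2_norm_nonneg[of haar_sq f] by linarith
    then have "AE x in haar_sq. f x = 0" using L2_norm_eq_0_iff[OF fL2] by simp
    then have "AE x in haar_sq. x \<notin> W"
      by eventually_elim (auto simp: f_def indicator_def split: if_splits)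
    then have "emeasure haar_sq W = 0" using AE_iff_measurable[OF W, of "\<lambda>x. x \<notin> W"]
      sets.sets_into_space[OF W] by auto
    then show False using Wpos by simp
  qed
  have "(L2_norm haar (marginal f))\<^sup>2 \<le> measure haar N * (L2_norm haar_sq f)\<^sup>2"
    by (rule L2_norm_marginal_support(2)[OF fL2 N])
      (auto simp: f_def indicator_def W_def U_def N_def)
  also have "\<dots> \<le> \<kappa>\<^sup>2 * (L2_norm haar_sq f)\<^sup>2" by (rule mult_right_mono[OF mN]) simp
  finally have mf2: "(L2_norm haar (marginal f))\<^sup>2 \<le> (\<kappa> * L2_norm haar_sq f)\<^sup>2"
    unfolding power_mult_distrib .
  have mf: "L2_norm haar (marginal f) \<le> \<kappa> * L2_norm haar_sq f"
    by (rule power2_le_imp_le[OF mf2]) (use \<kappa> in simp)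
  define g where "g = (\<lambda>x. of_real (E3 K x - z) * f x)"
  have gm: "g \<in> borel_measurable haar_sq"
    unfolding g_def using fm E3_measurable[of K] by measurable
  have gb: "AE x in haar_sq. cmod (g x) \<le> c / 2 * cmod (f x)"
    by (rule AE_I2) (auto simp: g_def f_def norm_mult indicator_def W_def U_def less_imp_le simp del: of_real_diff)
  note g = L2_dominated[OF fL2 gm _ gb]
  have S: "sum3 K (marginal f) \<in> L2 haar_sq" "L2_norm haar_sq (sum3 K (marginal f)) \<le> 3 * L2_norm haar (marginal f)"
    by (rule sum3_L2[OF marginal_L2(1)[OF fL2]])+
  have "L2_norm haar_sq (Tz (of_real z) f) = L2_norm haar_sq (\<lambda>x. g x + of_real \<mu> * sum3 K (marginal f) x)"
  proof (rule L2_norm_cong_AE)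
    show "Tz (of_real z) f \<in> borel_measurable haar_sq" by (rule V_measurable[OF Tz_V[OF f]])
    show "(\<lambda>x. g x + of_real \<mu> * sum3 K (marginal f) x) \<in> borel_measurable haar_sq"
      using gm L2_measurable[OF S(1)] by measurable
    show "AE x in haar_sq. Tz (of_real z) f x = g x + of_real \<mu> * sum3 K (marginal f) x"
      using H_op_eq[OF f, of \<mu>]
      by eventually_elim (simp add: Tz_def g_def H_form_def mult_fun_def algebra_simps)
  qed
  also have "\<dots> \<le> L2_norm haar_sq g + \<bar>\<mu>\<bar> * L2_norm haar_sq (sum3 K (marginal f))"
    using L2_norm_triangle[OF g(1) L2_scale[OF S(1)], of "of_real \<mu>"] c(1) by (simp add: L2_norm_scale)
  also have "\<dots> \<le> c / 2 * L2_norm haar_sq f + \<bar>\<mu>\<bar> * (3 * (\<kappa> * L2_norm haar_sq f))"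
    using g(2) S(2) mf c(1) by (intro add_mono mult_left_mono) auto
  also have "\<dots> = (c / 2 + 3 / 8 * c * (\<bar>\<mu>\<bar> / (\<bar>\<mu>\<bar> + 1))) * L2_norm haar_sq f"
    by (simp add: \<kappa>_def field_simps)
  also have "\<dots> < c * L2_norm haar_sq f"
  proof (rule mult_strict_right_mono[OF _ fpos])
    have "3 / 8 * c * (\<bar>\<mu>\<bar> / (\<bar>\<mu>\<bar> + 1)) \<le> 3 / 8 * c * 1" using c(1) by (intro mult_left_mono) auto
    then show "c / 2 + 3 / 8 * c * (\<bar>\<mu>\<bar> / (\<bar>\<mu>\<bar> + 1)) < c" using c(1) by linarith
  qed
  finally show False using c(2)[OF f] by simp
qed

text \<open>The function \<open>r\<close> of \<open>resolvent_gap\<close> with \<open>z\<close> as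
  an argument, so that its dependence on the spectral parameter can be studied.\<close>

definition fiber_int :: "real ^ 'n \<Rightarrow> real \<Rightarrow> real ^ 'n \<Rightarrow> real" where
  "fiber_int K z p = (\<integral>q. 1 / (E_three K p q - z) \<partial>haar)"

lemma E_three_section_measurable: "E_three K p \<in> borel_measurable haar"
proof -
  have "(\<lambda>q. E_three K p q) \<in> borel_measurable haar"
    by (intro measurable_haar1 borel_measurable_continuous_onI continuous_intros)
  then show ?thesis .
qed

text \<open>Separation of the spectator boson: it carries \<open>K - k\<close>, and the remaining
  pair has total momentum \<open>k\<close> and relative coordinate \<open>q\<close>.\<close>

lemma E_three_shift: "E_three K (K - k) ((1/2) *\<^sub>R k + q) = \<epsilon> (K - k) + E_two k q"
proof -
  have "K - (K - k) - ((1/2) *\<^sub>R k + q) = (1/2) *\<^sub>R k - q"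
    by (simp add: vec_eq_iff)
  then have "\<epsilon> (K - (K - k) - ((1/2) *\<^sub>R k + q)) = \<epsilon> ((1/2) *\<^sub>R k - q)" by (rule arg_cong)
  then show ?thesis unfolding E_three_def E_two_def by linarith
qed

lemma fiber_int_eq: "fiber_int K z (K - k) = (\<integral>q. 1 / (\<epsilon> (K - k) + E_two k q - z) \<partial>haar)"
proof -
  have "(\<lambda>q. 1 / (E_three K (K - k) q - z)) \<in> borel_measurable haar"
    using E_three_section_measurable[of K "K - k"] by measurable
  from integral_haar_translate[OF this, of "(1/2) *\<^sub>R k"]
  show ?thesis unfolding fiber_int_def E_three_wrap_right E_three_shift by (rule sym)
qed

lemma fiber_int_eq_two_int: "fiber_int K z (K - k) = two_int k (z - \<epsilon> (K - k))"
  unfolding fiber_int_eq two_int_def by (simp add: algebra_simps)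

lemma fiber_int_wrap: "fiber_int K z (wrap p) = fiber_int K z p"
  unfolding fiber_int_def by (simp add: E_three_wrap_left)

lemma E_min_le_shift: "E_min K \<le> \<epsilon> (K - k) + E_two k q"
  using E_min_le[of K "K - k" "(1/2) *\<^sub>R k + q"] by (simp add: E_three_shift)

lemma below_INF_E_two:
  fixes K k :: "real ^ 'n"
  assumes "z < E_min K" shows "z - \<epsilon> (K - k) < (INF p\<in>torus. E_two k p)"
proof -
  have "E_min K - \<epsilon> (K - k) \<le> (INF p\<in>torus. E_two k p)"
  proof (rule cINF_greatest)
    show "torus \<noteq> ({} :: (real ^ 'n) set)" using wrap_in_torus by blast
    show "E_min K - \<epsilon> (K - k) \<le> E_two k p" for p using E_min_le_shift[of K k p] by linarith
  qed
  then show ?thesis using assms by linarith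
qed

text \<open>The fibre integral is \<open>two_int k\<close> at \<open>z - \<epsilon> (K - k)\<close>.
  The hypothesis on \<open>z\<close> puts this argument below the minimum of \<open>E_two k\<close>,
  the range in which the zero identifies \<open>e_two\<close>.\<close>

lemma fiber_zero_iff:
  fixes K :: "real ^ 'n"
  assumes n: "CARD('n) = 1 \<or> CARD('n) = 2" and \<mu>: "\<mu> < 0" and z: "z < E_min K" and k: "k \<in> torus"
  shows "1 + \<mu> * fiber_int K z (K - k) = 0 \<longleftrightarrow> z = e_two \<mu> k + \<epsilon> (K - k)"
proof
  assume "1 + \<mu> * fiber_int K z (K - k) = 0"
  then have "z - \<epsilon> (K - k) = e_two \<mu> k"
    unfolding fiber_int_eq_two_int by (rule e_two_props(3)[OF n k \<mu> below_INF_E_two[OF z]])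
  then show "z = e_two \<mu> k + \<epsilon> (K - k)" by simp
next
  assume "z = e_two \<mu> k + \<epsilon> (K - k)"
  then show "1 + \<mu> * fiber_int K z (K - k) = 0"
    unfolding fiber_int_eq_two_int using e_two_props(2)[OF n k \<mu>] by simp
qed

text \<open>Lets an arbitrary \<open>p\<close> be treated as \<open>K - k\<close> with the
  representative \<open>k = wrap (K - p)\<close> in the torus, up to a period.\<close>

lemma fiber_int_reparam: "fiber_int K z p = fiber_int K z (K - wrap (K - p))" "\<epsilon> p = \<epsilon> (K - wrap (K - p))"
proof -
  have w: "wrap (K - wrap (K - p)) = wrap p" by (simp add: wrap_diff_wrap)
  show "fiber_int K z p = fiber_int K z (K - wrap (K - p))" using w fiber_int_wrap by metis
  show "\<epsilon> p = \<epsilon> (K - wrap (K - p))" using w eps_cong_wrap by metis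
qed

text \<open>Strictness at a single point spreads by continuity to an open set, which has positive
  measure in the torus.\<close>

lemma integral_inverse_diff_antimono_strict:
  fixes F1 F2 :: "real ^ 'n \<Rightarrow> real"
  assumes c: "continuous_on UNIV F1" "continuous_on UNIV F2" and m: "\<And>q. q \<in> torus \<Longrightarrow> m \<le> F1 q"
    and le: "\<And>q. q \<in> torus \<Longrightarrow> F1 q \<le> F2 q" and q0: "q0 \<in> torus" "F1 q0 < F2 q0" and z: "z < m"
  shows "(\<integral>q. 1 / (F2 q - z) \<partial>haar) < (\<integral>q. 1 / (F1 q - z) \<partial>haar)"
proof (rule haar.integral_less_AE)
  have meas: "F1 \<in> borel_measurable haar" "F2 \<in> borel_measurable haar"
    by (intro measurable_haar1 borel_measurable_continuous_onI c)+
  have m2: "m \<le> F2 q" if "q \<in> torus" for q using m[OF that] le[OF that] by linarith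
  show "integrable haar (\<lambda>q. 1 / (F2 q - z))" "integrable haar (\<lambda>q. 1 / (F1 q - z))"
    by (rule integral_inverse_diff_props(1)[OF meas(2) m2 z], assumption)
      (rule integral_inverse_diff_props(1)[OF meas(1) m z], assumption)
  let ?A = "{q. F1 q < F2 q} \<inter> torus"
  have o: "open {q. F1 q < F2 q}" by (intro open_Collect_less c)
  show "emeasure haar ?A \<noteq> 0" using emeasure_haar_open_pos[OF o _ q0(1)] q0(2) by simp
  show "?A \<in> sets haar" using o by (auto simp: sets_haar_iff)
  show "AE q in haar. q \<in> ?A \<longrightarrow> 1 / (F2 q - z) \<noteq> 1 / (F1 q - z)"
  proof (rule AE_I2, rule impI)
    fix q assume q: "q \<in> ?A"
    then have "1 / (F2 q - z) < 1 / (F1 q - z)"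
      using m[of q] m2[of q] z by (intro divide_strict_left_mono mult_pos_pos) auto
    then show "1 / (F2 q - z) \<noteq> 1 / (F1 q - z)" by (rule less_imp_neq)
  qed
  show "AE q in haar. 1 / (F2 q - z) \<le> 1 / (F1 q - z)"
  proof (rule AE_I2)
    fix q :: "real ^ 'n" assume "q \<in> space haar"
    then show "1 / (F2 q - z) \<le> 1 / (F1 q - z)"
      using m[of q] m2[of q] le[of q] z by (intro divide_left_mono mult_pos_pos) auto
  qed
qed

text \<open>Varying one coordinate of \<open>k\<close>: comparing \<open>\<pi>/2\<close> with \<open>-\<pi>/2\<close> forces \<open>sin K\<^sub>i = 0\<close>,
  and then \<open>0\<close> and \<open>\<pi>\<close> give different values.\<close>

lemma fiber_int_nonconstant:
  fixes K :: "real ^ 'n"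
  assumes z: "z < E_min K"
  shows "\<exists>p\<in>torus. fiber_int K z p \<noteq> c"
proof (rule ccontr)
  assume "\<not> (\<exists>p\<in>torus. fiber_int K z p \<noteq> c)"
  then have const: "fiber_int K z p = c" for p
    using fiber_int_wrap[of K z p] wrap_in_torus[of p] by metis
  define i :: 'n where "i = undefined"
  define F where "F t q = \<epsilon> (K - axis i t) + E_two (axis i t) q" for t q
  \<comment> \<open>The contribution of the other coordinates, the same for all \<open>t\<close>;
    only coordinate \<open>i\<close> of \<open>k\<close> is varied.\<close>
  define B where "B q = (\<Sum>j\<in>UNIV - {i}. (1 - cos (K $ j)) + (2 - 2 * cos (q $ j)))" for q :: "real ^ 'n"
  have F: "F t q = B q + ((1 - cos (K $ i - t)) + (2 - 2 * cos (t / 2) * cos (q $ i)))" for t q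
  proof -
    have "F t q = (\<Sum>j\<in>UNIV. (1 - cos ((K - axis i t) $ j)) + (2 - 2 * cos (axis i t $ j / 2) * cos (q $ j)))"
      unfolding F_def E_two_sum \<epsilon>_def by (simp add: sum.distrib[symmetric])
    also have "\<dots> = ((1 - cos (K $ i - t)) + (2 - 2 * cos (t / 2) * cos (q $ i)))
        + (\<Sum>j\<in>UNIV - {i}. (1 - cos ((K - axis i t) $ j)) + (2 - 2 * cos (axis i t $ j / 2) * cos (q $ j)))"
      by (subst sum.remove[of UNIV i]) (auto simp: axis_def)
    also have "(\<Sum>j\<in>UNIV - {i}. (1 - cos ((K - axis i t) $ j)) + (2 - 2 * cos (axis i t $ j / 2) * cos (q $ j))) = B q"
      unfolding B_def by (intro sum.cong) (auto simp: axis_def)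
    finally show ?thesis by simp
  qed
  have cont: "continuous_on UNIV (F t)" for t
    unfolding F_def[abs_def] by (intro continuous_intros continuous_E_two)
  have int: "(\<integral>q. 1 / (F t q - z) \<partial>haar) = c" for t
    unfolding F_def using const[of "K - axis i t"] fiber_int_eq[of K z "axis i t"] by simp
  \<comment> \<open>If the integral were constant in \<open>t\<close>, no two of the functions
    \<open>F t\<close> could be ordered with strict inequality somewhere.\<close>
  have no: False if "\<And>q. q \<in> torus \<Longrightarrow> F t q \<le> F t' q" "q0 \<in> torus" "F t q0 < F t' q0" for t t' q0
    using integral_inverse_diff_antimono_strict[OF cont cont, of "E_min K" t t' q0 z] that z E_min_le_shift int
    unfolding F_def by auto
  have t0: "(0 :: real ^ 'n) \<in> torus" by (simp add: torus_def)
  have c1: "0 \<le> 2 + 2 * cos (x::real)" "0 \<le> 2 - 2 * cos (x::real)" for x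
    using cos_ge_minus_one[of x] cos_le_one[of x] by linarith+
  have "sin (K $ i) = 0"
  proof (rule ccontr)
    assume ne: "sin (K $ i) \<noteq> 0"
    \<comment> \<open>At these two values \<open>cos (t / 2)\<close> agrees, so the pair energies
      are equal and only \<open>\<epsilon> (K - k)\<close> differs, by an amount independent of
      \<open>q\<close>.\<close>
    have d: "F (pi/2) q = F (- (pi/2)) q - 2 * sin (K $ i)" for q
      unfolding F by (simp add: cos_add cos_diff)
    show False
      using no[of "pi/2" "- (pi/2)" 0] no[of "- (pi/2)" "pi/2" 0] ne t0 unfolding d
      by (cases "sin (K $ i) > 0") auto
  qed
  then have "(cos (K $ i))\<^sup>2 = 1" using sin_cos_squared_add[of "K $ i"] by simp
  then consider "cos (K $ i) = 1" | "cos (K $ i) = - 1" by (auto simp: power2_eq_1_iff)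
  then show False
  proof cases
    case 1
    have d: "F pi q = F 0 q + (2 + 2 * cos (q $ i))" for q
      unfolding F using 1 by (simp add: cos_diff)
    show False by (rule no[of 0 pi 0]) (use d c1 t0 in auto)
  next
    case 2
    have d: "F 0 q = F pi q + (2 - 2 * cos (q $ i))" for q
      unfolding F using 2 by (simp add: cos_diff)
    \<comment> \<open>The difference \<open>2 - 2 * cos (q $ i)\<close> vanishes at the origin, so
      strictness is tested where the cosine is \<open>-1\<close>.\<close>
    let ?q = "\<chi> i. pi :: real ^ 'n"
    have "?q \<in> torus" by (simp add: torus_def)
    then show False by (rule no[of pi 0 ?q, rotated]) (use d c1 in auto)
  qed
qed

text \<open>Giving two bosons momentum \<open>pi\<close> in one coordinate changes the third by a
  full period, while each of the two gains energy 2. The interval is thus nondegenerate and has no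
  isolated points.\<close>

lemma E_min_less_E_max: "E_min K < E_max (K :: real ^ 'n)"
proof (rule ccontr)
  assume "\<not> E_min K < E_max K"
  then have eq: "E_three K p q = E_min K" for p q
    using E_min_le[of K p q] E_max_ge[of K p q] by linarith
  define i :: 'n where "i = undefined"
  have "E_three K (axis i pi) (axis i pi) = E_three K 0 0 + 4"
  proof -
    have "\<epsilon> (axis i pi :: real ^ 'n) = 2"
      unfolding \<epsilon>_def by (subst sum.remove[of UNIV i]) (auto simp: axis_def)
    moreover have "\<epsilon> (K - axis i pi - axis i pi) = \<epsilon> K"
      unfolding \<epsilon>_def
    proof (rule sum.cong[OF refl])
      fix j
      have "cos (x - 2 * pi) = cos x" for x :: real by (simp add: cos_diff)
      then show "1 - cos ((K - axis i pi - axis i pi) $ j) = 1 - cos (K $ j)" by (simp add: axis_def)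
    qed
    moreover have "\<epsilon> (0 :: real ^ 'n) = 0" by (simp add: \<epsilon>_def)
    ultimately show ?thesis by (simp add: E_three_def)
  qed
  then show False using eq by simp
qed

lemma resolvent_gap_below:
  assumes "z < E_min K" shows "resolvent_gap K z (E_min K - z)"
proof
  show "0 < E_min K - z" using assms by simp
  show "E_min K - z \<le> \<bar>E_three K p q - z\<bar>" for p q using E_min_le[of K p q] by linarith
qed

lemma resolvent_gap_above:
  assumes "E_max K < z" shows "resolvent_gap K z (z - E_max K)"
proof
  show "0 < z - E_max K" using assms by simp
  show "z - E_max K \<le> \<bar>E_three K p q - z\<bar>" for p q using E_max_ge[of K p q] by linarith
qed

lemma (in resolvent_gap) r_eq_fiber_int: "r = fiber_int K z"
  by (simp add: fun_eq_iff r_def R_def fiber_int_def)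

lemma continuous_fiber_int: "z < E_min K \<Longrightarrow> continuous_on A (fiber_int K z)"
  using resolvent_gap.continuous_r[OF resolvent_gap_below] resolvent_gap.r_eq_fiber_int[OF resolvent_gap_below]
  by metis

lemma fiber_int_strict_mono:
  assumes "z < z'" "z' < E_min K" shows "fiber_int K z p < fiber_int K z' p"
  unfolding fiber_int_def
  by (rule integral_inverse_diff_strict_mono[OF E_three_section_measurable E_min_le assms])

lemma tendsto_fiber_int:
  assumes z: "z < E_min K" shows "((\<lambda>y. fiber_int K y p) \<longlongrightarrow> fiber_int K z p) (at z)"
proof -
  define b where "b = (z + E_min K) / 2"
  have b: "z < b" "b < E_min K" using z by (auto simp: b_def)
  have "continuous_on {..b} (\<lambda>y. fiber_int K y p)"
    unfolding fiber_int_def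
    by (rule continuous_integral_inverse_diff[OF E_three_section_measurable E_min_le b(2)])
  then have "isCont (\<lambda>y. fiber_int K y p) z"
    by (rule continuous_on_interior) (use b in simp)
  then show ?thesis by (simp add: isCont_def)
qed

text \<open>The set predicted by the Hunziker-van Winter-Zhislin principle: a dimer with a free
  boson, or three free bosons.\<close>

definition hvz_set :: "real \<Rightarrow> real ^ 'n \<Rightarrow> real set" where
  "hvz_set \<mu> K = (\<Union>k\<in>torus. {e_two \<mu> k + \<epsilon> (K - k)}) \<union> {E_min K..E_max K}"

lemma fiber_zero_in_hvz_set:
  fixes K :: "real ^ 'n"
  assumes n: "CARD('n) = 1 \<or> CARD('n) = 2" and \<mu>: "\<mu> < 0" and z: "z < E_min K"
    and zero: "1 + \<mu> * fiber_int K z p = 0"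
  shows "z \<in> hvz_set \<mu> K"
proof -
  have "z = e_two \<mu> (wrap (K - p)) + \<epsilon> (K - wrap (K - p))"
    using fiber_zero_iff[OF n \<mu> z wrap_in_torus, of "K - p"] zero fiber_int_reparam(1)[of K z p] by simp
  then show ?thesis unfolding hvz_set_def using wrap_in_torus by blast
qed

text \<open>Binding lowers the energy: \<open>e_two \<mu> k\<close> is below every value of
  \<open>E_two k\<close>, so a branch point lies below some value of \<open>E_three K\<close>. If
  outside the interval, it must be below \<open>E_min K\<close>, where the branch is described by
  zeros of the determinant.\<close>

lemma hvz_setE:
  fixes K :: "real ^ 'n"
  assumes n: "CARD('n) = 1 \<or> CARD('n) = 2" and \<mu>: "\<mu> < 0" and z: "z \<in> hvz_set \<mu> K"
  obtains "z \<in> {E_min K..E_max K}"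
  | p where "z < E_min K" "p \<in> torus" "1 + \<mu> * fiber_int K z p = 0"
proof (cases "z \<in> {E_min K..E_max K}")
  case False
  then obtain k where k: "k \<in> torus" "z = e_two \<mu> k + \<epsilon> (K - k)" using z by (auto simp: hvz_set_def)
  \<comment> \<open>The second \<open>k\<close> merely serves as some point of the torus.\<close>
  have "e_two \<mu> k < E_two k k"
    using e_two_props(1)[OF n k(1) \<mu>] E_two_INF_le[OF k(1), of k] by linarith
  then have "z < E_three K (K - k) ((1/2) *\<^sub>R k + k)" using k(2) unfolding E_three_shift by simp
  also have "\<dots> \<le> E_max K" by (rule E_max_ge)
  finally have zm: "z < E_min K" using False by auto
  have "1 + \<mu> * fiber_int K z (K - k) = 0"
    using fiber_zero_iff[OF n \<mu> zm k(1)] k(2) by simp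
  then have "1 + \<mu> * fiber_int K z (wrap (K - k)) = 0" by (simp add: fiber_int_wrap)
  then show ?thesis by (rule that(2)[OF zm wrap_in_torus])
qed (rule that(1))

text \<open>Moving \<open>z\<close> slightly changes the sign of \<open>1 + \<mu> * fiber_int K z p\<close> at the zero, but not at a point
  where it is nonzero; the connectedness of the torus then provides a zero for the new \<open>z\<close>.\<close>

lemma hvz_set_perfect:
  fixes K :: "real ^ 'n"
  assumes n: "CARD('n) = 1 \<or> CARD('n) = 2" and \<mu>: "\<mu> < 0" and z: "z \<in> hvz_set \<mu> K" and e: "0 < e"
  shows "\<exists>y\<in>hvz_set \<mu> K. y \<noteq> z \<and> \<bar>y - z\<bar> < e"
  using n \<mu> z
proof (cases rule: hvz_setE)
  case 1
  \<comment> \<open>Move right if there is room, otherwise left; the interval is nondegenerate, so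
    one direction is always available.\<close>
  define y where "y = (if z < E_max K then min (E_max K) (z + e / 2) else max (E_min K) (z - e / 2))"
  have "y \<in> {E_min K..E_max K}" "y \<noteq> z" "\<bar>y - z\<bar> < e"
    using 1 e E_min_less_E_max[of K] by (auto simp: y_def min_def max_def)
  then show ?thesis by (auto simp: hvz_set_def)
next
  case (2 p0)
  note zm = 2(1)
  define D where "D y p = 1 + \<mu> * fiber_int K y p" for y p
  obtain p1 where p1: "p1 \<in> torus" "fiber_int K z p1 \<noteq> - 1 / \<mu>"
    using fiber_int_nonconstant[OF zm] by blast
  then have D1: "D z p1 \<noteq> 0" using \<mu> by (auto simp: D_def field_simps)
  have D_anti: "D y' p < D y p" if "y < y'" "y' < E_min K" for y y' p
    using fiber_int_strict_mono[OF that, of p] \<mu> by (simp add: D_def)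
  have limD: "((\<lambda>y. D y p1) \<longlongrightarrow> D z p1) (at z)"
    unfolding D_def by (intro tendsto_intros tendsto_fiber_int zm)
  have zero: "\<exists>p. D y p = 0" if y: "y < E_min K" and sgn: "D y a < 0" "0 < D y b" "a \<in> torus" "b \<in> torus" for y a b
  proof -
    have "continuous_on torus (D y)"
      unfolding D_def[abs_def] by (intro continuous_intros continuous_fiber_int y)
    then have "connected (D y ` torus)" by (rule connected_continuous_image[OF _ connected_torus])
    then have "{D y a..D y b} \<subseteq> D y ` torus"
      by (rule connected_contains_Icc) (use sgn in auto)
    then have "0 \<in> D y ` torus" using sgn(1,2) by (auto simp: subset_iff)
    then show ?thesis by force
  qed
  have D0: "D z p0 = 0" using 2(3) by (simp add: D_def)
  \<comment> \<open>The sign \<open>s\<close> selects the side of \<open>z\<close>; the step is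
    capped so that the new point stays within \<open>e\<close> of \<open>z\<close> and below
    \<open>E_min K\<close>.\<close>
  have near: "\<exists>y. P y \<and> y \<noteq> z \<and> \<bar>y - z\<bar> < e \<and> y < E_min K \<and> (0 < s \<longleftrightarrow> z < y)"
    if "eventually P (at z)" "s = 1 \<or> s = -1" for P and s :: real
  proof -
    obtain d where d: "0 < d" "\<And>y. y \<noteq> z \<Longrightarrow> dist y z < d \<Longrightarrow> P y"
      using \<open>eventually P (at z)\<close> unfolding eventually_at by blast
    define h where "h = min (d / 2) (min (e / 2) ((E_min K - z) / 2))"
    have hh: "h \<le> d / 2" "h \<le> e / 2" "h \<le> (E_min K - z) / 2" "0 < h"
      using d(1) e zm unfolding h_def by (simp_all only: min_def split: if_split) auto
    have "(E_min K - z) / 2 < E_min K - z" using zm by (simp add: field_simps)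
    with hh(3) have "h < E_min K - z" by (rule le_less_trans)
    with hh d(1) e have h: "0 < h" "h < d" "h < e" "h < E_min K - z" by simp_all
    have "P (z + s * h)" by (rule d(2)) (use h that(2) in \<open>auto simp: dist_real_def\<close>)
    then show ?thesis using h that(2) by (intro exI[of _ "z + s * h"]) auto
  qed
  have "\<exists>y p. y < E_min K \<and> y \<noteq> z \<and> \<bar>y - z\<bar> < e \<and> D y p = 0"
  proof (cases "0 < D z p1")
    \<comment> \<open>With \<open>D z p1\<close> positive, \<open>y\<close> is raised:
      \<open>D\<close> decreases in \<open>y\<close>, so it becomes negative at \<open>p0\<close>
      while staying positive at \<open>p1\<close>. In the other case \<open>y\<close> is
      lowered.\<close>
    case True
    then obtain y where y: "0 < D y p1" "\<bar>y - z\<bar> < e" "y < E_min K" "z < y"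
      using near[OF order_tendstoD(1)[OF limD True], of 1] by auto
    have "D y p0 < 0" using D_anti[OF y(4,3), of p0] D0 by simp
    then show ?thesis using zero[OF y(3) _ y(1) 2(2) p1(1)] y by force
  next
    case False
    then have neg: "D z p1 < 0" using D1 by simp
    then obtain y where y: "D y p1 < 0" "\<bar>y - z\<bar> < e" "y < E_min K" "y < z"
      using near[OF order_tendstoD(2)[OF limD neg], of "-1"] by force
    have "0 < D y p0" using D_anti[OF y(4) zm, of p0] D0 by simp
    then show ?thesis using zero[OF y(3) y(1) _ p1(1) 2(2)] y by force
  qed
  then show ?thesis using fiber_zero_in_hvz_set[OF n \<mu>, of _ K] unfolding D_def by blast
qed

theorem theorem4p2:
  fixes \<mu> :: real and K :: "real ^ 'n"
  assumes "CARD('n) = 1 \<or> CARD('n) = 2" and "\<mu> < 0" and "K \<in> torus"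
  shows "essential_spectrum (haar \<Otimes>\<^sub>M haar) (L2_sym K) (H_op \<mu> K) =
    of_real ` ((\<Union>k\<in>torus. {e_two \<mu> k + \<epsilon> (K - k)}) \<union> {E_min K .. E_max K})"
proof -
  interpret symmetric_operator haar_sq "L2_sym K" "H_op \<mu> K" "6 * CARD('n) + 3 * \<bar>\<mu>\<bar>"
    by (rule symmetric_operator_H_op)
  note n = assms(1) and \<mu> = assms(2)
  have "essential_spectrum haar_sq (L2_sym K) (H_op \<mu> K) = of_real ` hvz_set \<mu> K"
  proof (rule essential_spectrum_eqI)
    fix z assume "z \<in> hvz_set \<mu> K"
    with n \<mu> show "\<not> bounded_below (of_real z)"
    proof (cases rule: hvz_setE)
      case 1
      then show ?thesis by (rule not_bounded_below_interval)
    next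
      case (2 p)
      interpret resolvent_gap K z "E_min K - z" by (rule resolvent_gap_below[OF 2(1)])
      show ?thesis by (rule not_bounded_below_of_zero[OF 2(2)]) (simp add: r_eq_fiber_int 2(3))
    qed
  next
    fix z e :: real assume "z \<in> hvz_set \<mu> K" "0 < e"
    then show "\<exists>y\<in>hvz_set \<mu> K. y \<noteq> z \<and> \<bar>y - z\<bar> < e" by (rule hvz_set_perfect[OF n \<mu>])
  next
    fix z assume z: "z \<notin> hvz_set \<mu> K"
    then consider "z < E_min K" | "E_max K < z" by (force simp: hvz_set_def)
    then show "relatively_compact_at (of_real z)"
    proof cases
      case 1
      interpret resolvent_gap K z "E_min K - z" by (rule resolvent_gap_below[OF 1])
      show ?thesis
        by (rule relatively_compact) (use fiber_zero_in_hvz_set[OF n \<mu> 1] z in \<open>auto simp: r_eq_fiber_int\<close>)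
    next
      case 2
      interpret resolvent_gap K z "z - E_max K" by (rule resolvent_gap_above[OF 2])
      \<comment> \<open>Above the interval \<open>r\<close> is nonpositive, and so is
        \<open>\<mu>\<close>; hence \<open>1 + \<mu> * r p \<ge> 1\<close> and an attractive
        interaction creates no branch there.\<close>
      have "R p q \<le> 0" for p q
        using E_max_ge[of K p q] 2 by (simp add: R_def divide_nonneg_neg)
      then have "0 \<le> (\<integral>q. - R p q \<partial>haar)" for p
        by (intro Bochner_Integration.integral_nonneg) simp
      then have "r p \<le> 0" for p by (simp add: r_def)
      then have "0 \<le> \<mu> * r p" for p using \<mu> by (simp add: mult_nonpos_nonpos)
      then show ?thesis by (intro relatively_compact) (smt (verit))
    qed
  qed
  then show ?thesis by (simp add: hvz_set_def)
qed

end
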